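(* A bicategory of relations is the same thing as a unitary pre-tabular allegory. That is: every bicategory of relations, equipped with its canonical identity-on-objects involution $(-)^\circ$ and its local binary products $r \cap s = d^\bullet(r \otimes s)d$, is a unitary pre-tabular allegory; and conversely every unitary pre-tabular allegory is a bicategory of relations.
   Context: A map in a locally ordered 2-category is a morphism $f$ having a right adjoint, written $f^\bullet$. Allegories. An allegory is a strict 2-category $\mathcal{A}$ whose hom-categories are posets with binary meets $\cap$, equipped with a strict involution $(-)^\circ\colon\mathcal{A}^{\mathrm{op}}\to\mathcal{A}$ that is the identity on objects and satisfies the modular law $sr\cap t\le(s\cap t r^\circ)r$ for all suitably typed $r,s,t$. (Top elements of hom-posets, and preservation of meets by composition, are not required.) A tabulation of $r\colon X\to Y$ is a pair of maps $f\colon Z\to X$, $g\colon Z\to Y$ with $r=gf^\circ$ and $f^\circ f\cap g^\circ g=1$. An allegory is pre-tabular if every morphism is contained in (is $\leq$) one that has a tabulation. A unit is an object $U$ such that $1_U$ is the top element of $\mathcal{A}(U,U)$ and for every $X$ there is $p\colon X\to U$ with $p^\circ p\ge1$; an allegory is unitary if it has a unit. Bicategories of relations. A (locally ordered) cartesian bicategory is a locally partially ordered 2-category $\mathcal{C}$ such that: (1) $\mathcal{C}$ is symmetric monoidal, with $\otimes\colon\mathcal{C}\times\mathcal{C}\to\mathcal{C}$ a pseudofunctor and coherent natural isomorphisms, with unit $I$; (2) every object $X$ is a commutative comonoid via maps $d_X\colon X\to X\otimes X$ and $e_X\colon X\to I$ (with right adjoints $d_X^\bullet$, $e_X^\bullet$),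 and this is the only such comonoid structure on $X$; (3) every morphism $r\colon X\to Y$ satisfies $d_Y r\le(r\otimes r)d_X$ and $e_Y r\le e_X$. A bicategory of relations is a cartesian bicategory in which every object is Frobenius: $d\,d^\bullet=(d^\bullet\otimes1)(1\otimes d)$. In a bicategory of relations every object $Y$ is self-dual with unit $d_Ye_Y^\bullet\colon I\to Y\otimes Y$ and counit $e_Yd_Y^\bullet\colon Y\otimes Y\to I$; the involution $(-)^\circ$ sends a morphism $s\colon Y'\to Y$ to its transpose $Y\to Y'$ with respect to these dualities. *)

theory Defs
  imports Main
begin

section \<open>Locally partially ordered 2-categories\<close>

text \<open>
  Composition is written in applicative order: \<open>g \<cdot> f\<close> is \<open>f\<close> followed by \<open>g\<close>. All operations
  are total HOL functions, constrained only on the carriers and on composable or parallel arrows.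
\<close>

record ('o, 'a) cat2 =
  Ob  :: "'o set"
  Arr :: "'a set"
  Src :: "'a \<Rightarrow> 'o"
  Trg :: "'a \<Rightarrow> 'o"
  Idn :: "'o \<Rightarrow> 'a" ("\<one>\<index>")
  Cmp :: "'a \<Rightarrow> 'a \<Rightarrow> 'a" (infixr "\<cdot>\<index>" 75)
  Leq :: "'a \<Rightarrow> 'a \<Rightarrow> bool" (infix "\<preceq>\<index>" 50)

definition Hom :: "('o, 'a) cat2 \<Rightarrow> 'o \<Rightarrow> 'o \<Rightarrow> 'a set"
  where "Hom C X Y = {f \<in> Arr C. Src C f = X \<and> Trg C f = Y}"

text \<open>
  Since the 2-cells form posets, the associativity and unit constraints of such a 2-category are
  equalities, as are naturality and functoriality constraints below.
\<close>

locale locally_ordered_2_category =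
  fixes C :: "('o, 'a) cat2" (structure)
  assumes Src_Ob: "f \<in> Arr C \<Longrightarrow> Src C f \<in> Ob C"
    and Trg_Ob: "f \<in> Arr C \<Longrightarrow> Trg C f \<in> Ob C"
    and Idn_Hom: "X \<in> Ob C \<Longrightarrow> \<one> X \<in> Hom C X X"
    and Cmp_Hom: "\<lbrakk>f \<in> Hom C X Y; g \<in> Hom C Y Z\<rbrakk> \<Longrightarrow> g \<cdot> f \<in> Hom C X Z"
    and Idn_left: "f \<in> Hom C X Y \<Longrightarrow> \<one> Y \<cdot> f = f"
    and Idn_right: "f \<in> Hom C X Y \<Longrightarrow> f \<cdot> \<one> X = f"
    and Cmp_assoc: "\<lbrakk>f \<in> Hom C W X; g \<in> Hom C X Y; h \<in> Hom C Y Z\<rbrakk>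
      \<Longrightarrow> (h \<cdot> g) \<cdot> f = h \<cdot> (g \<cdot> f)"
    and Leq_refl: "f \<in> Hom C X Y \<Longrightarrow> f \<preceq> f"
    and Leq_antisym: "\<lbrakk>f \<in> Hom C X Y; g \<in> Hom C X Y; f \<preceq> g; g \<preceq> f\<rbrakk> \<Longrightarrow> f = g"
    and Leq_trans: "\<lbrakk>f \<in> Hom C X Y; g \<in> Hom C X Y; h \<in> Hom C X Y; f \<preceq> g; g \<preceq> h\<rbrakk> \<Longrightarrow> f \<preceq> h"
    and Cmp_mono: "\<lbrakk>f \<in> Hom C X Y; f' \<in> Hom C X Y; g \<in> Hom C Y Z; g' \<in> Hom C Y Z;
      f \<preceq> f'; g \<preceq> g'\<rbrakk> \<Longrightarrow> g \<cdot> f \<preceq> g' \<cdot> f'"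

definition adjoint :: "('o, 'a) cat2 \<Rightarrow> 'a \<Rightarrow> 'a \<Rightarrow> bool"
  where "adjoint C f u \<longleftrightarrow> f \<in> Arr C \<and> u \<in> Hom C (Trg C f) (Src C f) \<and>
    \<one>\<^bsub>C\<^esub> (Src C f) \<preceq>\<^bsub>C\<^esub> u \<cdot>\<^bsub>C\<^esub> f \<and> f \<cdot>\<^bsub>C\<^esub> u \<preceq>\<^bsub>C\<^esub> \<one>\<^bsub>C\<^esub> (Trg C f)"

definition is_map :: "('o, 'a) cat2 \<Rightarrow> 'a \<Rightarrow> bool"
  where "is_map C f \<longleftrightarrow> (\<exists>u. adjoint C f u)"

text \<open>Right adjoints and inverses are unique whenever they exist.\<close>

definition radj :: "('o, 'a) cat2 \<Rightarrow> 'a \<Rightarrow> 'a"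
  where "radj C f = (THE u. adjoint C f u)"

definition inverse_arrows :: "('o, 'a) cat2 \<Rightarrow> 'a \<Rightarrow> 'a \<Rightarrow> bool"
  where "inverse_arrows C f g \<longleftrightarrow> f \<in> Arr C \<and> g \<in> Hom C (Trg C f) (Src C f) \<and>
    g \<cdot>\<^bsub>C\<^esub> f = \<one>\<^bsub>C\<^esub> (Src C f) \<and> f \<cdot>\<^bsub>C\<^esub> g = \<one>\<^bsub>C\<^esub> (Trg C f)"

definition is_iso :: "('o, 'a) cat2 \<Rightarrow> 'a \<Rightarrow> bool"
  where "is_iso C f \<longleftrightarrow> (\<exists>g. inverse_arrows C f g)"

definition inv_arr :: "('o, 'a) cat2 \<Rightarrow> 'a \<Rightarrow> 'a"
  where "inv_arr C f = (THE g. inverse_arrows C f g)"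


section \<open>Allegories\<close>

locale allegory = locally_ordered_2_category C
  for C :: "('o, 'a) cat2" (structure)
    and meet :: "'a \<Rightarrow> 'a \<Rightarrow> 'a" (infixl "\<sqinter>" 70)
    and invol :: "'a \<Rightarrow> 'a" ("_\<degree>" [1000] 1000) +
  assumes meet_Hom: "\<lbrakk>r \<in> Hom C X Y; s \<in> Hom C X Y\<rbrakk> \<Longrightarrow> r \<sqinter> s \<in> Hom C X Y"
    and meet_le1: "\<lbrakk>r \<in> Hom C X Y; s \<in> Hom C X Y\<rbrakk> \<Longrightarrow> r \<sqinter> s \<preceq> r"
    and meet_le2: "\<lbrakk>r \<in> Hom C X Y; s \<in> Hom C X Y\<rbrakk> \<Longrightarrow> r \<sqinter> s \<preceq> s"
    and meet_greatest: "\<lbrakk>r \<in> Hom C X Y; s \<in> Hom C X Y; t \<in> Hom C X Y; t \<preceq> r; t \<preceq> s\<rbrakk>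
      \<Longrightarrow> t \<preceq> r \<sqinter> s"
    and invol_Hom: "r \<in> Hom C X Y \<Longrightarrow> r\<degree> \<in> Hom C Y X"
    and invol_Idn: "X \<in> Ob C \<Longrightarrow> (\<one> X)\<degree> = \<one> X"
    and invol_Cmp: "\<lbrakk>r \<in> Hom C X Y; s \<in> Hom C Y Z\<rbrakk> \<Longrightarrow> (s \<cdot> r)\<degree> = r\<degree> \<cdot> s\<degree>"
    and invol_mono: "\<lbrakk>r \<in> Hom C X Y; s \<in> Hom C X Y; r \<preceq> s\<rbrakk> \<Longrightarrow> r\<degree> \<preceq> s\<degree>"
    and invol_invol: "r \<in> Hom C X Y \<Longrightarrow> r\<degree>\<degree> = r"
    and modular: "\<lbrakk>r \<in> Hom C X Y; s \<in> Hom C Y Z; t \<in> Hom C X Z\<rbrakk>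
      \<Longrightarrow> (s \<cdot> r) \<sqinter> t \<preceq> (s \<sqinter> (t \<cdot> r\<degree>)) \<cdot> r"
begin

definition tabulation :: "'a \<Rightarrow> 'a \<Rightarrow> 'a \<Rightarrow> bool"
  where "tabulation r f g \<longleftrightarrow> r \<in> Arr C \<and>
    (\<exists>Z. f \<in> Hom C Z (Src C r) \<and> g \<in> Hom C Z (Trg C r) \<and> is_map C f \<and> is_map C g \<and>
      r = g \<cdot> f\<degree> \<and> (f\<degree> \<cdot> f) \<sqinter> (g\<degree> \<cdot> g) = \<one> Z)"

definition is_unit :: "'o \<Rightarrow> bool"
  where "is_unit U \<longleftrightarrow> U \<in> Ob C \<and> (\<forall>r \<in> Hom C U U. r \<preceq> \<one> U) \<and>
    (\<forall>X \<in> Ob C. \<exists>p \<in> Hom C X U. \<one> X \<preceq> p\<degree> \<cdot> p)"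

end

locale unitary_pre_tabular_allegory = allegory +
  assumes pre_tabular: "r \<in> Hom C X Y \<Longrightarrow> \<exists>r' \<in> Hom C X Y. r \<preceq> r' \<and> (\<exists>f g. tabulation r' f g)"
    and unitary: "\<exists>U. is_unit U"


section \<open>Cartesian bicategories and bicategories of relations\<close>

record ('o, 'a) monoidal =
  TenO  :: "'o \<Rightarrow> 'o \<Rightarrow> 'o" (infixr "\<odot>\<index>" 80)
  TenA  :: "'a \<Rightarrow> 'a \<Rightarrow> 'a" (infixr "\<otimes>\<index>" 80)
  UnitO :: "'o" ("\<I>\<index>")
  Assoc :: "'o \<Rightarrow> 'o \<Rightarrow> 'o \<Rightarrow> 'a" ("\<a>\<index>")
  LUnit :: "'o \<Rightarrow> 'a" ("\<l>\<index>")
  RUnit :: "'o \<Rightarrow> 'a" ("\<r>\<index>")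
  Swap  :: "'o \<Rightarrow> 'o \<Rightarrow> 'a" ("\<s>\<index>")
  Diag  :: "'o \<Rightarrow> 'a" ("\<d>\<index>")
  Aug   :: "'o \<Rightarrow> 'a" ("\<e>\<index>")

text \<open>
  Directions: \<open>\<a> X Y Z : (X \<odot> Y) \<odot> Z \<rightarrow> X \<odot> (Y \<odot> Z)\<close>, \<open>\<l> X : \<I> \<odot> X \<rightarrow> X\<close>, \<open>\<r> X : X \<odot> \<I> \<rightarrow> X\<close>,
  \<open>\<s> X Y : X \<odot> Y \<rightarrow> Y \<odot> X\<close>.
\<close>

locale symmetric_monoidal_2_category = locally_ordered_2_category C
  for C :: "('o, 'a) cat2" (structure)
    and M :: "('o, 'a) monoidal" (structure) +
  assumes UnitO_Ob: "\<I>\<^bsub>M\<^esub> \<in> Ob C"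
    and TenO_Ob: "\<lbrakk>X \<in> Ob C; Y \<in> Ob C\<rbrakk> \<Longrightarrow> X \<odot>\<^bsub>M\<^esub> Y \<in> Ob C"
    and TenA_Hom: "\<lbrakk>f \<in> Hom C X X'; g \<in> Hom C Y Y'\<rbrakk>
      \<Longrightarrow> f \<otimes>\<^bsub>M\<^esub> g \<in> Hom C (X \<odot>\<^bsub>M\<^esub> Y) (X' \<odot>\<^bsub>M\<^esub> Y')"
    and TenA_Idn: "\<lbrakk>X \<in> Ob C; Y \<in> Ob C\<rbrakk> \<Longrightarrow> \<one> X \<otimes>\<^bsub>M\<^esub> \<one> Y = \<one> (X \<odot>\<^bsub>M\<^esub> Y)"
    and TenA_Cmp: "\<lbrakk>f \<in> Hom C X X'; f' \<in> Hom C X' X''; g \<in> Hom C Y Y'; g' \<in> Hom C Y' Y''\<rbrakk>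
      \<Longrightarrow> (f' \<cdot> f) \<otimes>\<^bsub>M\<^esub> (g' \<cdot> g) = (f' \<otimes>\<^bsub>M\<^esub> g') \<cdot> (f \<otimes>\<^bsub>M\<^esub> g)"
    and TenA_mono: "\<lbrakk>f \<in> Hom C X X'; f' \<in> Hom C X X'; g \<in> Hom C Y Y'; g' \<in> Hom C Y Y';
      f \<preceq> f'; g \<preceq> g'\<rbrakk> \<Longrightarrow> f \<otimes>\<^bsub>M\<^esub> g \<preceq> f' \<otimes>\<^bsub>M\<^esub> g'"
    and Assoc_Hom: "\<lbrakk>X \<in> Ob C; Y \<in> Ob C; Z \<in> Ob C\<rbrakk>
      \<Longrightarrow> \<a>\<^bsub>M\<^esub> X Y Z \<in> Hom C ((X \<odot>\<^bsub>M\<^esub> Y) \<odot>\<^bsub>M\<^esub> Z) (X \<odot>\<^bsub>M\<^esub> (Y \<odot>\<^bsub>M\<^esub> Z))"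
    and LUnit_Hom: "X \<in> Ob C \<Longrightarrow> \<l>\<^bsub>M\<^esub> X \<in> Hom C (\<I>\<^bsub>M\<^esub> \<odot>\<^bsub>M\<^esub> X) X"
    and RUnit_Hom: "X \<in> Ob C \<Longrightarrow> \<r>\<^bsub>M\<^esub> X \<in> Hom C (X \<odot>\<^bsub>M\<^esub> \<I>\<^bsub>M\<^esub>) X"
    and Swap_Hom: "\<lbrakk>X \<in> Ob C; Y \<in> Ob C\<rbrakk> \<Longrightarrow> \<s>\<^bsub>M\<^esub> X Y \<in> Hom C (X \<odot>\<^bsub>M\<^esub> Y) (Y \<odot>\<^bsub>M\<^esub> X)"
    and Assoc_iso: "\<lbrakk>X \<in> Ob C; Y \<in> Ob C; Z \<in> Ob C\<rbrakk> \<Longrightarrow> is_iso C (\<a>\<^bsub>M\<^esub> X Y Z)"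
    and LUnit_iso: "X \<in> Ob C \<Longrightarrow> is_iso C (\<l>\<^bsub>M\<^esub> X)"
    and RUnit_iso: "X \<in> Ob C \<Longrightarrow> is_iso C (\<r>\<^bsub>M\<^esub> X)"
    and Swap_Swap: "\<lbrakk>X \<in> Ob C; Y \<in> Ob C\<rbrakk> \<Longrightarrow> \<s>\<^bsub>M\<^esub> Y X \<cdot> \<s>\<^bsub>M\<^esub> X Y = \<one> (X \<odot>\<^bsub>M\<^esub> Y)"
    and Assoc_natural: "\<lbrakk>f \<in> Hom C X X'; g \<in> Hom C Y Y'; h \<in> Hom C Z Z'\<rbrakk>
      \<Longrightarrow> \<a>\<^bsub>M\<^esub> X' Y' Z' \<cdot> ((f \<otimes>\<^bsub>M\<^esub> g) \<otimes>\<^bsub>M\<^esub> h) = (f \<otimes>\<^bsub>M\<^esub> (g \<otimes>\<^bsub>M\<^esub> h)) \<cdot> \<a>\<^bsub>M\<^esub> X Y Z"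
    and LUnit_natural: "f \<in> Hom C X X' \<Longrightarrow> \<l>\<^bsub>M\<^esub> X' \<cdot> (\<one> \<I>\<^bsub>M\<^esub> \<otimes>\<^bsub>M\<^esub> f) = f \<cdot> \<l>\<^bsub>M\<^esub> X"
    and RUnit_natural: "f \<in> Hom C X X' \<Longrightarrow> \<r>\<^bsub>M\<^esub> X' \<cdot> (f \<otimes>\<^bsub>M\<^esub> \<one> \<I>\<^bsub>M\<^esub>) = f \<cdot> \<r>\<^bsub>M\<^esub> X"
    and Swap_natural: "\<lbrakk>f \<in> Hom C X X'; g \<in> Hom C Y Y'\<rbrakk>
      \<Longrightarrow> \<s>\<^bsub>M\<^esub> X' Y' \<cdot> (f \<otimes>\<^bsub>M\<^esub> g) = (g \<otimes>\<^bsub>M\<^esub> f) \<cdot> \<s>\<^bsub>M\<^esub> X Y"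
    and triangle: "\<lbrakk>X \<in> Ob C; Y \<in> Ob C\<rbrakk>
      \<Longrightarrow> (\<one> X \<otimes>\<^bsub>M\<^esub> \<l>\<^bsub>M\<^esub> Y) \<cdot> \<a>\<^bsub>M\<^esub> X \<I>\<^bsub>M\<^esub> Y = \<r>\<^bsub>M\<^esub> X \<otimes>\<^bsub>M\<^esub> \<one> Y"
    and pentagon: "\<lbrakk>W \<in> Ob C; X \<in> Ob C; Y \<in> Ob C; Z \<in> Ob C\<rbrakk>
      \<Longrightarrow> \<a>\<^bsub>M\<^esub> W X (Y \<odot>\<^bsub>M\<^esub> Z) \<cdot> \<a>\<^bsub>M\<^esub> (W \<odot>\<^bsub>M\<^esub> X) Y Z =
        (\<one> W \<otimes>\<^bsub>M\<^esub> \<a>\<^bsub>M\<^esub> X Y Z) \<cdot> \<a>\<^bsub>M\<^esub> W (X \<odot>\<^bsub>M\<^esub> Y) Z \<cdot> (\<a>\<^bsub>M\<^esub> W X Y \<otimes>\<^bsub>M\<^esub> \<one> Z)"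
    and hexagon: "\<lbrakk>X \<in> Ob C; Y \<in> Ob C; Z \<in> Ob C\<rbrakk>
      \<Longrightarrow> \<a>\<^bsub>M\<^esub> Y Z X \<cdot> \<s>\<^bsub>M\<^esub> X (Y \<odot>\<^bsub>M\<^esub> Z) \<cdot> \<a>\<^bsub>M\<^esub> X Y Z =
        (\<one> Y \<otimes>\<^bsub>M\<^esub> \<s>\<^bsub>M\<^esub> X Z) \<cdot> \<a>\<^bsub>M\<^esub> Y X Z \<cdot> (\<s>\<^bsub>M\<^esub> X Y \<otimes>\<^bsub>M\<^esub> \<one> Z)"

definition map_comonoid :: "('o, 'a) cat2 \<Rightarrow> ('o, 'a) monoidal \<Rightarrow> 'o \<Rightarrow> 'a \<Rightarrow> 'a \<Rightarrow> bool"
  where "map_comonoid C M X d e \<longleftrightarrow>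
    d \<in> Hom C X (X \<odot>\<^bsub>M\<^esub> X) \<and> e \<in> Hom C X \<I>\<^bsub>M\<^esub> \<and> is_map C d \<and> is_map C e \<and>
    \<a>\<^bsub>M\<^esub> X X X \<cdot>\<^bsub>C\<^esub> (d \<otimes>\<^bsub>M\<^esub> \<one>\<^bsub>C\<^esub> X) \<cdot>\<^bsub>C\<^esub> d = (\<one>\<^bsub>C\<^esub> X \<otimes>\<^bsub>M\<^esub> d) \<cdot>\<^bsub>C\<^esub> d \<and>
    \<l>\<^bsub>M\<^esub> X \<cdot>\<^bsub>C\<^esub> (e \<otimes>\<^bsub>M\<^esub> \<one>\<^bsub>C\<^esub> X) \<cdot>\<^bsub>C\<^esub> d = \<one>\<^bsub>C\<^esub> X \<and>
    \<r>\<^bsub>M\<^esub> X \<cdot>\<^bsub>C\<^esub> (\<one>\<^bsub>C\<^esub> X \<otimes>\<^bsub>M\<^esub> e) \<cdot>\<^bsub>C\<^esub> d = \<one>\<^bsub>C\<^esub> X \<and>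
    \<s>\<^bsub>M\<^esub> X X \<cdot>\<^bsub>C\<^esub> d = d"

locale cartesian_bicategory = symmetric_monoidal_2_category +
  assumes comonoid: "X \<in> Ob C \<Longrightarrow> map_comonoid C M X (\<d>\<^bsub>M\<^esub> X) (\<e>\<^bsub>M\<^esub> X)"
    and comonoid_unique: "\<lbrakk>X \<in> Ob C; map_comonoid C M X d e\<rbrakk> \<Longrightarrow> d = \<d>\<^bsub>M\<^esub> X \<and> e = \<e>\<^bsub>M\<^esub> X"
    and lax_Diag: "r \<in> Hom C X Y \<Longrightarrow> \<d>\<^bsub>M\<^esub> Y \<cdot> r \<preceq> (r \<otimes>\<^bsub>M\<^esub> r) \<cdot> \<d>\<^bsub>M\<^esub> X"
    and lax_Aug: "r \<in> Hom C X Y \<Longrightarrow> \<e>\<^bsub>M\<^esub> Y \<cdot> r \<preceq> \<e>\<^bsub>M\<^esub> X"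

locale bicategory_of_relations = cartesian_bicategory +
  assumes Frobenius: "X \<in> Ob C \<Longrightarrow> \<d>\<^bsub>M\<^esub> X \<cdot> radj C (\<d>\<^bsub>M\<^esub> X) =
    (radj C (\<d>\<^bsub>M\<^esub> X) \<otimes>\<^bsub>M\<^esub> \<one> X) \<cdot> inv_arr C (\<a>\<^bsub>M\<^esub> X X X) \<cdot> (\<one> X \<otimes>\<^bsub>M\<^esub> \<d>\<^bsub>M\<^esub> X)"

definition local_product :: "('o, 'a) cat2 \<Rightarrow> ('o, 'a) monoidal \<Rightarrow> 'a \<Rightarrow> 'a \<Rightarrow> 'a"
  where "local_product C M r s =
    radj C (\<d>\<^bsub>M\<^esub> (Trg C r)) \<cdot>\<^bsub>C\<^esub> (r \<otimes>\<^bsub>M\<^esub> s) \<cdot>\<^bsub>C\<^esub> \<d>\<^bsub>M\<^esub> (Src C r)"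

definition dual_unit :: "('o, 'a) cat2 \<Rightarrow> ('o, 'a) monoidal \<Rightarrow> 'o \<Rightarrow> 'a"
  where "dual_unit C M X = \<d>\<^bsub>M\<^esub> X \<cdot>\<^bsub>C\<^esub> radj C (\<e>\<^bsub>M\<^esub> X)"

definition dual_counit :: "('o, 'a) cat2 \<Rightarrow> ('o, 'a) monoidal \<Rightarrow> 'o \<Rightarrow> 'a"
  where "dual_counit C M X = \<e>\<^bsub>M\<^esub> X \<cdot>\<^bsub>C\<^esub> radj C (\<d>\<^bsub>M\<^esub> X)"

text \<open>
  The transpose of \<open>s : X \<rightarrow> Y\<close> is the composite
  \<open>Y \<rightarrow> \<I> \<odot> Y \<rightarrow> (X \<odot> X) \<odot> Y \<rightarrow> X \<odot> (X \<odot> Y) \<rightarrow> X \<odot> (Y \<odot> Y) \<rightarrow> X \<odot> \<I> \<rightarrow> X\<close>.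
  As the comonoids are commutative, bending the wires the other way gives the same arrow.
\<close>

definition transpose_arr :: "('o, 'a) cat2 \<Rightarrow> ('o, 'a) monoidal \<Rightarrow> 'a \<Rightarrow> 'a"
  where "transpose_arr C M s = (let X = Src C s; Y = Trg C s in
    \<r>\<^bsub>M\<^esub> X \<cdot>\<^bsub>C\<^esub> (\<one>\<^bsub>C\<^esub> X \<otimes>\<^bsub>M\<^esub> dual_counit C M Y) \<cdot>\<^bsub>C\<^esub> (\<one>\<^bsub>C\<^esub> X \<otimes>\<^bsub>M\<^esub> (s \<otimes>\<^bsub>M\<^esub> \<one>\<^bsub>C\<^esub> Y)) \<cdot>\<^bsub>C\<^esub>
      \<a>\<^bsub>M\<^esub> X X Y \<cdot>\<^bsub>C\<^esub> (dual_unit C M X \<otimes>\<^bsub>M\<^esub> \<one>\<^bsub>C\<^esub> Y) \<cdot>\<^bsub>C\<^esub> inv_arr C (\<l>\<^bsub>M\<^esub> Y))"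

end

theory Submission
  imports Defs
begin

text \<open>
  In one direction the allegory structure is read off from the string calculus of a bicategory of
  relations. Lax naturality of the diagonals makes \<open>d\<^sup>\<bullet> (r \<otimes> s) d\<close> the meet of \<open>r\<close> and \<open>s\<close>. The
  Frobenius law makes every object self-dual, so that transposition is an involution
  (\<open>cou_bend\<close>, \<open>bend_cou\<close>), and sliding an arrow around a bent wire gives the inequality behind the
  modular law (\<open>diag_modular\<close>). The unit of the tensor is the unit of the allegory, and the top arrow
  \<open>X \<rightarrow> Y\<close> is tabulated by the projections of \<open>X \<otimes> Y\<close>. The point that needs an argument is that these
  projections are jointly monic, in other words that their pairing \<open>h\<close> is the identity
  (\<open>pairing_of_projections\<close>). This would follow from coherence between the diagonal
  of \<open>X \<otimes> Y\<close> and the diagonals of \<open>X\<close> and \<open>Y\<close>, but a proof inside the allegory avoids the large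
  coherence diagrams: by self-duality an arrow \<open>X \<otimes> Y \<rightarrow> I\<close> is the name of an arrow \<open>X \<rightarrow> Y\<close>, and the
  latter can be recovered after precomposing the name with the idempotent \<open>h\<close>. So precomposition
  with \<open>h\<close> is injective, hence trivial, on arrows into \<open>I\<close>, and this forces \<open>h = 1\<close>.

  In the other direction a unit and pre-tabularity give tabulations of the top arrows, which are the
  binary products of a cartesian structure on the maps. The tensor of \<open>r\<close> and \<open>s\<close> is
  \<open>p\<degree> r p \<inter> q\<degree> s q\<close>, and everything rests on the rule
  \<open>\<langle>a, b\<rangle>\<degree> \<langle>c, d\<rangle> = a\<degree> c \<inter> b\<degree> d\<close> for pairings of arbitrary arrows (\<open>pair_sharp\<close>). It yields
  functoriality of the tensor and naturality of the structure maps; the coherence equations, which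
  involve maps only, are then checked on projections.

  It remains to see that the involution and meets recovered from the constructed tensor are the given
  ones. The first direction shows that they form an allegory structure on the same ordered category,
  and such a structure is unique as soon as every arrow factors as a map after a coreflexive after
  the converse of a map (\<open>meet_unique\<close>, \<open>invol_unique\<close>).
\<close>

section \<open>Locally ordered categories\<close>

context locally_ordered_2_category
begin

lemma Hom_iff:
  "f \<in> Hom C X Y \<longleftrightarrow> f \<in> Arr C \<and> Src C f = X \<and> Trg C f = Y \<and> X \<in> Ob C \<and> Y \<in> Ob C"
  by (auto simp: Hom_def Src_Ob Trg_Ob)

lemma Hom_self: "f \<in> Arr C \<Longrightarrow> f \<in> Hom C (Src C f) (Trg C f)"
  by (simp add: Hom_def)

lemmas [simp] = Src_Ob Trg_Ob

lemma Idn_simps [simp]: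
  assumes "X \<in> Ob C"
  shows "\<one> X \<in> Arr C" "Src C (\<one> X) = X" "Trg C (\<one> X) = X"
  using Idn_Hom[OF assms] by (auto simp: Hom_iff)

lemma Cmp_simps [simp]:
  assumes "f \<in> Arr C" "g \<in> Arr C" "Src C g = Trg C f"
  shows "g \<cdot> f \<in> Arr C" "Src C (g \<cdot> f) = Src C f" "Trg C (g \<cdot> f) = Trg C g"
  using Cmp_Hom[OF Hom_self[OF assms(1)], of g "Trg C g"] assms by (auto simp: Hom_iff)

lemma Idn_left' [simp]: "\<lbrakk>f \<in> Arr C; Trg C f = Y\<rbrakk> \<Longrightarrow> \<one> Y \<cdot> f = f"
  using Idn_left[of f "Src C f" Y] by (simp add: Hom_def)

lemma Idn_right' [simp]: "\<lbrakk>f \<in> Arr C; Src C f = X\<rbrakk> \<Longrightarrow> f \<cdot> \<one> X = f"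
  using Idn_right[of f X "Trg C f"] by (simp add: Hom_def)

lemma Cmp_assoc' [simp]:
  "\<lbrakk>f \<in> Arr C; g \<in> Arr C; h \<in> Arr C; Src C g = Trg C f; Src C h = Trg C g\<rbrakk>
    \<Longrightarrow> (h \<cdot> g) \<cdot> f = h \<cdot> (g \<cdot> f)"
  using Cmp_assoc[of f "Src C f" "Trg C f" g "Trg C g" h "Trg C h"] by (simp add: Hom_def)

text \<open>Rewriting with a known composite inside a right-nested chain.\<close>

lemma Cmp_in_chain:
  assumes "g \<cdot> f = k" "f \<in> Arr C" "g \<in> Arr C" "Src C g = Trg C f"
    and "x \<in> Arr C" "Src C f = Trg C x"
  shows "g \<cdot> (f \<cdot> x) = k \<cdot> x"
  using assms Cmp_assoc'[of x f g] by simp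

text \<open>Bundling the order with parallelism makes transitivity and antisymmetry unconditional.\<close>

definition le :: "'a \<Rightarrow> 'a \<Rightarrow> bool" (infix "\<sqsubseteq>" 50)
  where "f \<sqsubseteq> g \<longleftrightarrow> f \<in> Arr C \<and> g \<in> Arr C \<and> Src C f = Src C g \<and> Trg C f = Trg C g \<and> f \<preceq> g"

lemma leI: "\<lbrakk>f \<in> Hom C X Y; g \<in> Hom C X Y; f \<preceq> g\<rbrakk> \<Longrightarrow> f \<sqsubseteq> g"
  by (simp add: le_def Hom_def)

lemma leD: "f \<sqsubseteq> g \<Longrightarrow> f \<preceq> g"
  by (simp add: le_def)

lemma le_refl [simp, intro]: "f \<in> Arr C \<Longrightarrow> f \<sqsubseteq> f"
  using Leq_refl[OF Hom_self] by (simp add: le_def)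

lemma le_trans [trans]: "f \<sqsubseteq> g \<Longrightarrow> g \<sqsubseteq> h \<Longrightarrow> f \<sqsubseteq> h"
  using Leq_trans[of f "Src C f" "Trg C f" g h] by (auto simp: le_def Hom_def)

lemma le_antisym: "f \<sqsubseteq> g \<Longrightarrow> g \<sqsubseteq> f \<Longrightarrow> f = g"
  using Leq_antisym[of f "Src C f" "Trg C f" g] by (auto simp: le_def Hom_def)

lemma Cmp_le: "\<lbrakk>g \<sqsubseteq> g'; f \<sqsubseteq> f'; Src C g = Trg C f\<rbrakk> \<Longrightarrow> g \<cdot> f \<sqsubseteq> g' \<cdot> f'"
  using Cmp_mono[of f "Src C f" "Trg C f" f' g "Trg C g" g'] by (auto simp: le_def Hom_def)

lemma Cmp_le_left: "\<lbrakk>g \<sqsubseteq> g'; f \<in> Arr C; Src C g = Trg C f\<rbrakk> \<Longrightarrow> g \<cdot> f \<sqsubseteq> g' \<cdot> f"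
  by (rule Cmp_le) auto

lemma Cmp_le_right: "\<lbrakk>f \<sqsubseteq> f'; g \<in> Arr C; Src C g = Trg C f\<rbrakk> \<Longrightarrow> g \<cdot> f \<sqsubseteq> g \<cdot> f'"
  by (rule Cmp_le) auto

lemma adjoint_iff:
  "adjoint C f u \<longleftrightarrow> f \<in> Arr C \<and> u \<in> Arr C \<and> Src C u = Trg C f \<and> Trg C u = Src C f \<and>
    \<one> (Src C f) \<sqsubseteq> u \<cdot> f \<and> f \<cdot> u \<sqsubseteq> \<one> (Trg C f)"
  unfolding adjoint_def le_def by (auto simp: Hom_iff)

lemma adjoint_le:
  assumes fu: "adjoint C f u" and fv: "adjoint C f v"
  shows "u \<sqsubseteq> v"
proof -
  note [simp] = fu[unfolded adjoint_iff] fv[unfolded adjoint_iff]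
  have "\<one> (Src C f) \<cdot> u \<sqsubseteq> (v \<cdot> f) \<cdot> u"
    by (rule Cmp_le_left) auto
  also have "\<dots> = v \<cdot> (f \<cdot> u)" by simp
  also have "\<dots> \<sqsubseteq> v \<cdot> \<one> (Trg C f)" by (rule Cmp_le_right) auto
  finally show ?thesis by simp
qed

lemma radj_eqI: "adjoint C f u \<Longrightarrow> radj C f = u"
  unfolding radj_def by (rule the_equality) (auto intro: le_antisym adjoint_le)

lemma adjoint_radj: "is_map C f \<Longrightarrow> adjoint C f (radj C f)"
  using radj_eqI by (auto simp: is_map_def)

lemma map_Arr: "is_map C f \<Longrightarrow> f \<in> Arr C"
  by (auto simp: is_map_def adjoint_def)

lemma radj_simps [simp]:
  assumes "is_map C f"
  shows "radj C f \<in> Arr C" "Src C (radj C f) = Trg C f" "Trg C (radj C f) = Src C f"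
  using adjoint_radj[OF assms] by (auto simp: adjoint_iff)

lemma radj_unit: "\<lbrakk>is_map C f; Src C f = X\<rbrakk> \<Longrightarrow> \<one> X \<sqsubseteq> radj C f \<cdot> f"
  and radj_counit: "\<lbrakk>is_map C f; Trg C f = Y\<rbrakk> \<Longrightarrow> f \<cdot> radj C f \<sqsubseteq> \<one> Y"
  using adjoint_radj[of f] by (auto simp: adjoint_iff)

lemma adjoint_Idn: "X \<in> Ob C \<Longrightarrow> adjoint C (\<one> X) (\<one> X)"
  by (simp add: adjoint_iff)

lemma adjoint_Cmp:
  assumes fu: "adjoint C f u" and gv: "adjoint C g v" and gf: "Src C g = Trg C f"
  shows "adjoint C (g \<cdot> f) (u \<cdot> v)"
proof -
  note [simp] = fu[unfolded adjoint_iff] gv[unfolded adjoint_iff] gf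
  have "\<one> (Src C f) \<sqsubseteq> u \<cdot> (\<one> (Trg C f) \<cdot> f)" by simp
  also have "\<dots> \<sqsubseteq> u \<cdot> ((v \<cdot> g) \<cdot> f)"
    using gv gf by (intro Cmp_le_right Cmp_le_left) (auto simp: adjoint_iff)
  finally have 1: "\<one> (Src C f) \<sqsubseteq> (u \<cdot> v) \<cdot> (g \<cdot> f)" by simp
  have "g \<cdot> ((f \<cdot> u) \<cdot> v) \<sqsubseteq> g \<cdot> (\<one> (Trg C f) \<cdot> v)"
    by (intro Cmp_le_right Cmp_le_left) auto
  also have "\<dots> \<sqsubseteq> \<one> (Trg C g)" by simp
  finally have 2: "(g \<cdot> f) \<cdot> (u \<cdot> v) \<sqsubseteq> \<one> (Trg C g)" by simp
  show ?thesis using 1 2 unfolding adjoint_iff by (simp del: Cmp_assoc')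
qed

lemma map_Idn [simp]: "X \<in> Ob C \<Longrightarrow> is_map C (\<one> X)"
  using adjoint_Idn by (auto simp: is_map_def)

lemma map_Cmp [simp]: "\<lbrakk>is_map C f; is_map C g; Src C g = Trg C f\<rbrakk> \<Longrightarrow> is_map C (g \<cdot> f)"
  unfolding is_map_def using adjoint_Cmp by blast

lemma radj_Cmp:
  "\<lbrakk>is_map C f; is_map C g; Src C g = Trg C f\<rbrakk> \<Longrightarrow> radj C (g \<cdot> f) = radj C f \<cdot> radj C g"
  by (intro radj_eqI adjoint_Cmp adjoint_radj)

lemma inv_arr_eqI:
  assumes "inverse_arrows C f g"
  shows "inv_arr C f = g"
  unfolding inv_arr_def
proof (rule the_equality, rule assms)
  fix h assume h: "inverse_arrows C f h"
  note [simp] = assms[unfolded inverse_arrows_def Hom_iff] h[unfolded inverse_arrows_def Hom_iff]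
  have "h \<cdot> (f \<cdot> g) = (h \<cdot> f) \<cdot> g" by (subst Cmp_assoc') auto
  then show "h = g" by simp
qed

lemma inverse_arrows_inv_arr: "is_iso C f \<Longrightarrow> inverse_arrows C f (inv_arr C f)"
  using inv_arr_eqI by (auto simp: is_iso_def)

lemma iso_Arr: "is_iso C f \<Longrightarrow> f \<in> Arr C"
  by (auto simp: is_iso_def inverse_arrows_def)

lemma inv_arr_simps [simp]:
  assumes "is_iso C f"
  shows "inv_arr C f \<in> Arr C" "Src C (inv_arr C f) = Trg C f" "Trg C (inv_arr C f) = Src C f"
    "inv_arr C f \<cdot> f = \<one> (Src C f)" "f \<cdot> inv_arr C f = \<one> (Trg C f)"
  using inverse_arrows_inv_arr[OF assms] by (auto simp: inverse_arrows_def Hom_iff)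

lemma inv_arr_chain [simp]:
  assumes "is_iso C f" "x \<in> Arr C"
  shows "Src C f = Trg C x \<Longrightarrow> inv_arr C f \<cdot> (f \<cdot> x) = x"
    and "Trg C f = Trg C x \<Longrightarrow> f \<cdot> (inv_arr C f \<cdot> x) = x"
  using assms iso_Arr[OF assms(1)] by (simp_all add: Cmp_in_chain[of "inv_arr C f" f]
      Cmp_in_chain[of f "inv_arr C f"])

lemma adjoint_inverse: "inverse_arrows C f g \<Longrightarrow> adjoint C f g"
  by (auto simp: inverse_arrows_def adjoint_iff Hom_iff)

lemma map_iso [simp]: "is_iso C f \<Longrightarrow> is_map C f"
  using adjoint_inverse by (auto simp: is_iso_def is_map_def)

lemma radj_iso: "is_iso C f \<Longrightarrow> radj C f = inv_arr C f"
  by (intro radj_eqI adjoint_inverse inverse_arrows_inv_arr)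

lemma inv_arr_left_eqI:
  assumes "is_iso C f" "x \<in> Arr C" "f \<cdot> x = \<one> (Trg C f)" "Src C f = Trg C x"
  shows "x = inv_arr C f"
proof -
  have "inv_arr C f \<cdot> (f \<cdot> x) = x" using assms(1,2,4) by simp
  then show ?thesis using assms(1) by (simp add: assms(3))
qed

lemma iso_cancel_left:
  assumes "is_iso C f" "f \<cdot> x = f \<cdot> y" "x \<in> Arr C" "y \<in> Arr C" "Trg C x = Src C f" "Trg C y = Src C f"
  shows "x = y"
proof -
  have "inv_arr C f \<cdot> (f \<cdot> x) = inv_arr C f \<cdot> (f \<cdot> y)" by (simp only: assms(2))
  then show ?thesis using assms(1,3-) by simp
qed

lemma iso_cancel_right:
  assumes "is_iso C f" "x \<cdot> f = y \<cdot> f" "x \<in> Arr C" "y \<in> Arr C" "Src C x = Trg C f" "Src C y = Trg C f"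
  shows "x = y"
proof -
  have "(x \<cdot> f) \<cdot> inv_arr C f = (y \<cdot> f) \<cdot> inv_arr C f" by (simp only: assms(2))
  then show ?thesis using assms(1,3-) iso_Arr[OF assms(1)] by simp
qed

end

section \<open>Allegories\<close>

context allegory
begin

lemma meet_simps [simp]:
  assumes "r \<in> Arr C" "s \<in> Arr C" "Src C s = Src C r" "Trg C s = Trg C r"
  shows "r \<sqinter> s \<in> Arr C" "Src C (r \<sqinter> s) = Src C r" "Trg C (r \<sqinter> s) = Trg C r"
  using meet_Hom[of r "Src C r" "Trg C r" s] assms by (auto simp: Hom_def)

lemma invol_simps [simp]:
  assumes "r \<in> Arr C"
  shows "r\<degree> \<in> Arr C" "Src C (r\<degree>) = Trg C r" "Trg C (r\<degree>) = Src C r" "r\<degree>\<degree> = r"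
  using invol_Hom[of r "Src C r" "Trg C r"] invol_invol[of r "Src C r" "Trg C r"] assms
  by (auto simp: Hom_def)

lemmas [simp] = invol_Idn

lemma invol_Cmp' [simp]:
  "\<lbrakk>r \<in> Arr C; s \<in> Arr C; Src C s = Trg C r\<rbrakk> \<Longrightarrow> (s \<cdot> r)\<degree> = r\<degree> \<cdot> s\<degree>"
  using invol_Cmp[of r "Src C r" "Trg C r" s "Trg C s"] by (auto simp: Hom_def)

lemma le_meet:
  assumes "r \<in> Arr C" "s \<in> Arr C" "Src C s = Src C r" "Trg C s = Trg C r"
  shows "t \<sqsubseteq> r \<sqinter> s \<longleftrightarrow> t \<sqsubseteq> r \<and> t \<sqsubseteq> s"
proof -
  have 1: "r \<sqinter> s \<sqsubseteq> r" "r \<sqinter> s \<sqsubseteq> s"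
    using meet_le1[of r "Src C r" "Trg C r" s] meet_le2[of r "Src C r" "Trg C r" s] assms
    by (auto simp: le_def Hom_def)
  have 2: "t \<sqsubseteq> r \<sqinter> s" if "t \<sqsubseteq> r" "t \<sqsubseteq> s"
    using that meet_greatest[of r "Src C r" "Trg C r" s t] assms by (auto simp: le_def Hom_def)
  show ?thesis using 1 2 le_trans by blast
qed

lemma meetI: "\<lbrakk>t \<sqsubseteq> r; t \<sqsubseteq> s\<rbrakk> \<Longrightarrow> t \<sqsubseteq> r \<sqinter> s"
  by (subst le_meet) (auto simp: le_def)

lemma meet_lower:
  assumes "r \<in> Arr C" "s \<in> Arr C" "Src C s = Src C r" "Trg C s = Trg C r"
  shows "r \<sqinter> s \<sqsubseteq> r" "r \<sqinter> s \<sqsubseteq> s"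
  using le_meet[OF assms, of "r \<sqinter> s"] assms by auto

lemma meet_coarser:
  assumes "r \<in> Arr C" "s \<in> Arr C" "Src C s = Src C r" "Trg C s = Trg C r"
  shows "r \<sqsubseteq> t \<Longrightarrow> r \<sqinter> s \<sqsubseteq> t" "s \<sqsubseteq> t \<Longrightarrow> r \<sqinter> s \<sqsubseteq> t"
  using meet_lower[OF assms] le_trans by blast+

lemma meet_le: "\<lbrakk>r \<sqsubseteq> r'; s \<sqsubseteq> s'; Src C s = Src C r; Trg C s = Trg C r\<rbrakk> \<Longrightarrow> r \<sqinter> s \<sqsubseteq> r' \<sqinter> s'"
  by (intro meetI meet_coarser) (auto simp: le_def)

lemma meet_comm:
  assumes "r \<in> Arr C" "s \<in> Arr C" "Src C s = Src C r" "Trg C s = Trg C r"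
  shows "r \<sqinter> s = s \<sqinter> r"
  using assms by (intro le_antisym meetI meet_lower) auto

lemma meet_assoc:
  assumes "r \<in> Arr C" "s \<in> Arr C" "Src C s = Src C r" "Trg C s = Trg C r"
    "t \<in> Arr C" "Src C t = Src C r" "Trg C t = Trg C r"
  shows "(r \<sqinter> s) \<sqinter> t = r \<sqinter> (s \<sqinter> t)"
proof (intro le_antisym meetI)
  show "(r \<sqinter> s) \<sqinter> t \<sqsubseteq> r" "(r \<sqinter> s) \<sqinter> t \<sqsubseteq> s"
    using assms by (intro meet_coarser(1)[OF _ _ _ _ meet_lower(1)]
        meet_coarser(1)[OF _ _ _ _ meet_lower(2)]; simp)+
  show "r \<sqinter> (s \<sqinter> t) \<sqsubseteq> s" "r \<sqinter> (s \<sqinter> t) \<sqsubseteq> t"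
    using assms by (intro meet_coarser(2)[OF _ _ _ _ meet_lower(1)]
        meet_coarser(2)[OF _ _ _ _ meet_lower(2)]; simp)+
qed (use assms in \<open>simp_all add: meet_lower\<close>)

lemma meet_absorb: "r \<sqsubseteq> s \<Longrightarrow> r \<sqinter> s = r"
  by (intro le_antisym meetI meet_lower) (auto simp: le_def intro: Leq_refl[OF Hom_self])

lemma invol_le: "r \<sqsubseteq> s \<Longrightarrow> r\<degree> \<sqsubseteq> s\<degree>"
  using invol_mono[of r "Src C r" "Trg C r" s] by (auto simp: le_def Hom_def)

lemma invol_le_iff: "r \<in> Arr C \<Longrightarrow> s \<in> Arr C \<Longrightarrow> r\<degree> \<sqsubseteq> s\<degree> \<longleftrightarrow> r \<sqsubseteq> s"
  using invol_le[of "r\<degree>" "s\<degree>"] invol_le[of r s] by auto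

lemma invol_meet [simp]:
  assumes "r \<in> Arr C" "s \<in> Arr C" "Src C s = Src C r" "Trg C s = Trg C r"
  shows "(r \<sqinter> s)\<degree> = r\<degree> \<sqinter> s\<degree>"
proof (rule le_antisym)
  show "(r \<sqinter> s)\<degree> \<sqsubseteq> r\<degree> \<sqinter> s\<degree>"
    using assms by (intro meetI invol_le meet_lower) auto
  have "(r\<degree> \<sqinter> s\<degree>)\<degree> \<sqsubseteq> r\<degree>\<degree> \<sqinter> s\<degree>\<degree>"
    using assms by (intro meetI invol_le meet_lower) (auto simp del: invol_simps(4))
  then show "r\<degree> \<sqinter> s\<degree> \<sqsubseteq> (r \<sqinter> s)\<degree>"
    using assms invol_le_iff[of "r\<degree> \<sqinter> s\<degree>" "(r \<sqinter> s)\<degree>"] by simp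
qed

lemma modular_right:
  assumes "r \<in> Arr C" "s \<in> Arr C" "t \<in> Arr C" "Src C s = Trg C r" "Src C t = Src C r" "Trg C t = Trg C s"
  shows "(s \<cdot> r) \<sqinter> t \<sqsubseteq> (s \<sqinter> (t \<cdot> r\<degree>)) \<cdot> r"
  using modular[of r "Src C r" "Trg C r" s "Trg C s" t] assms by (auto simp: le_def Hom_def)

lemma modular_left:
  assumes "r \<in> Arr C" "s \<in> Arr C" "t \<in> Arr C" "Src C s = Trg C r" "Src C t = Src C r" "Trg C t = Trg C s"
  shows "(s \<cdot> r) \<sqinter> t \<sqsubseteq> s \<cdot> (r \<sqinter> (s\<degree> \<cdot> t))"
proof -
  have "(r\<degree> \<cdot> s\<degree>) \<sqinter> t\<degree> \<sqsubseteq> (r\<degree> \<sqinter> (t\<degree> \<cdot> s\<degree>\<degree>)) \<cdot> s\<degree>"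
    using assms by (intro modular_right) auto
  then have "((s \<cdot> r) \<sqinter> t)\<degree> \<sqsubseteq> (s \<cdot> (r \<sqinter> (s\<degree> \<cdot> t)))\<degree>"
    using assms by simp
  then show ?thesis using assms by (subst (asm) invol_le_iff) auto
qed

text \<open>
  A right adjoint is the converse: if \<open>u\<close> is right adjoint to \<open>f\<close> then
  \<open>1 \<le> (u \<inter> f\<degree>) f\<close>, so \<open>u \<inter> f\<degree>\<close> is again right adjoint to \<open>f\<close>, whence \<open>u \<le> f\<degree>\<close>; the
  reverse inequality is the same argument for the adjunction between \<open>u\<degree>\<close> and \<open>f\<degree>\<close>.
\<close>

lemma adjoint_invol:
  assumes "adjoint C f u"
  shows "u = f\<degree>"
proof -
  have *: "v \<sqsubseteq> g\<degree>" if gv: "adjoint C g v" for g v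
  proof -
    note [simp] = gv[unfolded adjoint_iff]
    have "\<one> (Src C g) \<sqsubseteq> (v \<cdot> g) \<sqinter> \<one> (Src C g)"
      by (intro meetI) auto
    also have "\<dots> \<sqsubseteq> (v \<sqinter> (\<one> (Src C g) \<cdot> g\<degree>)) \<cdot> g"
      by (rule modular_right) auto
    finally have 1: "\<one> (Src C g) \<sqsubseteq> (v \<sqinter> g\<degree>) \<cdot> g" by simp
    have "g \<cdot> (v \<sqinter> g\<degree>) \<sqsubseteq> g \<cdot> v"
      by (intro Cmp_le_right meet_lower) auto
    also have "\<dots> \<sqsubseteq> \<one> (Trg C g)" by simp
    finally have "adjoint C g (v \<sqinter> g\<degree>)"
      using 1 by (simp add: adjoint_iff)
    then have "v \<sqsubseteq> v \<sqinter> g\<degree>" using gv adjoint_le by blast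
    then show ?thesis by (subst (asm) le_meet) auto
  qed
  note [simp] = assms[unfolded adjoint_iff]
  have "(\<one> (Src C f))\<degree> \<sqsubseteq> (u \<cdot> f)\<degree>" "(f \<cdot> u)\<degree> \<sqsubseteq> (\<one> (Trg C f))\<degree>"
    by (intro invol_le; simp)+
  then have "adjoint C (u\<degree>) (f\<degree>)"
    by (simp add: adjoint_iff)
  then have "f\<degree> \<sqsubseteq> u" using * by fastforce
  then show ?thesis using *[OF assms] le_antisym by blast
qed

text \<open>So being a map is a property of the allegory that mentions no adjoint.\<close>

lemma map_iff:
  "is_map C f \<longleftrightarrow> f \<in> Arr C \<and> \<one> (Src C f) \<sqsubseteq> f\<degree> \<cdot> f \<and> f \<cdot> f\<degree> \<sqsubseteq> \<one> (Trg C f)"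
proof
  assume "is_map C f"
  then obtain u where "adjoint C f u" by (auto simp: is_map_def)
  then show "f \<in> Arr C \<and> \<one> (Src C f) \<sqsubseteq> f\<degree> \<cdot> f \<and> f \<cdot> f\<degree> \<sqsubseteq> \<one> (Trg C f)"
    using adjoint_invol[of f u] by (auto simp: adjoint_iff)
next
  assume "f \<in> Arr C \<and> \<one> (Src C f) \<sqsubseteq> f\<degree> \<cdot> f \<and> f \<cdot> f\<degree> \<sqsubseteq> \<one> (Trg C f)"
  then have "adjoint C f (f\<degree>)" by (simp add: adjoint_iff)
  then show "is_map C f" by (auto simp: is_map_def)
qed

lemma radj_invol: "is_map C f \<Longrightarrow> radj C f = f\<degree>"
  using adjoint_radj adjoint_invol by blast

lemma map_total: "\<lbrakk>is_map C f; Src C f = X\<rbrakk> \<Longrightarrow> \<one> X \<sqsubseteq> f\<degree> \<cdot> f"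
  and map_functional: "\<lbrakk>is_map C f; Trg C f = Y\<rbrakk> \<Longrightarrow> f \<cdot> f\<degree> \<sqsubseteq> \<one> Y"
  by (auto simp: map_iff)

lemma functional_below:
  assumes "f \<cdot> f\<degree> \<sqsubseteq> \<one> (Trg C f)" "f \<in> Arr C" "r \<in> Arr C" "Trg C r = Trg C f"
  shows "f \<cdot> (f\<degree> \<cdot> r) \<sqsubseteq> r"
proof -
  have "(f \<cdot> f\<degree>) \<cdot> r \<sqsubseteq> \<one> (Trg C f) \<cdot> r"
    using assms by (intro Cmp_le_left) auto
  then show ?thesis using assms by simp
qed

lemma functional_below':
  assumes "f \<cdot> f\<degree> \<sqsubseteq> \<one> (Trg C f)" "f \<in> Arr C" "r \<in> Arr C" "Src C r = Trg C f"
  shows "r \<cdot> (f \<cdot> f\<degree>) \<sqsubseteq> r"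
proof -
  have "r \<cdot> (f \<cdot> f\<degree>) \<sqsubseteq> r \<cdot> \<one> (Trg C f)"
    using assms by (intro Cmp_le_right) auto
  then show ?thesis using assms by simp
qed

lemma meet_functional:
  assumes "f \<cdot> f\<degree> \<sqsubseteq> \<one> (Trg C f)" "f \<in> Arr C"
    and "r \<in> Arr C" "s \<in> Arr C" "Src C r = Trg C f" "Src C s = Trg C f" "Trg C s = Trg C r"
  shows "(r \<sqinter> s) \<cdot> f = (r \<cdot> f) \<sqinter> (s \<cdot> f)"
proof (rule le_antisym)
  show "(r \<sqinter> s) \<cdot> f \<sqsubseteq> (r \<cdot> f) \<sqinter> (s \<cdot> f)"
    using assms by (intro meetI Cmp_le_left meet_lower) auto
  have "(r \<cdot> f) \<sqinter> (s \<cdot> f) \<sqsubseteq> (r \<sqinter> ((s \<cdot> f) \<cdot> f\<degree>)) \<cdot> f"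
    using assms by (intro modular_right) auto
  also have "\<dots> \<sqsubseteq> (r \<sqinter> s) \<cdot> f"
    using assms functional_below'[of f s] by (intro Cmp_le_left meet_le) auto
  finally show "(r \<cdot> f) \<sqinter> (s \<cdot> f) \<sqsubseteq> (r \<sqinter> s) \<cdot> f" .
qed

lemma meet_map:
  assumes "is_map C f"
    and "r \<in> Arr C" "s \<in> Arr C" "Src C r = Trg C f" "Src C s = Trg C f" "Trg C s = Trg C r"
  shows "(r \<sqinter> s) \<cdot> f = (r \<cdot> f) \<sqinter> (s \<cdot> f)"
  using assms by (intro meet_functional) (auto simp: map_iff)

lemma invol_map_meet:
  assumes "is_map C f"
    and "r \<in> Arr C" "s \<in> Arr C" "Trg C r = Trg C f" "Src C s = Src C r" "Trg C s = Trg C r"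
  shows "f\<degree> \<cdot> (r \<sqinter> s) = (f\<degree> \<cdot> r) \<sqinter> (f\<degree> \<cdot> s)"
proof -
  have f: "f \<in> Arr C" using assms map_Arr by blast
  have "((r\<degree> \<sqinter> s\<degree>) \<cdot> f)\<degree> = ((r\<degree> \<cdot> f) \<sqinter> (s\<degree> \<cdot> f))\<degree>"
    using assms f by (subst meet_map) auto
  then show ?thesis using assms f by simp
qed

lemma map_le_eq:
  assumes f: "is_map C f" and g: "is_map C g" and fg: "f \<sqsubseteq> g"
  shows "f = g"
proof (rule le_antisym[OF fg])
  note [simp] = map_Arr[OF f] map_Arr[OF g]
  have [simp]: "Src C f = Src C g" "Trg C f = Trg C g" using fg by (auto simp: le_def)
  have "g \<cdot> \<one> (Src C g) \<sqsubseteq> g \<cdot> (f\<degree> \<cdot> f)"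
    using f by (intro Cmp_le_right) (auto simp: map_total)
  also have "\<dots> \<sqsubseteq> g \<cdot> (g\<degree> \<cdot> f)"
    using fg by (intro Cmp_le_right Cmp_le_left invol_le) auto
  also have "\<dots> \<sqsubseteq> f"
    using g by (intro functional_below) (auto simp: map_iff)
  finally show "g \<sqsubseteq> f" by simp
qed

text \<open>Coreflexives are symmetric: for \<open>c \<le> 1\<close> the modular law gives \<open>c = c 1 \<inter> 1 \<le> c (1 \<inter> c\<degree>) \<le> c\<degree>\<close>.\<close>

lemma coreflexive_le_invol:
  assumes "r \<in> Arr C" "Src C r = X" "Trg C r = X"
  shows "\<one> X \<sqinter> r \<sqsubseteq> r\<degree>"
proof -
  have X [simp]: "X \<in> Ob C" using assms by auto
  let ?c = "\<one> X \<sqinter> r"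
  have c [simp]: "?c \<in> Arr C" "Src C ?c = X" "Trg C ?c = X" using assms by simp_all
  have "?c \<sqsubseteq> (?c \<cdot> \<one> X) \<sqinter> \<one> X"
    using assms by (intro meetI meet_lower) auto
  also have "\<dots> \<sqsubseteq> ?c \<cdot> (\<one> X \<sqinter> (?c\<degree> \<cdot> \<one> X))"
    by (rule modular_left) simp_all
  also have "\<dots> \<sqsubseteq> \<one> X \<cdot> (?c\<degree> \<cdot> \<one> X)"
    using assms by (intro Cmp_le meet_lower) auto
  also have "\<dots> = ?c\<degree>" by (simp del: invol_meet)
  also have "\<dots> \<sqsubseteq> r\<degree>"
    using assms by (intro invol_le meet_lower) auto
  finally show ?thesis .
qed

lemma meet_one_invol:
  assumes "r \<in> Arr C" "Src C r = X" "Trg C r = X"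
  shows "\<one> X \<sqinter> r\<degree> = \<one> X \<sqinter> r"
proof -
  have X [simp]: "X \<in> Ob C" using assms by auto
  show ?thesis
    using assms coreflexive_le_invol[of r X] coreflexive_le_invol[of "r\<degree>" X]
    by (intro le_antisym meetI meet_lower) auto
qed

lemma coreflexive_invol:
  assumes "c \<sqsubseteq> \<one> X" "X \<in> Ob C"
  shows "c\<degree> = c"
proof -
  have c: "c \<in> Arr C" "Src C c = X" "Trg C c = X" using assms by (auto simp: le_def)
  have "c\<degree> \<sqsubseteq> \<one> X" using invol_le[OF assms(1)] assms(2) by simp
  then show ?thesis
    using meet_one_invol[OF c] meet_absorb[OF assms(1)] meet_absorb[of "c\<degree>" "\<one> X"] c assms(2)
    by (simp add: meet_comm)
qed

lemma le_self_dom: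
  assumes "t \<in> Arr C"
  shows "t \<sqsubseteq> t \<cdot> (\<one> (Src C t) \<sqinter> (t\<degree> \<cdot> t))"
proof -
  have "(t \<cdot> \<one> (Src C t)) \<sqinter> t \<sqsubseteq> t \<cdot> (\<one> (Src C t) \<sqinter> (t\<degree> \<cdot> t))"
    using assms by (intro modular_left) auto
  then show ?thesis using assms meet_absorb[of t t] by simp
qed

lemma coreflexive_le_dom:
  assumes "r \<in> Arr C" "k \<in> Arr C" "Src C k = Src C r" "Trg C k = Trg C r"
  shows "\<one> (Src C r) \<sqinter> (r\<degree> \<cdot> k) \<sqsubseteq> r\<degree> \<cdot> r"
proof -
  have "(r\<degree> \<cdot> k) \<sqinter> \<one> (Src C r) \<sqsubseteq> r\<degree> \<cdot> (k \<sqinter> (r\<degree>\<degree> \<cdot> \<one> (Src C r)))"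
    using assms by (intro modular_left) auto
  also have "\<dots> \<sqsubseteq> r\<degree> \<cdot> r"
    using assms by (intro Cmp_le_right) (auto intro: meet_lower)
  finally show ?thesis using assms by (simp add: meet_comm)
qed

text \<open>
  A part of a functional arrow is determined by its domain, and composing with the total arrow \<open>e\<close>
  does not change the domain.
\<close>

lemma functional_le_of_dom:
  assumes tq: "t \<sqsubseteq> q" and t'q: "t' \<sqsubseteq> q" and q: "q \<cdot> q\<degree> \<sqsubseteq> \<one> (Trg C q)"
    and e: "e \<in> Arr C" "Src C e = Trg C q" "\<one> (Trg C q) \<sqsubseteq> e\<degree> \<cdot> e" and et: "e \<cdot> t = e \<cdot> t'"
  shows "t \<sqsubseteq> t'"
proof -
  have [simp]: "t \<in> Arr C" "t' \<in> Arr C" "q \<in> Arr C" "Src C t = Src C q" "Src C t' = Src C q"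
    "Trg C t = Trg C q" "Trg C t' = Trg C q"
    using tq t'q by (auto simp: le_def)
  note [simp] = e(1,2)
  have "t\<degree> \<cdot> (\<one> (Trg C q) \<cdot> t) \<sqsubseteq> t\<degree> \<cdot> ((e\<degree> \<cdot> e) \<cdot> t)"
    using e(3) by (intro Cmp_le_right Cmp_le_left) simp_all
  also have "\<dots> = (e \<cdot> t)\<degree> \<cdot> (e \<cdot> t)" by simp
  also have "\<dots> = (e \<cdot> t')\<degree> \<cdot> (e \<cdot> t')" by (simp only: et)
  also have "\<dots> = t'\<degree> \<cdot> (e\<degree> \<cdot> (e \<cdot> t'))" by simp
  finally have 1: "t\<degree> \<cdot> t \<sqsubseteq> t'\<degree> \<cdot> (e\<degree> \<cdot> (e \<cdot> t'))" by simp
  have "\<one> (Src C q) \<sqinter> (t\<degree> \<cdot> t) \<sqsubseteq> \<one> (Src C q) \<sqinter> (t'\<degree> \<cdot> (e\<degree> \<cdot> (e \<cdot> t')))"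
    using 1 by (intro meet_le) simp_all
  also have "\<dots> \<sqsubseteq> t'\<degree> \<cdot> t'"
    using coreflexive_le_dom[of t' "e\<degree> \<cdot> (e \<cdot> t')"] by simp
  finally have 2: "\<one> (Src C q) \<sqinter> (t\<degree> \<cdot> t) \<sqsubseteq> t'\<degree> \<cdot> t'" .
  have "t \<sqsubseteq> t \<cdot> (\<one> (Src C q) \<sqinter> (t\<degree> \<cdot> t))"
    using le_self_dom[of t] by simp
  also have "\<dots> \<sqsubseteq> t \<cdot> (t'\<degree> \<cdot> t')"
    using 2 by (intro Cmp_le_right) simp_all
  also have "\<dots> \<sqsubseteq> q \<cdot> (q\<degree> \<cdot> t')"
    using tq t'q by (intro Cmp_le invol_le) simp_all
  also have "\<dots> \<sqsubseteq> t'"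
    using q by (intro functional_below) simp_all
  finally show ?thesis .
qed

end

section \<open>Symmetric monoidal structure\<close>

context symmetric_monoidal_2_category
begin

abbreviation tenO (infixr "\<bullet>" 80) where "X \<bullet> Y \<equiv> X \<odot>\<^bsub>M\<^esub> Y"
abbreviation tenA (infixr "\<star>" 80) where "f \<star> g \<equiv> f \<otimes>\<^bsub>M\<^esub> g"
abbreviation I where "I \<equiv> \<I>\<^bsub>M\<^esub>"
abbreviation asc where "asc \<equiv> \<a>\<^bsub>M\<^esub>"
abbreviation lun where "lun \<equiv> \<l>\<^bsub>M\<^esub>"
abbreviation run where "run \<equiv> \<r>\<^bsub>M\<^esub>"
abbreviation swp where "swp \<equiv> \<s>\<^bsub>M\<^esub>"
abbreviation asc' where "asc' X Y Z \<equiv> inv_arr C (asc X Y Z)"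
abbreviation lun' where "lun' X \<equiv> inv_arr C (lun X)"
abbreviation run' where "run' X \<equiv> inv_arr C (run X)"

lemmas [simp] = UnitO_Ob TenO_Ob TenA_Idn Assoc_iso LUnit_iso RUnit_iso Swap_Swap

lemma ten_simps [simp]:
  assumes "f \<in> Arr C" "g \<in> Arr C"
  shows "f \<star> g \<in> Arr C" "Src C (f \<star> g) = Src C f \<bullet> Src C g" "Trg C (f \<star> g) = Trg C f \<bullet> Trg C g"
  using TenA_Hom[OF Hom_self Hom_self, OF assms] by (auto simp: Hom_iff)

lemma interchange [simp]:
  assumes "f \<in> Arr C" "g \<in> Arr C" "f' \<in> Arr C" "g' \<in> Arr C" "Src C f' = Trg C f" "Src C g' = Trg C g"
  shows "(f' \<star> g') \<cdot> (f \<star> g) = (f' \<cdot> f) \<star> (g' \<cdot> g)"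
  using TenA_Cmp[of f "Src C f" "Trg C f" f' "Trg C f'" g "Src C g" "Trg C g" g' "Trg C g'"] assms
  by (simp add: Hom_def)

lemma interchange_chain [simp]:
  assumes "f \<in> Arr C" "g \<in> Arr C" "f' \<in> Arr C" "g' \<in> Arr C" "Src C f' = Trg C f" "Src C g' = Trg C g"
    and "x \<in> Arr C" "Trg C x = Src C f \<bullet> Src C g"
  shows "(f' \<star> g') \<cdot> ((f \<star> g) \<cdot> x) = ((f' \<cdot> f) \<star> (g' \<cdot> g)) \<cdot> x"
  using assms by (intro Cmp_in_chain) auto

lemma ten_le: "\<lbrakk>f \<sqsubseteq> f'; g \<sqsubseteq> g'\<rbrakk> \<Longrightarrow> f \<star> g \<sqsubseteq> f' \<star> g'"
  using TenA_mono[of f "Src C f" "Trg C f" f' g "Src C g" "Trg C g" g'] by (auto simp: le_def Hom_def)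

lemma structure_simps [simp]:
  "\<lbrakk>X \<in> Ob C; Y \<in> Ob C; Z \<in> Ob C\<rbrakk> \<Longrightarrow> asc X Y Z \<in> Arr C"
  "\<lbrakk>X \<in> Ob C; Y \<in> Ob C; Z \<in> Ob C\<rbrakk> \<Longrightarrow> Src C (asc X Y Z) = (X \<bullet> Y) \<bullet> Z"
  "\<lbrakk>X \<in> Ob C; Y \<in> Ob C; Z \<in> Ob C\<rbrakk> \<Longrightarrow> Trg C (asc X Y Z) = X \<bullet> (Y \<bullet> Z)"
  "X \<in> Ob C \<Longrightarrow> lun X \<in> Arr C" "X \<in> Ob C \<Longrightarrow> Src C (lun X) = I \<bullet> X" "X \<in> Ob C \<Longrightarrow> Trg C (lun X) = X"
  "X \<in> Ob C \<Longrightarrow> run X \<in> Arr C" "X \<in> Ob C \<Longrightarrow> Src C (run X) = X \<bullet> I" "X \<in> Ob C \<Longrightarrow> Trg C (run X) = X"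
  "\<lbrakk>X \<in> Ob C; Y \<in> Ob C\<rbrakk> \<Longrightarrow> swp X Y \<in> Arr C"
  "\<lbrakk>X \<in> Ob C; Y \<in> Ob C\<rbrakk> \<Longrightarrow> Src C (swp X Y) = X \<bullet> Y"
  "\<lbrakk>X \<in> Ob C; Y \<in> Ob C\<rbrakk> \<Longrightarrow> Trg C (swp X Y) = Y \<bullet> X"
  using Assoc_Hom LUnit_Hom RUnit_Hom Swap_Hom by (auto simp: Hom_iff)

lemma swp_swp_chain [simp]:
  "\<lbrakk>X \<in> Ob C; Y \<in> Ob C; x \<in> Arr C; Trg C x = X \<bullet> Y\<rbrakk> \<Longrightarrow> swp Y X \<cdot> (swp X Y \<cdot> x) = x"
  by (simp add: Cmp_in_chain[of "swp Y X" "swp X Y" "\<one> (X \<bullet> Y)"])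

lemma swp_inverse: "\<lbrakk>X \<in> Ob C; Y \<in> Ob C\<rbrakk> \<Longrightarrow> inverse_arrows C (swp X Y) (swp Y X)"
  by (simp add: inverse_arrows_def Hom_iff)

lemma swp_iso [simp]: "\<lbrakk>X \<in> Ob C; Y \<in> Ob C\<rbrakk> \<Longrightarrow> is_iso C (swp X Y)"
  using swp_inverse by (auto simp: is_iso_def)

lemma asc_natural:
  assumes "f \<in> Hom C X X'" "g \<in> Hom C Y Y'" "h \<in> Hom C Z Z'"
  shows "asc X' Y' Z' \<cdot> ((f \<star> g) \<star> h) = (f \<star> (g \<star> h)) \<cdot> asc X Y Z"
  using assms by (rule Assoc_natural)

lemma asc'_natural:
  assumes "f \<in> Hom C X X'" "g \<in> Hom C Y Y'" "h \<in> Hom C Z Z'"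
  shows "((f \<star> g) \<star> h) \<cdot> asc' X Y Z = asc' X' Y' Z' \<cdot> (f \<star> (g \<star> h))"
proof -
  note [simp] = assms[unfolded Hom_iff]
  have "asc' X' Y' Z' \<cdot> (asc X' Y' Z' \<cdot> ((f \<star> g) \<star> h)) \<cdot> asc' X Y Z =
      asc' X' Y' Z' \<cdot> ((f \<star> (g \<star> h)) \<cdot> asc X Y Z) \<cdot> asc' X Y Z"
    by (simp only: asc_natural[OF assms])
  then show ?thesis by simp
qed

lemma lun'_natural: "f \<in> Hom C X X' \<Longrightarrow> (\<one> I \<star> f) \<cdot> lun' X = lun' X' \<cdot> f"
proof -
  assume f: "f \<in> Hom C X X'"
  note [simp] = f[unfolded Hom_iff]
  have "lun' X' \<cdot> (lun X' \<cdot> (\<one> I \<star> f)) \<cdot> lun' X = lun' X' \<cdot> (f \<cdot> lun X) \<cdot> lun' X"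
    by (simp only: LUnit_natural[OF f])
  then show ?thesis by simp
qed

lemma run'_natural: "f \<in> Hom C X X' \<Longrightarrow> (f \<star> \<one> I) \<cdot> run' X = run' X' \<cdot> f"
proof -
  assume f: "f \<in> Hom C X X'"
  note [simp] = f[unfolded Hom_iff]
  have "run' X' \<cdot> (run X' \<cdot> (f \<star> \<one> I)) \<cdot> run' X = run' X' \<cdot> (f \<cdot> run X) \<cdot> run' X"
    by (simp only: RUnit_natural[OF f])
  then show ?thesis by simp
qed

lemma ten_I_faithful:
  assumes "f \<star> \<one> I = g \<star> \<one> I" "f \<in> Hom C X Y" "g \<in> Hom C X Y"
  shows "f = g"
proof (rule iso_cancel_right[of "run X"])
  note [simp] = assms(2,3)[unfolded Hom_iff]
  show "f \<cdot> run X = g \<cdot> run X"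
    using RUnit_natural[OF assms(2)] RUnit_natural[OF assms(3)] assms(1) by simp
qed (use assms in \<open>simp_all add: Hom_iff\<close>)

lemma I_ten_faithful:
  assumes "\<one> I \<star> f = \<one> I \<star> g" "f \<in> Hom C X Y" "g \<in> Hom C X Y"
  shows "f = g"
proof (rule iso_cancel_right[of "lun X"])
  note [simp] = assms(2,3)[unfolded Hom_iff]
  show "f \<cdot> lun X = g \<cdot> lun X"
    using LUnit_natural[OF assms(2)] LUnit_natural[OF assms(3)] assms(1) by simp
qed (use assms in \<open>simp_all add: Hom_iff\<close>)

text \<open>
  Kelly's argument for the remaining unit coherences: after tensoring with \<open>I\<close>, which is faithful, the
  equation becomes a consequence of the pentagon with one unit leg contracted by the triangle.
\<close>

lemma run_ten:
  assumes [simp]: "X \<in> Ob C" "Y \<in> Ob C"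
  shows "(\<one> X \<star> run Y) \<cdot> asc X Y I = run (X \<bullet> Y)"
proof -
  have "asc X Y I \<cdot> (run (X \<bullet> Y) \<star> \<one> I) =
      asc X Y I \<cdot> ((\<one> X \<star> \<one> Y) \<star> lun I) \<cdot> asc (X \<bullet> Y) I I"
    using triangle[of "X \<bullet> Y" I] by simp
  also have "\<dots> = (asc X Y I \<cdot> ((\<one> X \<star> \<one> Y) \<star> lun I)) \<cdot> asc (X \<bullet> Y) I I" by simp
  also have "\<dots> = ((\<one> X \<star> (\<one> Y \<star> lun I)) \<cdot> asc X Y (I \<bullet> I)) \<cdot> asc (X \<bullet> Y) I I"
    by (subst asc_natural[of _ X X _ Y Y _ "I \<bullet> I" I]) (simp_all add: Hom_iff)
  also have "\<dots> = (\<one> X \<star> (\<one> Y \<star> lun I)) \<cdot> (\<one> X \<star> asc Y I I) \<cdot> asc X (Y \<bullet> I) I \<cdot> (asc X Y I \<star> \<one> I)"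
    using pentagon[of X Y I I] by simp
  also have "\<dots> = (\<one> X \<star> (run Y \<star> \<one> I)) \<cdot> asc X (Y \<bullet> I) I \<cdot> (asc X Y I \<star> \<one> I)"
    using triangle[of Y I] by simp
  also have "\<dots> = ((\<one> X \<star> (run Y \<star> \<one> I)) \<cdot> asc X (Y \<bullet> I) I) \<cdot> (asc X Y I \<star> \<one> I)" by simp
  also have "\<dots> = (asc X Y I \<cdot> ((\<one> X \<star> run Y) \<star> \<one> I)) \<cdot> (asc X Y I \<star> \<one> I)"
    by (subst asc_natural[of _ X X _ "Y \<bullet> I" Y _ I I]) (simp_all add: Hom_iff)
  finally have *: "asc X Y I \<cdot> (run (X \<bullet> Y) \<star> \<one> I) = asc X Y I \<cdot> (((\<one> X \<star> run Y) \<cdot> asc X Y I) \<star> \<one> I)"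
    by simp
  have "run (X \<bullet> Y) \<star> \<one> I = ((\<one> X \<star> run Y) \<cdot> asc X Y I) \<star> \<one> I"
    by (rule iso_cancel_left[OF _ *]) simp_all
  then show ?thesis by (rule ten_I_faithful[symmetric, of _ _ "(X \<bullet> Y) \<bullet> I" "X \<bullet> Y"]) (simp_all add: Hom_iff)
qed

lemma lun_ten:
  assumes [simp]: "X \<in> Ob C" "Y \<in> Ob C"
  shows "lun (X \<bullet> Y) \<cdot> asc I X Y = lun X \<star> \<one> Y"
proof -
  have "(\<one> I \<star> (lun (X \<bullet> Y) \<cdot> asc I X Y)) \<cdot> asc I (I \<bullet> X) Y \<cdot> (asc I I X \<star> \<one> Y) =
      (\<one> I \<star> lun (X \<bullet> Y)) \<cdot> (asc I I (X \<bullet> Y) \<cdot> asc (I \<bullet> I) X Y)"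
    using pentagon[of I I X Y] by simp
  also have "\<dots> = ((\<one> I \<star> lun (X \<bullet> Y)) \<cdot> asc I I (X \<bullet> Y)) \<cdot> asc (I \<bullet> I) X Y" by simp
  also have "\<dots> = (run I \<star> (\<one> X \<star> \<one> Y)) \<cdot> asc (I \<bullet> I) X Y"
    using triangle[of I "X \<bullet> Y"] by simp
  also have "\<dots> = asc I X Y \<cdot> ((run I \<star> \<one> X) \<star> \<one> Y)"
    by (subst asc_natural[of _ "I \<bullet> I" I _ X X _ Y Y]) (simp_all add: Hom_iff)
  also have "\<dots> = (asc I X Y \<cdot> ((\<one> I \<star> lun X) \<star> \<one> Y)) \<cdot> (asc I I X \<star> \<one> Y)"
    using triangle[of I X] by simp
  also have "\<dots> = ((\<one> I \<star> (lun X \<star> \<one> Y)) \<cdot> asc I (I \<bullet> X) Y) \<cdot> (asc I I X \<star> \<one> Y)"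
    by (subst asc_natural[of _ I I _ "I \<bullet> X" X _ Y Y]) (simp_all add: Hom_iff)
  finally have *: "((\<one> I \<star> (lun (X \<bullet> Y) \<cdot> asc I X Y)) \<cdot> asc I (I \<bullet> X) Y) \<cdot> (asc I I X \<star> \<one> Y) =
      ((\<one> I \<star> (lun X \<star> \<one> Y)) \<cdot> asc I (I \<bullet> X) Y) \<cdot> (asc I I X \<star> \<one> Y)" by simp
  have iso: "is_iso C (asc I I X \<star> \<one> Y)"
    unfolding is_iso_def
    by (rule exI[of _ "asc' I I X \<star> \<one> Y"]) (simp add: inverse_arrows_def Hom_iff)
  have "\<one> I \<star> (lun (X \<bullet> Y) \<cdot> asc I X Y) = \<one> I \<star> (lun X \<star> \<one> Y)"
    by (rule iso_cancel_right[OF _ iso_cancel_right[OF iso *]]) simp_all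
  then show ?thesis by (rule I_ten_faithful[of _ _ "(I \<bullet> X) \<bullet> Y" "X \<bullet> Y"]) (simp_all add: Hom_iff)
qed

text \<open>The inverse of the hexagon.\<close>

lemma swp_ten:
  assumes [simp]: "X \<in> Ob C" "Y \<in> Ob C" "Z \<in> Ob C"
  shows "swp (Y \<bullet> Z) X = asc X Y Z \<cdot> (swp Y X \<star> \<one> Z) \<cdot> asc' Y X Z \<cdot> (\<one> Y \<star> swp Z X) \<cdot> asc Y Z X"
    (is "?l = ?r")
proof (rule iso_cancel_right)
  have "?r \<cdot> swp X (Y \<bullet> Z) \<cdot> asc X Y Z =
      asc X Y Z \<cdot> (swp Y X \<star> \<one> Z) \<cdot> asc' Y X Z \<cdot> (\<one> Y \<star> swp Z X) \<cdot>
        (asc Y Z X \<cdot> swp X (Y \<bullet> Z) \<cdot> asc X Y Z)" by simp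
  also have "\<dots> = asc X Y Z" by (subst hexagon) simp_all
  also have "\<dots> = ?l \<cdot> swp X (Y \<bullet> Z) \<cdot> asc X Y Z" by simp
  finally have *: "(?l \<cdot> swp X (Y \<bullet> Z)) \<cdot> asc X Y Z = (?r \<cdot> swp X (Y \<bullet> Z)) \<cdot> asc X Y Z"
    by (simp del: Swap_Swap swp_swp_chain)
  show "?l \<cdot> swp X (Y \<bullet> Z) = ?r \<cdot> swp X (Y \<bullet> Z)"
    by (rule iso_cancel_right[OF _ *]) simp_all
qed simp_all

text \<open>
  Two ways of exchanging the outer factors agree. The ternary symmetries \<open>swp (Z \<bullet> X) Y\<close> and
  \<open>swp (X \<bullet> Y) Z\<close> are expanded by \<open>swp_ten\<close>, after which everything cancels.
\<close>

lemma swp_outer: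
  assumes [simp]: "X \<in> Ob C" "Y \<in> Ob C" "Z \<in> Ob C"
  shows "(\<one> Y \<star> swp X Z) \<cdot> asc Y X Z \<cdot> (swp X Y \<star> \<one> Z) = swp (Z \<bullet> X) Y \<cdot> asc' Z X Y \<cdot> swp (X \<bullet> Y) Z"
proof -
  have "swp (Z \<bullet> X) Y = (swp (Z \<bullet> X) Y \<cdot> (swp X Z \<star> \<one> Y)) \<cdot> (swp Z X \<star> \<one> Y)"
    by simp
  also have "\<dots> = ((\<one> Y \<star> swp X Z) \<cdot> swp (X \<bullet> Z) Y) \<cdot> (swp Z X \<star> \<one> Y)"
    by (subst Swap_natural[of _ "X \<bullet> Z" "Z \<bullet> X" _ Y Y]) (simp_all add: Hom_iff)
  finally have 1: "swp (Z \<bullet> X) Y = (\<one> Y \<star> swp X Z) \<cdot> swp (X \<bullet> Z) Y \<cdot> (swp Z X \<star> \<one> Y)"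
    by simp
  have "swp (Z \<bullet> X) Y \<cdot> asc' Z X Y \<cdot> swp (X \<bullet> Y) Z = (\<one> Y \<star> swp X Z) \<cdot> asc Y X Z \<cdot>
    (swp X Y \<star> \<one> Z) \<cdot> asc' X Y Z \<cdot> (\<one> X \<star> swp Z Y) \<cdot> asc X Z Y \<cdot>
    (swp Z X \<star> \<one> Y) \<cdot> asc' Z X Y \<cdot> asc Z X Y \<cdot> (swp X Z \<star> \<one> Y) \<cdot> asc' X Z Y \<cdot> (\<one> X \<star> swp Y Z) \<cdot> asc X Y Z"
    unfolding 1 swp_ten[of Y X Z, simplified] swp_ten[of Z X Y, simplified] by simp
  also have "\<dots> = (\<one> Y \<star> swp X Z) \<cdot> asc Y X Z \<cdot> (swp X Y \<star> \<one> Z)" by simp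
  finally show ?thesis by simp
qed

lemma adjoint_ten:
  assumes "adjoint C f u" "adjoint C g v"
  shows "adjoint C (f \<star> g) (u \<star> v)"
proof -
  note [simp] = assms[unfolded adjoint_iff]
  have "\<one> (Src C f) \<star> \<one> (Src C g) \<sqsubseteq> (u \<cdot> f) \<star> (v \<cdot> g)"
    by (intro ten_le) simp_all
  moreover have "(f \<cdot> u) \<star> (g \<cdot> v) \<sqsubseteq> \<one> (Trg C f) \<star> \<one> (Trg C g)"
    by (intro ten_le) simp_all
  ultimately show ?thesis by (simp add: adjoint_iff)
qed

lemma map_ten [simp]: "\<lbrakk>is_map C f; is_map C g\<rbrakk> \<Longrightarrow> is_map C (f \<star> g)"
  unfolding is_map_def using adjoint_ten by blast

lemma radj_ten: "\<lbrakk>is_map C f; is_map C g\<rbrakk> \<Longrightarrow> radj C (f \<star> g) = radj C f \<star> radj C g"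
  by (intro radj_eqI adjoint_ten adjoint_radj)

end

section \<open>Self-duality in a bicategory of relations\<close>

context bicategory_of_relations
begin

abbreviation dg where "dg \<equiv> \<d>\<^bsub>M\<^esub>"
abbreviation au where "au \<equiv> \<e>\<^bsub>M\<^esub>"
abbreviation dg' where "dg' X \<equiv> radj C (dg X)"
abbreviation au' where "au' X \<equiv> radj C (au X)"
abbreviation cou where "cou \<equiv> dual_counit C M"
abbreviation uni where "uni \<equiv> dual_unit C M"
abbreviation tr where "tr \<equiv> transpose_arr C M"
abbreviation lp (infixl "\<triangle>" 70) where "r \<triangle> s \<equiv> local_product C M r s"

lemma comonoid_simps [simp]:
  assumes "X \<in> Ob C"
  shows "is_map C (dg X)" "dg X \<in> Arr C" "Src C (dg X) = X" "Trg C (dg X) = X \<bullet> X"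
    "is_map C (au X)" "au X \<in> Arr C" "Src C (au X) = X" "Trg C (au X) = I"
    "swp X X \<cdot> dg X = dg X"
  using comonoid[OF assms] assms by (auto simp: map_comonoid_def Hom_iff)

lemma counit_left: "X \<in> Ob C \<Longrightarrow> (au X \<star> \<one> X) \<cdot> dg X = lun' X"
  and counit_right: "X \<in> Ob C \<Longrightarrow> (\<one> X \<star> au X) \<cdot> dg X = run' X"
proof -
  assume [simp]: "X \<in> Ob C"
  show "(au X \<star> \<one> X) \<cdot> dg X = lun' X"
    by (rule inv_arr_left_eqI) (use comonoid[of X] in \<open>simp_all add: map_comonoid_def\<close>)
  show "(\<one> X \<star> au X) \<cdot> dg X = run' X"
    by (rule inv_arr_left_eqI) (use comonoid[of X] in \<open>simp_all add: map_comonoid_def\<close>)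
qed

lemma radj_counit_left: "X \<in> Ob C \<Longrightarrow> dg' X \<cdot> (au' X \<star> \<one> X) = lun X"
proof -
  assume X [simp]: "X \<in> Ob C"
  have "radj C ((au X \<star> \<one> X) \<cdot> dg X) = radj C (lun' X)" by (simp only: counit_left[OF X])
  moreover have "radj C (lun' X) = lun X"
    using inverse_arrows_inv_arr[of "lun X"]
    by (intro radj_eqI adjoint_inverse) (auto simp: inverse_arrows_def Hom_iff)
  ultimately show ?thesis
    by (simp add: radj_Cmp radj_ten radj_eqI[OF adjoint_Idn])
qed

lemma radj_counit_right: "X \<in> Ob C \<Longrightarrow> dg' X \<cdot> (\<one> X \<star> au' X) = run X"
proof -
  assume X [simp]: "X \<in> Ob C"
  have "radj C ((\<one> X \<star> au X) \<cdot> dg X) = radj C (run' X)" by (simp only: counit_right[OF X])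
  moreover have "radj C (run' X) = run X"
    using inverse_arrows_inv_arr[of "run X"]
    by (intro radj_eqI adjoint_inverse) (auto simp: inverse_arrows_def Hom_iff)
  ultimately show ?thesis
    by (simp add: radj_Cmp radj_ten radj_eqI[OF adjoint_Idn])
qed

lemma radj_swp: "\<lbrakk>X \<in> Ob C; Y \<in> Ob C\<rbrakk> \<Longrightarrow> radj C (swp X Y) = swp Y X"
  by (intro radj_eqI adjoint_inverse swp_inverse)

lemma radj_dg_swp [simp]: "X \<in> Ob C \<Longrightarrow> dg' X \<cdot> swp X X = dg' X"
  using radj_Cmp[of "dg X" "swp X X"] by (simp add: radj_swp)

lemma dual_simps [simp]:
  assumes "X \<in> Ob C"
  shows "cou X \<in> Arr C" "Src C (cou X) = X \<bullet> X" "Trg C (cou X) = I"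
    "uni X \<in> Arr C" "Src C (uni X) = I" "Trg C (uni X) = X \<bullet> X"
    "cou X \<cdot> swp X X = cou X"
  using assms by (simp_all add: dual_counit_def dual_unit_def)

text \<open>
  The Frobenius law is assumed for one bracketing only; commutativity of the comonoids turns it
  into the law for the other one.
\<close>

lemma Frobenius_mirror:
  assumes [simp]: "X \<in> Ob C"
  shows "dg X \<cdot> dg' X = (\<one> X \<star> dg' X) \<cdot> asc X X X \<cdot> (dg X \<star> \<one> X)"
proof -
  have n1: "swp (X \<bullet> X) X \<cdot> (dg X \<star> \<one> X) = (\<one> X \<star> dg X) \<cdot> swp X X"
    by (rule Swap_natural) (simp_all add: Hom_iff)
  have n2: "swp X X \<cdot> (dg' X \<star> \<one> X) = (\<one> X \<star> dg' X) \<cdot> swp (X \<bullet> X) X"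
    by (rule Swap_natural) (simp_all add: Hom_iff)
  have "(\<one> X \<star> dg' X) \<cdot> asc X X X \<cdot> (dg X \<star> \<one> X) =
      (\<one> X \<star> dg' X) \<cdot> ((\<one> X \<star> swp X X) \<cdot> asc X X X \<cdot> (swp X X \<star> \<one> X)) \<cdot> (dg X \<star> \<one> X)"
    by simp
  also have "\<dots> = ((\<one> X \<star> dg' X) \<cdot> swp (X \<bullet> X) X) \<cdot> asc' X X X \<cdot> (swp (X \<bullet> X) X \<cdot> (dg X \<star> \<one> X))"
    unfolding swp_outer[of X X X, simplified] by simp
  also have "\<dots> = swp X X \<cdot> ((dg' X \<star> \<one> X) \<cdot> asc' X X X \<cdot> (\<one> X \<star> dg X)) \<cdot> swp X X"
    unfolding n1 n2[symmetric] by simp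
  also have "\<dots> = (swp X X \<cdot> dg X) \<cdot> (dg' X \<cdot> swp X X)"
    unfolding Frobenius[symmetric, of X, simplified] by (simp del: comonoid_simps(9) radj_dg_swp)
  finally show ?thesis by simp
qed

text \<open>
  A bent wire fed into a multiplication is a diagonal: Frobenius trades the pair for \<open>dg X \<cdot> dg' X\<close>, whose
  second factor is cancelled by the unit. Discarding one output gives the zigzag identities.
\<close>

lemma uni_dg:
  assumes [simp]: "X \<in> Ob C"
  shows "(dg' X \<star> \<one> X) \<cdot> asc' X X X \<cdot> (\<one> X \<star> uni X) \<cdot> run' X = dg X"
proof -
  have "(dg' X \<star> \<one> X) \<cdot> asc' X X X \<cdot> (\<one> X \<star> uni X) \<cdot> run' X =
      ((dg' X \<star> \<one> X) \<cdot> asc' X X X \<cdot> (\<one> X \<star> dg X)) \<cdot> (\<one> X \<star> au' X) \<cdot> run' X"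
    by (simp add: dual_unit_def)
  also have "\<dots> = dg X \<cdot> (dg' X \<cdot> (\<one> X \<star> au' X)) \<cdot> run' X"
    unfolding Frobenius[symmetric, of X, simplified] by simp
  finally show ?thesis by (simp add: radj_counit_right)
qed

lemma uni_dg_mirror:
  assumes [simp]: "X \<in> Ob C"
  shows "(\<one> X \<star> dg' X) \<cdot> asc X X X \<cdot> (uni X \<star> \<one> X) \<cdot> lun' X = dg X"
proof -
  have "(\<one> X \<star> dg' X) \<cdot> asc X X X \<cdot> (uni X \<star> \<one> X) \<cdot> lun' X =
      ((\<one> X \<star> dg' X) \<cdot> asc X X X \<cdot> (dg X \<star> \<one> X)) \<cdot> (au' X \<star> \<one> X) \<cdot> lun' X"
    by (simp add: dual_unit_def)
  also have "\<dots> = dg X \<cdot> (dg' X \<cdot> (au' X \<star> \<one> X)) \<cdot> lun' X"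
    unfolding Frobenius_mirror[symmetric, of X, simplified] by simp
  finally show ?thesis by (simp add: radj_counit_left)
qed

lemma zigzag:
  assumes [simp]: "X \<in> Ob C"
  shows "(cou X \<star> \<one> X) \<cdot> asc' X X X \<cdot> (\<one> X \<star> uni X) \<cdot> run' X = lun' X"
proof -
  have "(cou X \<star> \<one> X) \<cdot> asc' X X X \<cdot> (\<one> X \<star> uni X) \<cdot> run' X =
    (au X \<star> \<one> X) \<cdot> ((dg' X \<star> \<one> X) \<cdot> asc' X X X \<cdot> (\<one> X \<star> uni X) \<cdot> run' X)"
    by (simp add: dual_counit_def)
  then show ?thesis by (simp only: uni_dg[OF assms] counit_left[OF assms])
qed

lemma zigzag_mirror:
  assumes [simp]: "X \<in> Ob C"
  shows "(\<one> X \<star> cou X) \<cdot> asc X X X \<cdot> (uni X \<star> \<one> X) \<cdot> lun' X = run' X"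
proof -
  have "(\<one> X \<star> cou X) \<cdot> asc X X X \<cdot> (uni X \<star> \<one> X) \<cdot> lun' X =
    (\<one> X \<star> au X) \<cdot> ((\<one> X \<star> dg' X) \<cdot> asc X X X \<cdot> (uni X \<star> \<one> X) \<cdot> lun' X)"
    by (simp add: dual_counit_def)
  then show ?thesis by (simp only: uni_dg_mirror[OF assms] counit_right[OF assms])
qed

lemma triangle':
  assumes [simp]: "X \<in> Ob C" "Y \<in> Ob C"
  shows "\<one> X \<star> lun' Y = asc X I Y \<cdot> (run' X \<star> \<one> Y)"
proof -
  have "\<one> X \<star> lun' Y = (\<one> X \<star> lun' Y) \<cdot> ((\<one> X \<star> lun Y) \<cdot> asc X I Y) \<cdot> (run' X \<star> \<one> Y)"
    by (subst triangle) simp_all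
  also have "\<dots> = asc X I Y \<cdot> (run' X \<star> \<one> Y)" by simp
  finally show ?thesis .
qed

lemma lun'_ten:
  assumes [simp]: "X \<in> Ob C" "Y \<in> Ob C"
  shows "asc I X Y \<cdot> (lun' X \<star> \<one> Y) = lun' (X \<bullet> Y)"
proof (rule inv_arr_left_eqI)
  have "lun (X \<bullet> Y) \<cdot> asc I X Y \<cdot> (lun' X \<star> \<one> Y) = (lun (X \<bullet> Y) \<cdot> asc I X Y) \<cdot> (lun' X \<star> \<one> Y)"
    by simp
  also have "\<dots> = \<one> (X \<bullet> Y)" by (subst lun_ten) simp_all
  finally show "lun (X \<bullet> Y) \<cdot> asc I X Y \<cdot> (lun' X \<star> \<one> Y) = \<one> (Trg C (lun (X \<bullet> Y)))" by simp
qed simp_all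

lemma run'_ten:
  assumes [simp]: "X \<in> Ob C" "Y \<in> Ob C"
  shows "\<one> X \<star> run' Y = asc X Y I \<cdot> run' (X \<bullet> Y)"
proof -
  have "\<one> X \<star> run' Y = (\<one> X \<star> run' Y) \<cdot> ((\<one> X \<star> run Y) \<cdot> asc X Y I) \<cdot> run' (X \<bullet> Y)"
    by (subst run_ten) simp_all
  also have "\<dots> = asc X Y I \<cdot> run' (X \<bullet> Y)" by simp
  finally show ?thesis .
qed

lemma lax_Aug_le: "r \<in> Hom C X Y \<Longrightarrow> au Y \<cdot> r \<sqsubseteq> au X"
  using lax_Aug[of r X Y] by (auto simp: le_def Hom_iff)

lemma lax_Diag_le: "r \<in> Hom C X Y \<Longrightarrow> dg Y \<cdot> r \<sqsubseteq> (r \<star> r) \<cdot> dg X"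
  using lax_Diag[of r X Y] by (auto simp: le_def Hom_iff)

lemma au_map:
  assumes "is_map C f" "f \<in> Hom C X Y"
  shows "au Y \<cdot> f = au X"
proof (rule le_antisym[OF lax_Aug_le[OF assms(2)]])
  note [simp] = assms(1) assms(2)[unfolded Hom_iff]
  have "au X \<cdot> \<one> X \<sqsubseteq> au X \<cdot> (radj C f \<cdot> f)"
    by (intro Cmp_le_right radj_unit) simp_all
  also have "\<dots> = (au X \<cdot> radj C f) \<cdot> f" by simp
  also have "\<dots> \<sqsubseteq> au Y \<cdot> f"
    by (intro Cmp_le_left lax_Aug_le) (simp_all add: Hom_iff)
  finally show "au X \<sqsubseteq> au Y \<cdot> f" by simp
qed

lemma dg_map:
  assumes "is_map C f" "f \<in> Hom C X Y"
  shows "dg Y \<cdot> f = (f \<star> f) \<cdot> dg X"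
proof (rule le_antisym[OF lax_Diag_le[OF assms(2)]])
  note [simp] = assms(1) assms(2)[unfolded Hom_iff]
  have "(f \<star> f) \<cdot> dg X \<cdot> \<one> X \<sqsubseteq> (f \<star> f) \<cdot> dg X \<cdot> (radj C f \<cdot> f)"
    by (intro Cmp_le_right radj_unit) simp_all
  also have "\<dots> = (f \<star> f) \<cdot> (dg X \<cdot> radj C f) \<cdot> f" by simp
  also have "\<dots> \<sqsubseteq> (f \<star> f) \<cdot> ((radj C f \<star> radj C f) \<cdot> dg Y) \<cdot> f"
    by (intro Cmp_le_right Cmp_le_left lax_Diag_le) (simp_all add: Hom_iff)
  also have "\<dots> = ((f \<cdot> radj C f) \<star> (f \<cdot> radj C f)) \<cdot> (dg Y \<cdot> f)" by simp
  also have "\<dots> \<sqsubseteq> (\<one> Y \<star> \<one> Y) \<cdot> (dg Y \<cdot> f)"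
    by (intro Cmp_le_left ten_le radj_counit) simp_all
  finally show "(f \<star> f) \<cdot> dg X \<sqsubseteq> dg Y \<cdot> f" by simp
qed

text \<open>
  The arrow \<open>au I\<close> is idempotent because augmentations are natural for maps, and it has a section
  because the counit law makes \<open>(\<one> I \<star> au I) \<cdot> dg I\<close> invertible. Hence \<open>I\<close> is terminal for maps.
\<close>

lemma au_I [simp]: "au I = \<one> I"
proof -
  have idem: "au I \<cdot> au I = au I" by (rule au_map) (simp_all add: Hom_iff)
  have "au I \<cdot> (lun I \<cdot> dg I \<cdot> run I) = (au I \<cdot> lun I) \<cdot> dg I \<cdot> run I" by simp
  also have "\<dots> = (lun I \<cdot> (\<one> I \<star> au I)) \<cdot> dg I \<cdot> run I"
    by (subst LUnit_natural[of "au I" I I]) (simp_all add: Hom_iff)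
  also have "\<dots> = lun I \<cdot> ((\<one> I \<star> au I) \<cdot> dg I) \<cdot> run I" by simp
  also have "\<dots> = lun I" by (subst counit_right) simp_all
  finally have "(au I \<cdot> (lun I \<cdot> dg I \<cdot> run I)) \<cdot> lun' I = \<one> I" by simp
  then have sec: "au I \<cdot> (lun I \<cdot> dg I \<cdot> run I \<cdot> lun' I) = \<one> I" by simp
  have "au I = au I \<cdot> (au I \<cdot> (lun I \<cdot> dg I \<cdot> run I \<cdot> lun' I))"
    by (subst sec) simp
  also have "\<dots> = (au I \<cdot> au I) \<cdot> (lun I \<cdot> dg I \<cdot> run I \<cdot> lun' I)" by simp
  also have "\<dots> = \<one> I" by (simp only: idem sec)
  finally show ?thesis .
qed

lemma le_au: "r \<in> Hom C X I \<Longrightarrow> r \<sqsubseteq> au X"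
  using lax_Aug_le[of r X I] by (simp add: Hom_iff)

lemma map_into_I: "\<lbrakk>is_map C f; f \<in> Hom C X I\<rbrakk> \<Longrightarrow> f = au X"
  using au_map[of f X I] by (simp add: Hom_iff)

lemma run_I: "run I = lun I"
  by (rule trans[OF map_into_I map_into_I[symmetric], of _ "I \<bullet> I"]) (simp_all add: Hom_iff)

text \<open>Bending the second input of \<open>k : X \<bullet> Y \<rightarrow> I\<close>; a transpose is such a bend.\<close>

definition bend :: "'b \<Rightarrow> 'a \<Rightarrow> 'a \<Rightarrow> 'b"
  where "bend k X Y = run X \<cdot> (\<one> X \<star> k) \<cdot> asc X X Y \<cdot> (uni X \<star> \<one> Y) \<cdot> lun' Y"

lemma transpose_bend:
  assumes "s \<in> Hom C X Y"
  shows "tr s = bend (cou Y \<cdot> (s \<star> \<one> Y)) X Y"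
  using assms by (simp add: transpose_arr_def bend_def Hom_iff)

lemma bend_simps [simp]:
  assumes "k \<in> Arr C" "Src C k = X \<bullet> Y" "Trg C k = I" "X \<in> Ob C" "Y \<in> Ob C"
  shows "bend k X Y \<in> Arr C" "Src C (bend k X Y) = Y" "Trg C (bend k X Y) = X"
  using assms by (simp_all add: bend_def)

text \<open>
  Straightening \<open>bend k X Y\<close> leaves the zigzag \<open>(cou X \<star> \<one>) \<cdot> asc' X X X \<cdot> (\<one> \<star> uni X)\<close> on the wire \<open>X\<close>; all
  other steps move the brackets until that zigzag is exposed.
\<close>

lemma cou_bend:
  assumes "k \<in> Arr C" "Src C k = X \<bullet> Y" "Trg C k = I" "X \<in> Ob C" "Y \<in> Ob C"
  shows "cou X \<cdot> (\<one> X \<star> bend k X Y) = k"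
proof -
  note [simp] = assms
  have "cou X \<cdot> (\<one> X \<star> bend k X Y) =
      cou X \<cdot> (\<one> X \<star> run X) \<cdot> (\<one> X \<star> (\<one> X \<star> k)) \<cdot> (\<one> X \<star> asc X X Y) \<cdot> (\<one> X \<star> (uni X \<star> \<one> Y)) \<cdot> (\<one> X \<star> lun' Y)"
    by (simp add: bend_def)
  also have "\<dots> = cou X \<cdot> (\<one> X \<star> run X) \<cdot> (\<one> X \<star> (\<one> X \<star> k)) \<cdot> (\<one> X \<star> asc X X Y) \<cdot>
      ((\<one> X \<star> (uni X \<star> \<one> Y)) \<cdot> asc X I Y) \<cdot> (run' X \<star> \<one> Y)"
    by (subst triangle') simp_all
  also have "\<dots> = cou X \<cdot> (\<one> X \<star> run X) \<cdot> (\<one> X \<star> (\<one> X \<star> k)) \<cdot> (\<one> X \<star> asc X X Y) \<cdot>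
      (asc X (X \<bullet> X) Y \<cdot> ((\<one> X \<star> uni X) \<star> \<one> Y)) \<cdot> (run' X \<star> \<one> Y)"
    by (subst asc_natural[of _ X X _ I "X \<bullet> X" _ Y Y]) (simp_all add: Hom_iff)
  also have "\<dots> = cou X \<cdot> (\<one> X \<star> run X) \<cdot> (\<one> X \<star> (\<one> X \<star> k)) \<cdot>
      ((\<one> X \<star> asc X X Y) \<cdot> asc X (X \<bullet> X) Y \<cdot> (asc X X X \<star> \<one> Y)) \<cdot> (asc' X X X \<star> \<one> Y) \<cdot> ((\<one> X \<star> uni X) \<star> \<one> Y) \<cdot> (run' X \<star> \<one> Y)"
    by simp
  also have "\<dots> = cou X \<cdot> (\<one> X \<star> run X) \<cdot> ((\<one> X \<star> (\<one> X \<star> k)) \<cdot> asc X X (X \<bullet> Y)) \<cdot>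
      asc (X \<bullet> X) X Y \<cdot> (asc' X X X \<star> \<one> Y) \<cdot> ((\<one> X \<star> uni X) \<star> \<one> Y) \<cdot> (run' X \<star> \<one> Y)"
    by (subst pentagon[symmetric]) simp_all
  also have "\<dots> = cou X \<cdot> (\<one> X \<star> run X) \<cdot> (asc X X I \<cdot> ((\<one> X \<star> \<one> X) \<star> k)) \<cdot>
      asc (X \<bullet> X) X Y \<cdot> (asc' X X X \<star> \<one> Y) \<cdot> ((\<one> X \<star> uni X) \<star> \<one> Y) \<cdot> (run' X \<star> \<one> Y)"
    by (subst asc_natural[of _ X X _ X X _ "X \<bullet> Y" I]) (simp_all add: Hom_iff)
  also have "\<dots> = cou X \<cdot> ((\<one> X \<star> run X) \<cdot> asc X X I) \<cdot> (\<one> (X \<bullet> X) \<star> k) \<cdot>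
      asc (X \<bullet> X) X Y \<cdot> (asc' X X X \<star> \<one> Y) \<cdot> ((\<one> X \<star> uni X) \<star> \<one> Y) \<cdot> (run' X \<star> \<one> Y)"
    by simp
  also have "\<dots> = (cou X \<cdot> run (X \<bullet> X)) \<cdot> (\<one> (X \<bullet> X) \<star> k) \<cdot>
      asc (X \<bullet> X) X Y \<cdot> (asc' X X X \<star> \<one> Y) \<cdot> ((\<one> X \<star> uni X) \<star> \<one> Y) \<cdot> (run' X \<star> \<one> Y)"
    by (subst run_ten) simp_all
  also have "\<dots> = (run I \<cdot> (cou X \<star> \<one> I)) \<cdot> (\<one> (X \<bullet> X) \<star> k) \<cdot>
      asc (X \<bullet> X) X Y \<cdot> (asc' X X X \<star> \<one> Y) \<cdot> ((\<one> X \<star> uni X) \<star> \<one> Y) \<cdot> (run' X \<star> \<one> Y)"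
    by (subst RUnit_natural[of "cou X" "X \<bullet> X" I]) (simp_all add: Hom_iff)
  also have "\<dots> = run I \<cdot> (\<one> I \<star> k) \<cdot> ((cou X \<star> (\<one> X \<star> \<one> Y)) \<cdot>
      asc (X \<bullet> X) X Y) \<cdot> (asc' X X X \<star> \<one> Y) \<cdot> ((\<one> X \<star> uni X) \<star> \<one> Y) \<cdot> (run' X \<star> \<one> Y)"
    by simp
  also have "\<dots> = run I \<cdot> (\<one> I \<star> k) \<cdot> (asc I X Y \<cdot> ((cou X \<star> \<one> X) \<star> \<one> Y))
       \<cdot> (asc' X X X \<star> \<one> Y) \<cdot> ((\<one> X \<star> uni X) \<star> \<one> Y) \<cdot> (run' X \<star> \<one> Y)"
    by (subst asc_natural[of _ "X \<bullet> X" I _ X X _ Y Y]) (simp_all add: Hom_iff)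
  also have "\<dots> = run I \<cdot> (\<one> I \<star> k) \<cdot> asc I X Y \<cdot> (((cou X \<star> \<one> X) \<cdot> asc' X X X \<cdot> (\<one> X \<star> uni X) \<cdot> run' X) \<star> \<one> Y)"
    by simp
  also have "\<dots> = run I \<cdot> (\<one> I \<star> k) \<cdot> lun' (X \<bullet> Y)"
    by (simp only: zigzag assms lun'_ten)
  also have "\<dots> = k"
    by (subst lun'_natural[of k "X \<bullet> Y" I]) (simp_all add: Hom_iff run_I)
  finally show ?thesis .
qed

lemma bend_cou:
  assumes "t \<in> Hom C Y X"
  shows "bend (cou X \<cdot> (\<one> X \<star> t)) X Y = t"
proof -
  note [simp] = assms[unfolded Hom_iff]
  have "bend (cou X \<cdot> (\<one> X \<star> t)) X Y =
      run X \<cdot> (\<one> X \<star> cou X) \<cdot> ((\<one> X \<star> (\<one> X \<star> t)) \<cdot> asc X X Y) \<cdot> (uni X \<star> \<one> Y) \<cdot> lun' Y"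
    by (simp add: bend_def)
  also have "\<dots> = run X \<cdot> (\<one> X \<star> cou X) \<cdot> (asc X X X \<cdot> ((\<one> X \<star> \<one> X) \<star> t)) \<cdot> (uni X \<star> \<one> Y) \<cdot> lun' Y"
    by (subst asc_natural[of _ X X _ X X _ Y X]) (simp_all add: Hom_iff)
  also have "\<dots> = run X \<cdot> (\<one> X \<star> cou X) \<cdot> asc X X X \<cdot> (uni X \<star> \<one> X) \<cdot> ((\<one> I \<star> t) \<cdot> lun' Y)"
    by simp
  also have "\<dots> = run X \<cdot> (\<one> X \<star> cou X) \<cdot> asc X X X \<cdot> (uni X \<star> \<one> X) \<cdot> (lun' X \<cdot> t)"
    by (simp only: lun'_natural[OF assms])
  also have "\<dots> = run X \<cdot> ((\<one> X \<star> cou X) \<cdot> asc X X X \<cdot> (uni X \<star> \<one> X) \<cdot> lun' X) \<cdot> t"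
    by simp
  also have "\<dots> = t" by (subst zigzag_mirror) simp_all
  finally show ?thesis .
qed

lemma tr_simps [simp]:
  assumes "s \<in> Arr C"
  shows "tr s \<in> Arr C" "Src C (tr s) = Trg C s" "Trg C (tr s) = Src C s"
  using assms transpose_bend[OF Hom_self[OF assms]] by simp_all

text \<open>
  The transpose of \<open>s\<close> is the only arrow that satisfies the next equation. This description turns
  functoriality and involutivity of \<open>tr\<close> into short computations.
\<close>

lemma slide_cou:
  assumes "s \<in> Hom C X Y"
  shows "cou X \<cdot> (\<one> X \<star> tr s) = cou Y \<cdot> (s \<star> \<one> Y)"
  using assms cou_bend[of "cou Y \<cdot> (s \<star> \<one> Y)" X Y] by (simp add: transpose_bend[OF assms] Hom_iff)

lemma tr_eqI:
  assumes "s \<in> Hom C X Y" "t \<in> Hom C Y X" "cou X \<cdot> (\<one> X \<star> t) = cou Y \<cdot> (s \<star> \<one> Y)"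
  shows "tr s = t"
  using bend_cou[OF assms(2)] transpose_bend[OF assms(1)] assms(3) by simp

lemma tr_Idn: "X \<in> Ob C \<Longrightarrow> tr (\<one> X) = \<one> X"
  by (intro tr_eqI[of _ X X]) (simp_all add: Hom_iff)

lemma tr_Cmp:
  assumes "r \<in> Hom C X Y" "s \<in> Hom C Y Z"
  shows "tr (s \<cdot> r) = tr r \<cdot> tr s"
proof (rule tr_eqI[of _ X Z])
  note [simp] = assms[unfolded Hom_iff]
  have "cou X \<cdot> (\<one> X \<star> (tr r \<cdot> tr s)) = (cou X \<cdot> (\<one> X \<star> tr r)) \<cdot> (\<one> X \<star> tr s)" by simp
  also have "\<dots> = (cou Y \<cdot> (r \<star> \<one> Y)) \<cdot> (\<one> X \<star> tr s)" by (simp only: slide_cou[OF assms(1)])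
  also have "\<dots> = (cou Y \<cdot> (\<one> Y \<star> tr s)) \<cdot> (r \<star> \<one> Z)" by simp
  also have "\<dots> = (cou Z \<cdot> (s \<star> \<one> Z)) \<cdot> (r \<star> \<one> Z)" by (simp only: slide_cou[OF assms(2)])
  finally show "cou X \<cdot> (\<one> X \<star> (tr r \<cdot> tr s)) = cou Z \<cdot> ((s \<cdot> r) \<star> \<one> Z)" by simp
qed (use assms in \<open>simp_all add: Hom_iff\<close>)

lemma tr_tr:
  assumes "s \<in> Hom C X Y"
  shows "tr (tr s) = s"
proof (rule tr_eqI[of _ Y X])
  note [simp] = assms[unfolded Hom_iff]
  have "cou Y \<cdot> (\<one> Y \<star> s) = cou Y \<cdot> (swp Y Y \<cdot> (\<one> Y \<star> s))"
    using Cmp_in_chain[of "cou Y" "swp Y Y" "cou Y" "\<one> Y \<star> s"] by simp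
  also have "\<dots> = cou Y \<cdot> ((s \<star> \<one> Y) \<cdot> swp Y X)"
    by (subst Swap_natural[of _ Y Y _ X Y]) (simp_all add: Hom_iff)
  also have "\<dots> = (cou Y \<cdot> (s \<star> \<one> Y)) \<cdot> swp Y X" by simp
  also have "\<dots> = (cou X \<cdot> (\<one> X \<star> tr s)) \<cdot> swp Y X" by (simp only: slide_cou[OF assms])
  also have "\<dots> = cou X \<cdot> ((\<one> X \<star> tr s) \<cdot> swp Y X)" by simp
  also have "\<dots> = cou X \<cdot> (swp X X \<cdot> (tr s \<star> \<one> X))"
    by (subst Swap_natural[of _ Y X _ X X]) (simp_all add: Hom_iff)
  also have "\<dots> = cou X \<cdot> (tr s \<star> \<one> X)"
    using Cmp_in_chain[of "cou X" "swp X X" "cou X" "tr s \<star> \<one> X"] by simp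
  finally show "cou Y \<cdot> (\<one> Y \<star> s) = cou X \<cdot> (tr s \<star> \<one> X)" .
qed (use assms in \<open>simp_all add: Hom_iff\<close>)

lemma tr_le:
  assumes "r \<sqsubseteq> s"
  shows "tr r \<sqsubseteq> tr s"
proof -
  have [simp]: "r \<in> Arr C" "s \<in> Arr C" "Src C r = Src C s" "Trg C r = Trg C s"
    using assms by (auto simp: le_def)
  show ?thesis
    using assms unfolding transpose_bend[OF Hom_self[of s], simplified]
      transpose_bend[OF Hom_self[of r], simplified] bend_def
    by (intro Cmp_le_right Cmp_le_left ten_le le_refl) simp_all
qed

text \<open>
  The same for arrows \<open>n : I \<rightarrow> X \<bullet> Y\<close>. It transports \<open>slide_cou\<close> from counits to units, as both sides of
  \<open>slide_uni\<close> unbend to \<open>r\<close>.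
\<close>

definition unbend :: "'b \<Rightarrow> 'a \<Rightarrow> 'a \<Rightarrow> 'b"
  where "unbend n X Y = lun Y \<cdot> (cou X \<star> \<one> Y) \<cdot> asc' X X Y \<cdot> (\<one> X \<star> n) \<cdot> run' X"

lemma unbend_uni:
  assumes "n \<in> Hom C I (X \<bullet> Y)" "X \<in> Ob C" "Y \<in> Ob C"
  shows "(\<one> X \<star> unbend n X Y) \<cdot> uni X = n"
proof -
  note [simp] = assms(1)[unfolded Hom_iff] assms(2,3)
  have pent: "(\<one> X \<star> asc' X X Y) \<cdot> asc X X (X \<bullet> Y) =
      asc X (X \<bullet> X) Y \<cdot> (asc X X X \<star> \<one> Y) \<cdot> asc' (X \<bullet> X) X Y"
  proof -
    have "(\<one> X \<star> asc' X X Y) \<cdot> asc X X (X \<bullet> Y) =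
      (\<one> X \<star> asc' X X Y) \<cdot> (asc X X (X \<bullet> Y) \<cdot> asc (X \<bullet> X) X Y) \<cdot> asc' (X \<bullet> X) X Y" by simp
    also have "\<dots> = asc X (X \<bullet> X) Y \<cdot> (asc X X X \<star> \<one> Y) \<cdot> asc' (X \<bullet> X) X Y"
      by (subst pentagon) simp_all
    finally show ?thesis .
  qed
  have "(\<one> X \<star> unbend n X Y) \<cdot> uni X =
     (\<one> X \<star> lun Y) \<cdot> (\<one> X \<star> (cou X \<star> \<one> Y)) \<cdot> (\<one> X \<star> asc' X X Y) \<cdot> (\<one> X \<star> (\<one> X \<star> n)) \<cdot> (\<one> X \<star> run' X) \<cdot> uni X"
    by (simp add: unbend_def)
  also have "\<dots> = (\<one> X \<star> lun Y) \<cdot> (\<one> X \<star> (cou X \<star> \<one> Y)) \<cdot> (\<one> X \<star> asc' X X Y) \<cdot>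
      ((\<one> X \<star> (\<one> X \<star> n)) \<cdot> asc X X I) \<cdot> (run' (X \<bullet> X) \<cdot> uni X)"
    by (subst run'_ten) simp_all
  also have "\<dots> = (\<one> X \<star> lun Y) \<cdot> (\<one> X \<star> (cou X \<star> \<one> Y)) \<cdot> (\<one> X \<star> asc' X X Y) \<cdot>
      (asc X X (X \<bullet> Y) \<cdot> ((\<one> X \<star> \<one> X) \<star> n)) \<cdot> ((uni X \<star> \<one> I) \<cdot> run' I)"
    by (subst asc_natural[of _ X X _ X X _ I "X \<bullet> Y"])
      (simp_all add: Hom_iff run'_natural[of "uni X" I "X \<bullet> X", symmetric] del: interchange_chain)
  also have "\<dots> = (\<one> X \<star> lun Y) \<cdot> (\<one> X \<star> (cou X \<star> \<one> Y)) \<cdot> ((\<one> X \<star> asc' X X Y) \<cdot> asc X X (X \<bullet> Y)) \<cdot>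
      (uni X \<star> (\<one> X \<star> \<one> Y)) \<cdot> ((\<one> I \<star> n) \<cdot> lun' I)"
    by (simp add: run_I)
  also have "\<dots> = (\<one> X \<star> lun Y) \<cdot> (\<one> X \<star> (cou X \<star> \<one> Y)) \<cdot> (asc X (X \<bullet> X) Y \<cdot> (asc X X X \<star> \<one> Y) \<cdot> asc' (X \<bullet> X) X Y) \<cdot>
      (uni X \<star> (\<one> X \<star> \<one> Y)) \<cdot> (lun' (X \<bullet> Y) \<cdot> n)"
    by (simp only: pent lun'_natural[OF assms(1)])
  also have "\<dots> = (\<one> X \<star> lun Y) \<cdot> ((\<one> X \<star> (cou X \<star> \<one> Y)) \<cdot> asc X (X \<bullet> X) Y) \<cdot> (asc X X X \<star> \<one> Y) \<cdot>
      (asc' (X \<bullet> X) X Y \<cdot> (uni X \<star> (\<one> X \<star> \<one> Y))) \<cdot> lun' (X \<bullet> Y) \<cdot> n"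
    by simp
  also have "\<dots> = (\<one> X \<star> lun Y) \<cdot> (asc X I Y \<cdot> ((\<one> X \<star> cou X) \<star> \<one> Y)) \<cdot> (asc X X X \<star> \<one> Y) \<cdot>
      (asc' (X \<bullet> X) X Y \<cdot> (uni X \<star> (\<one> X \<star> \<one> Y))) \<cdot> lun' (X \<bullet> Y) \<cdot> n"
    by (subst asc_natural[of _ X X _ "X \<bullet> X" I _ Y Y]) (simp_all add: Hom_iff)
  also have "\<dots> = (\<one> X \<star> lun Y) \<cdot> (asc X I Y \<cdot> ((\<one> X \<star> cou X) \<star> \<one> Y)) \<cdot> (asc X X X \<star> \<one> Y) \<cdot>
      (((uni X \<star> \<one> X) \<star> \<one> Y) \<cdot> asc' I X Y) \<cdot> (asc I X Y \<cdot> (lun' X \<star> \<one> Y)) \<cdot> n"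
    by (subst asc'_natural[of _ I "X \<bullet> X" _ X X _ Y Y], simp_all only: lun'_ten[OF assms(2,3)])
      (simp_all add: Hom_iff)
  also have "\<dots> = ((\<one> X \<star> lun Y) \<cdot> asc X I Y) \<cdot>
      (((\<one> X \<star> cou X) \<cdot> asc X X X \<cdot> (uni X \<star> \<one> X) \<cdot> lun' X) \<star> \<one> Y) \<cdot> n"
    by simp
  also have "\<dots> = (run X \<star> \<one> Y) \<cdot> (run' X \<star> \<one> Y) \<cdot> n"
    by (simp only: triangle zigzag_mirror assms)
  finally show ?thesis by simp
qed

lemma slide_uni:
  assumes "r \<in> Hom C X Y"
  shows "(\<one> X \<star> r) \<cdot> uni X = (tr r \<star> \<one> Y) \<cdot> uni Y"
proof -
  note [simp] = assms[unfolded Hom_iff]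
  have "unbend ((tr r \<star> \<one> Y) \<cdot> uni Y) X Y =
      lun Y \<cdot> (cou X \<star> \<one> Y) \<cdot> (asc' X X Y \<cdot> (\<one> X \<star> (tr r \<star> \<one> Y))) \<cdot> (\<one> X \<star> uni Y) \<cdot> run' X"
    by (simp add: unbend_def)
  also have "\<dots> = lun Y \<cdot> (cou X \<star> \<one> Y) \<cdot> (((\<one> X \<star> tr r) \<star> \<one> Y) \<cdot> asc' X Y Y) \<cdot> (\<one> X \<star> uni Y) \<cdot> run' X"
    by (subst asc'_natural[of _ X X _ Y X _ Y Y]) (simp_all add: Hom_iff)
  also have "\<dots> = lun Y \<cdot> ((cou X \<cdot> (\<one> X \<star> tr r)) \<star> \<one> Y) \<cdot> asc' X Y Y \<cdot> (\<one> X \<star> uni Y) \<cdot> run' X"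
    by simp
  also have "\<dots> = lun Y \<cdot> ((cou Y \<cdot> (r \<star> \<one> Y)) \<star> \<one> Y) \<cdot> asc' X Y Y \<cdot> (\<one> X \<star> uni Y) \<cdot> run' X"
    by (simp only: slide_cou[OF assms])
  also have "\<dots> = lun Y \<cdot> (cou Y \<star> \<one> Y) \<cdot> (((r \<star> \<one> Y) \<star> \<one> Y) \<cdot> asc' X Y Y) \<cdot> (\<one> X \<star> uni Y) \<cdot> run' X"
    by simp
  also have "\<dots> = lun Y \<cdot> (cou Y \<star> \<one> Y) \<cdot> (asc' Y Y Y \<cdot> (r \<star> (\<one> Y \<star> \<one> Y))) \<cdot> (\<one> X \<star> uni Y) \<cdot> run' X"
    by (subst asc'_natural[of _ X Y _ Y Y _ Y Y]) (simp_all add: Hom_iff)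
  also have "\<dots> = lun Y \<cdot> (cou Y \<star> \<one> Y) \<cdot> asc' Y Y Y \<cdot> (\<one> Y \<star> uni Y) \<cdot> ((r \<star> \<one> I) \<cdot> run' X)"
    by simp
  also have "\<dots> = lun Y \<cdot> (cou Y \<star> \<one> Y) \<cdot> asc' Y Y Y \<cdot> (\<one> Y \<star> uni Y) \<cdot> (run' Y \<cdot> r)"
    by (simp only: run'_natural[OF assms])
  also have "\<dots> = lun Y \<cdot> ((cou Y \<star> \<one> Y) \<cdot> asc' Y Y Y \<cdot> (\<one> Y \<star> uni Y) \<cdot> run' Y) \<cdot> r"
    by simp
  also have "\<dots> = r" by (subst zigzag) simp_all
  finally have "unbend ((tr r \<star> \<one> Y) \<cdot> uni Y) X Y = r" .
  then show ?thesis
    using unbend_uni[of "(tr r \<star> \<one> Y) \<cdot> uni Y" X Y] by (simp add: Hom_iff)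
qed

end

section \<open>The allegory of a bicategory of relations\<close>

context bicategory_of_relations
begin

lemma lp_eq: "\<lbrakk>r \<in> Hom C X Y; s \<in> Hom C X Y\<rbrakk> \<Longrightarrow> r \<triangle> s = dg' Y \<cdot> (r \<star> s) \<cdot> dg X"
  by (simp add: local_product_def Hom_iff)

lemma lp_Hom: "\<lbrakk>r \<in> Hom C X Y; s \<in> Hom C X Y\<rbrakk> \<Longrightarrow> r \<triangle> s \<in> Hom C X Y"
  by (simp add: lp_eq) (simp add: Hom_iff)

lemma le_top:
  assumes "r \<in> Hom C X Y"
  shows "r \<sqsubseteq> au' Y \<cdot> au X"
proof -
  note [simp] = assms[unfolded Hom_iff]
  have "\<one> Y \<cdot> r \<sqsubseteq> (au' Y \<cdot> au Y) \<cdot> r"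
    by (intro Cmp_le_left radj_unit) simp_all
  also have "\<dots> = au' Y \<cdot> (au Y \<cdot> r)" by simp
  also have "\<dots> \<sqsubseteq> au' Y \<cdot> au X"
    by (intro Cmp_le_right lax_Aug_le) (simp_all add: Hom_iff)
  finally show ?thesis by simp
qed

lemma lp_le1:
  assumes "r \<in> Hom C X Y" "s \<in> Hom C X Y"
  shows "r \<triangle> s \<sqsubseteq> r"
proof -
  note [simp] = assms[unfolded Hom_iff]
  have "r \<triangle> s \<sqsubseteq> dg' Y \<cdot> (r \<star> (au' Y \<cdot> au X)) \<cdot> dg X"
    unfolding lp_eq[OF assms] by (intro Cmp_le_right Cmp_le_left ten_le le_top) (simp_all add: Hom_iff)
  also have "\<dots> = (dg' Y \<cdot> (\<one> Y \<star> au' Y)) \<cdot> (r \<star> \<one> I) \<cdot> ((\<one> X \<star> au X) \<cdot> dg X)"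
    by simp
  also have "\<dots> = run Y \<cdot> (r \<star> \<one> I) \<cdot> run' X"
    by (simp only: radj_counit_right counit_right assms[unfolded Hom_iff])
  also have "\<dots> = r" by (subst run'_natural[OF assms(1)]) simp
  finally show ?thesis .
qed

lemma lp_le2:
  assumes "r \<in> Hom C X Y" "s \<in> Hom C X Y"
  shows "r \<triangle> s \<sqsubseteq> s"
proof -
  note [simp] = assms[unfolded Hom_iff]
  have "r \<triangle> s \<sqsubseteq> dg' Y \<cdot> ((au' Y \<cdot> au X) \<star> s) \<cdot> dg X"
    unfolding lp_eq[OF assms] by (intro Cmp_le_right Cmp_le_left ten_le le_top) (simp_all add: Hom_iff)
  also have "\<dots> = (dg' Y \<cdot> (au' Y \<star> \<one> Y)) \<cdot> (\<one> I \<star> s) \<cdot> ((au X \<star> \<one> X) \<cdot> dg X)"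
    by simp
  also have "\<dots> = lun Y \<cdot> (\<one> I \<star> s) \<cdot> lun' X"
    by (simp only: radj_counit_left counit_left assms[unfolded Hom_iff])
  also have "\<dots> = s" by (subst lun'_natural[OF assms(2)]) simp
  finally show ?thesis .
qed

lemma lp_greatest:
  assumes "t \<sqsubseteq> r" "t \<sqsubseteq> s"
  shows "t \<sqsubseteq> r \<triangle> s"
proof -
  define X Y where "X = Src C t" and "Y = Trg C t"
  have [simp]: "t \<in> Arr C" "r \<in> Arr C" "s \<in> Arr C" "Src C t = X" "Trg C t = Y" "Src C r = X" "Trg C r = Y"
    "Src C s = X" "Trg C s = Y" "X \<in> Ob C" "Y \<in> Ob C"
    using assms by (auto simp: le_def X_def Y_def)
  have "\<one> Y \<cdot> t \<sqsubseteq> (dg' Y \<cdot> dg Y) \<cdot> t"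
    by (intro Cmp_le_left radj_unit) simp_all
  also have "\<dots> = dg' Y \<cdot> (dg Y \<cdot> t)" by simp
  also have "\<dots> \<sqsubseteq> dg' Y \<cdot> ((t \<star> t) \<cdot> dg X)"
    by (intro Cmp_le_right lax_Diag_le) (simp_all add: Hom_iff)
  also have "\<dots> \<sqsubseteq> dg' Y \<cdot> ((r \<star> s) \<cdot> dg X)"
    using assms by (intro Cmp_le_right Cmp_le_left ten_le) simp_all
  also have "\<dots> = r \<triangle> s"
    by (subst lp_eq[of _ X Y]) (simp_all add: Hom_iff)
  finally show ?thesis by simp
qed

text \<open>
  The inequality behind the modular law. Expand \<open>dg X\<close> as a multiplication applied to a bent wire;
  the mate \<open>r \<cdot> dg' X \<sqsubseteq> dg' Y \<cdot> (r \<star> r)\<close> of the lax naturality of \<open>dg\<close> then pushes \<open>r\<close> through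
  the multiplication, and the second copy of \<open>r\<close> slides around the bend to become \<open>tr r\<close>.
\<close>

lemma diag_modular:
  assumes "r \<in> Hom C X Y"
  shows "(r \<star> \<one> X) \<cdot> dg X \<sqsubseteq> (\<one> Y \<star> tr r) \<cdot> dg Y \<cdot> r"
proof -
  note [simp] = assms[unfolded Hom_iff]
  have "\<one> Y \<cdot> (r \<cdot> dg' X) \<sqsubseteq> (dg' Y \<cdot> dg Y) \<cdot> (r \<cdot> dg' X)"
    by (intro Cmp_le_left radj_unit) simp_all
  also have "\<dots> = dg' Y \<cdot> (dg Y \<cdot> r) \<cdot> dg' X" by simp
  also have "\<dots> \<sqsubseteq> dg' Y \<cdot> ((r \<star> r) \<cdot> dg X) \<cdot> dg' X"
    by (intro Cmp_le_right Cmp_le_left lax_Diag_le) (simp_all add: Hom_iff)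
  also have "\<dots> = (dg' Y \<cdot> (r \<star> r)) \<cdot> (dg X \<cdot> dg' X)" by simp
  also have "\<dots> \<sqsubseteq> (dg' Y \<cdot> (r \<star> r)) \<cdot> \<one> (X \<bullet> X)"
    by (intro Cmp_le_right radj_counit) simp_all
  finally have mate: "r \<cdot> dg' X \<sqsubseteq> dg' Y \<cdot> (r \<star> r)" by simp
  have slide: "(r \<star> \<one> X) \<cdot> uni X = (\<one> Y \<star> tr r) \<cdot> uni Y"
    using slide_uni[of "tr r" Y X] tr_tr[OF assms] by (simp add: Hom_iff)
  have "(r \<star> \<one> X) \<cdot> dg X = (r \<star> \<one> X) \<cdot> (dg' X \<star> \<one> X) \<cdot> asc' X X X \<cdot> (\<one> X \<star> uni X) \<cdot> run' X"
    by (subst uni_dg[symmetric]) simp_all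
  also have "\<dots> = ((r \<cdot> dg' X) \<star> \<one> X) \<cdot> asc' X X X \<cdot> (\<one> X \<star> uni X) \<cdot> run' X" by simp
  also have "\<dots> \<sqsubseteq> ((dg' Y \<cdot> (r \<star> r)) \<star> \<one> X) \<cdot> asc' X X X \<cdot> (\<one> X \<star> uni X) \<cdot> run' X"
    using mate by (intro Cmp_le_left ten_le) simp_all
  also have "\<dots> = (dg' Y \<star> \<one> X) \<cdot> (((r \<star> r) \<star> \<one> X) \<cdot> asc' X X X) \<cdot> (\<one> X \<star> uni X) \<cdot> run' X" by simp
  also have "\<dots> = (dg' Y \<star> \<one> X) \<cdot> (asc' Y Y X \<cdot> (r \<star> (r \<star> \<one> X))) \<cdot> (\<one> X \<star> uni X) \<cdot> run' X"
    by (subst asc'_natural[of _ X Y _ X Y _ X X]) (simp_all add: Hom_iff)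
  also have "\<dots> = (dg' Y \<star> \<one> X) \<cdot> asc' Y Y X \<cdot> (r \<star> ((r \<star> \<one> X) \<cdot> uni X)) \<cdot> run' X" by simp
  also have "\<dots> = (dg' Y \<star> \<one> X) \<cdot> asc' Y Y X \<cdot> (r \<star> ((\<one> Y \<star> tr r) \<cdot> uni Y)) \<cdot> run' X"
    by (simp only: slide)
  also have "\<dots> = (dg' Y \<star> \<one> X) \<cdot> (asc' Y Y X \<cdot> (\<one> Y \<star> (\<one> Y \<star> tr r))) \<cdot> (\<one> Y \<star> uni Y) \<cdot> ((r \<star> \<one> I) \<cdot> run' X)"
    by simp
  also have "\<dots> = (dg' Y \<star> \<one> X) \<cdot> (((\<one> Y \<star> \<one> Y) \<star> tr r) \<cdot> asc' Y Y Y) \<cdot> (\<one> Y \<star> uni Y) \<cdot> (run' Y \<cdot> r)"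
    by (subst asc'_natural[of _ Y Y _ Y Y _ Y X])
      (simp_all add: Hom_iff run'_natural[OF assms] del: interchange_chain)
  also have "\<dots> = (\<one> Y \<star> tr r) \<cdot> ((dg' Y \<star> \<one> Y) \<cdot> asc' Y Y Y \<cdot> (\<one> Y \<star> uni Y) \<cdot> run' Y) \<cdot> r" by simp
  also have "\<dots> = (\<one> Y \<star> tr r) \<cdot> dg Y \<cdot> r"
    by (subst uni_dg) simp_all
  finally show ?thesis .
qed

lemma lp_modular:
  assumes "r \<in> Hom C X Y" "s \<in> Hom C Y Z" "t \<in> Hom C X Z"
  shows "(s \<cdot> r) \<triangle> t \<sqsubseteq> (s \<triangle> (t \<cdot> tr r)) \<cdot> r"
proof -
  note [simp] = assms[unfolded Hom_iff]
  have "(s \<cdot> r) \<triangle> t = (dg' Z \<cdot> (s \<star> t)) \<cdot> ((r \<star> \<one> X) \<cdot> dg X)"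
    by (subst lp_eq[of _ X Z]) (simp_all add: Hom_iff)
  also have "\<dots> \<sqsubseteq> (dg' Z \<cdot> (s \<star> t)) \<cdot> ((\<one> Y \<star> tr r) \<cdot> dg Y \<cdot> r)"
    by (intro Cmp_le_right diag_modular) (simp_all add: Hom_iff)
  also have "\<dots> = (s \<triangle> (t \<cdot> tr r)) \<cdot> r"
    by (subst lp_eq[of _ Y Z]) (simp_all add: Hom_iff)
  finally show ?thesis .
qed

theorem allegory_of_relations: "allegory C (local_product C M) tr"
proof
  show "r \<triangle> s \<preceq> r" "r \<triangle> s \<preceq> s" if "r \<in> Hom C X Y" "s \<in> Hom C X Y" for r s X Y
    using that lp_le1 lp_le2 leD by blast+
  show "t \<preceq> r \<triangle> s"
    if "r \<in> Hom C X Y" "s \<in> Hom C X Y" "t \<in> Hom C X Y" "t \<preceq> r" "t \<preceq> s" for r s t X Y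
    using that lp_greatest[of t r s] leI leD by blast
  show "tr r \<in> Hom C Y X" if "r \<in> Hom C X Y" for r X Y
    using that by (simp add: Hom_iff)
  show "tr r \<preceq> tr s" if "r \<in> Hom C X Y" "s \<in> Hom C X Y" "r \<preceq> s" for r s X Y
    using that tr_le leI leD by blast
  show "(s \<cdot> r) \<triangle> t \<preceq> (s \<triangle> (t \<cdot> tr r)) \<cdot> r"
    if "r \<in> Hom C X Y" "s \<in> Hom C Y Z" "t \<in> Hom C X Z" for r s t X Y Z
    using that lp_modular leD by blast
qed (simp_all add: lp_Hom tr_Idn tr_Cmp tr_tr)

interpretation allegory C "local_product C M" tr
  by (rule allegory_of_relations)

section \<open>Tabulations from the tensor product\<close>

abbreviation prl where "prl X Y \<equiv> run X \<cdot> (\<one> X \<star> au Y)"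
abbreviation prr where "prr X Y \<equiv> lun Y \<cdot> (au X \<star> \<one> Y)"

lemma prr_prl_top:
  assumes [simp]: "X \<in> Ob C" "Y \<in> Ob C"
  shows "prr X Y \<cdot> radj C (prl X Y) = au' Y \<cdot> au X"
proof -
  have r: "radj C (prl X Y) = (\<one> X \<star> au' Y) \<cdot> run' X"
    by (simp add: radj_Cmp radj_ten radj_iso radj_eqI[OF adjoint_Idn])
  have "prr X Y \<cdot> radj C (prl X Y) = (lun Y \<cdot> (\<one> I \<star> au' Y)) \<cdot> ((au X \<star> \<one> I) \<cdot> run' X)"
    unfolding r by simp
  also have "\<dots> = (au' Y \<cdot> lun I) \<cdot> (run' I \<cdot> au X)"
    by (simp only: LUnit_natural[of "au' Y" I Y] run'_natural[of "au X" X I] Hom_iff assms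
        comonoid_simps radj_simps UnitO_Ob simp_thms)
  also have "\<dots> = au' Y \<cdot> au X" by (simp add: run_I)
  finally show ?thesis .
qed

lemma prl_pair:
  assumes "f \<in> Hom C W X" "g \<in> Hom C W Y" "is_map C g"
  shows "prl X Y \<cdot> (f \<star> g) \<cdot> dg W = f"
proof -
  note [simp] = assms(1,2)[unfolded Hom_iff]
  have "prl X Y \<cdot> (f \<star> g) \<cdot> dg W = run X \<cdot> (f \<star> (au Y \<cdot> g)) \<cdot> dg W" by simp
  also have "\<dots> = run X \<cdot> (f \<star> \<one> I) \<cdot> ((\<one> W \<star> au W) \<cdot> dg W)"
    by (simp add: au_map[OF assms(3,2)])
  also have "\<dots> = run X \<cdot> ((f \<star> \<one> I) \<cdot> run' W)" by (subst counit_right) simp_all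
  also have "\<dots> = f" by (subst run'_natural[OF assms(1)]) simp_all
  finally show ?thesis .
qed

lemma prr_pair:
  assumes "f \<in> Hom C W X" "g \<in> Hom C W Y" "is_map C f"
  shows "prr X Y \<cdot> (f \<star> g) \<cdot> dg W = g"
proof -
  note [simp] = assms(1,2)[unfolded Hom_iff]
  have "prr X Y \<cdot> (f \<star> g) \<cdot> dg W = lun Y \<cdot> ((au X \<cdot> f) \<star> g) \<cdot> dg W" by simp
  also have "\<dots> = lun Y \<cdot> (\<one> I \<star> g) \<cdot> ((au W \<star> \<one> W) \<cdot> dg W)"
    by (simp add: au_map[OF assms(3,1)])
  also have "\<dots> = lun Y \<cdot> ((\<one> I \<star> g) \<cdot> lun' W)" by (subst counit_left) simp_all
  also have "\<dots> = g" by (subst lun'_natural[OF assms(2)]) simp_all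
  finally show ?thesis .
qed

text \<open>
  Write \<open>p\<close> and \<open>q\<close> for the projections. The relation \<open>s p \<inter> q\<close> is part of the functional \<open>q\<close>, so it
  is determined by its domain, and composing it with the converse of \<open>p\<close> gives back \<open>s\<close> because
  \<open>q p\<degree>\<close> is the top arrow.
\<close>

lemma names_determine:
  assumes s: "s \<in> Hom C X Y" and s': "s' \<in> Hom C X Y"
    and eq: "au Y \<cdot> ((s \<cdot> prl X Y) \<triangle> prr X Y) = au Y \<cdot> ((s' \<cdot> prl X Y) \<triangle> prr X Y)"
  shows "s = s'"
proof -
  note [simp] = s[unfolded Hom_iff] s'[unfolded Hom_iff]
  define p q where "p = prl X Y" and "q = prr X Y"
  have [simp]: "is_map C p" "is_map C q" "p \<in> Arr C" "q \<in> Arr C" "Src C p = X \<bullet> Y" "Src C q = X \<bullet> Y"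
    "Trg C p = X" "Trg C q = Y"
    by (simp_all add: p_def q_def)
  have le: "(a \<cdot> p) \<triangle> q \<sqsubseteq> (b \<cdot> p) \<triangle> q"
    if [simp]: "a \<in> Hom C X Y" "b \<in> Hom C X Y"
      and ab: "au Y \<cdot> ((a \<cdot> p) \<triangle> q) = au Y \<cdot> ((b \<cdot> p) \<triangle> q)" for a b
  proof (rule functional_le_of_dom)
    show "(a \<cdot> p) \<triangle> q \<sqsubseteq> q" "(b \<cdot> p) \<triangle> q \<sqsubseteq> q"
      using that by (auto simp: Hom_iff intro: meet_lower)
    show "\<one> (Trg C q) \<sqsubseteq> tr (au Y) \<cdot> au Y"
      by (rule map_total) simp_all
    show "q \<cdot> tr q \<sqsubseteq> \<one> (Trg C q)"
      by (rule map_functional) simp_all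
  qed (use ab in simp_all)
  have recover: "((a \<cdot> p) \<triangle> q) \<cdot> tr p = a" if a: "a \<in> Hom C X Y" for a
  proof (rule le_antisym)
    note [simp] = a[unfolded Hom_iff]
    have "((a \<cdot> p) \<triangle> q) \<cdot> tr p \<sqsubseteq> (a \<cdot> p) \<cdot> tr p"
      by (intro Cmp_le_left meet_lower) simp_all
    also have "\<dots> = a \<cdot> (p \<cdot> tr p)" by simp
    also have "\<dots> \<sqsubseteq> a"
      by (rule functional_below') (simp_all add: map_functional)
    finally show "((a \<cdot> p) \<triangle> q) \<cdot> tr p \<sqsubseteq> a" .
    have "a \<sqsubseteq> (q \<cdot> tr p) \<triangle> a"
      using le_top[OF a] prr_prl_top[of X Y] radj_invol[of p]
      by (intro meetI) (simp_all add: p_def q_def)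
    also have "\<dots> \<sqsubseteq> (q \<triangle> (a \<cdot> tr (tr p))) \<cdot> tr p"
      by (intro modular_right) simp_all
    also have "\<dots> = ((a \<cdot> p) \<triangle> q) \<cdot> tr p"
      by (simp add: meet_comm)
    finally show "a \<sqsubseteq> ((a \<cdot> p) \<triangle> q) \<cdot> tr p" .
  qed
  have eq': "au Y \<cdot> ((s \<cdot> p) \<triangle> q) = au Y \<cdot> ((s' \<cdot> p) \<triangle> q)"
    using eq by (simp only: p_def q_def)
  have "(s \<cdot> p) \<triangle> q = (s' \<cdot> p) \<triangle> q"
    by (rule le_antisym[OF le[OF s s' eq'] le[OF s' s eq'[symmetric]]])
  with recover[OF s] recover[OF s'] show ?thesis by metis
qed

text \<open>
  The pairing \<open>h\<close> of the two projections is an idempotent map. Precomposition with \<open>h\<close> sends the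
  name \<open>cou Y \<cdot> (s \<star> \<one> Y)\<close> of \<open>s\<close> to \<open>au Y \<cdot> ((s \<cdot> prl X Y) \<triangle> prr X Y)\<close>, from which \<open>s\<close> can be
  recovered. By self-duality every arrow \<open>X \<bullet> Y \<rightarrow> I\<close> is a name, so precomposition with the idempotent
  \<open>h\<close> is injective on them, hence trivial. Applied to the domain of \<open>h \<triangle> \<one>\<close> this gives \<open>h = \<one>\<close>.
\<close>

lemma pairing_of_projections:
  assumes XY [simp]: "X \<in> Ob C" "Y \<in> Ob C"
  shows "(prl X Y \<star> prr X Y) \<cdot> dg (X \<bullet> Y) = \<one> (X \<bullet> Y)"
proof -
  define W p q h where "W = X \<bullet> Y" and "p = prl X Y" and "q = prr X Y" and "h = (p \<star> q) \<cdot> dg W"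
  have W [simp]: "W \<in> Ob C" by (simp add: W_def)
  have pq [simp]: "is_map C p" "is_map C q" "p \<in> Arr C" "q \<in> Arr C" "Src C p = W" "Src C q = W"
    "Trg C p = X" "Trg C q = Y"
    by (simp_all add: p_def q_def W_def)
  have h [simp]: "h \<in> Arr C" "Src C h = W" "Trg C h = W" "is_map C h"
    by (simp_all add: h_def) (simp_all add: W_def)
  have ph: "p \<cdot> h = p" and qh: "q \<cdot> h = q"
    using prl_pair[of p W X q Y] prr_pair[of p W X q Y]
    by (simp_all add: Hom_iff h_def) (simp_all add: p_def q_def W_def)
  have "h \<cdot> h = (p \<star> q) \<cdot> (dg W \<cdot> h)" by (subst (1) h_def) simp
  also have "\<dots> = (p \<star> q) \<cdot> ((h \<star> h) \<cdot> dg W)"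
    by (subst dg_map[of h W W]) (simp_all add: Hom_iff)
  also have "\<dots> = ((p \<cdot> h) \<star> (q \<cdot> h)) \<cdot> dg W" by simp
  also have "\<dots> = h" by (simp only: ph qh) (simp only: h_def)
  finally have hh: "h \<cdot> h = h" .
  have name: "\<exists>s \<in> Hom C X Y. \<phi> = cou Y \<cdot> (s \<star> \<one> Y) \<and> \<phi> \<cdot> h = au Y \<cdot> ((s \<cdot> p) \<triangle> q)"
    if \<phi>: "\<phi> \<in> Hom C W I" for \<phi>
  proof
    define t where "t = bend \<phi> X Y"
    note [simp] = \<phi>[unfolded Hom_iff]
    have t [simp]: "t \<in> Arr C" "Src C t = Y" "Trg C t = X"
      by (simp_all add: t_def W_def[symmetric])
    show s: "tr t \<in> Hom C X Y" by (simp add: Hom_iff)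
    have 1: "\<phi> = cou Y \<cdot> (tr t \<star> \<one> Y)"
      using slide_cou[OF s] cou_bend[of \<phi> X Y] by (simp add: t_def[symmetric] W_def[symmetric])
    have "\<phi> \<cdot> h = au Y \<cdot> dg' Y \<cdot> ((tr t \<cdot> p) \<star> q) \<cdot> dg W"
      unfolding 1 h_def by (simp add: dual_counit_def)
    also have "\<dots> = au Y \<cdot> ((tr t \<cdot> p) \<triangle> q)"
      by (simp add: lp_eq[of _ W Y] Hom_iff)
    finally show "\<phi> = cou Y \<cdot> (tr t \<star> \<one> Y) \<and> \<phi> \<cdot> h = au Y \<cdot> ((tr t \<cdot> p) \<triangle> q)"
      using 1 by blast
  qed
  have absorb: "\<phi> \<cdot> h = \<phi>" if \<phi>: "\<phi> \<in> Hom C W I" for \<phi>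
  proof -
    note [simp] = \<phi>[unfolded Hom_iff]
    have \<phi>h: "\<phi> \<cdot> h \<in> Hom C W I" by (simp add: Hom_iff)
    obtain s s' where s: "s \<in> Hom C X Y" "\<phi> = cou Y \<cdot> (s \<star> \<one> Y)" "\<phi> \<cdot> h = au Y \<cdot> ((s \<cdot> p) \<triangle> q)"
      and s': "s' \<in> Hom C X Y" "\<phi> \<cdot> h = cou Y \<cdot> (s' \<star> \<one> Y)" "(\<phi> \<cdot> h) \<cdot> h = au Y \<cdot> ((s' \<cdot> p) \<triangle> q)"
      using name[OF \<phi>] name[OF \<phi>h] by blast
    have "(\<phi> \<cdot> h) \<cdot> h = \<phi> \<cdot> h" by (simp add: hh)
    then have "s = s'"
      using s(3) s'(3) by (intro names_determine[OF s(1) s'(1)]) (simp add: p_def q_def)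
    then show ?thesis using s(2) s'(2) by simp
  qed
  have "au W \<cdot> (h \<triangle> \<one> W) = (au W \<cdot> (h \<triangle> \<one> W)) \<cdot> h"
    by (rule absorb[symmetric]) (simp add: Hom_iff)
  also have "\<dots> = au W \<cdot> ((h \<triangle> \<one> W) \<cdot> h)" by simp
  also have "(h \<triangle> \<one> W) \<cdot> h = h"
    using meet_absorb[of h h] by (simp add: meet_map hh)
  also have "au W \<cdot> h = au W"
    by (rule absorb) (simp add: Hom_iff)
  finally have dom: "au W \<cdot> (h \<triangle> \<one> W) = au W \<cdot> \<one> W" by simp
  have "\<one> W \<sqsubseteq> h \<triangle> \<one> W"
  proof (rule functional_le_of_dom)
    show "\<one> W \<sqsubseteq> \<one> W" "h \<triangle> \<one> W \<sqsubseteq> \<one> W" by (simp_all add: meet_lower)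
    show "\<one> (Trg C (\<one> W)) \<sqsubseteq> tr (au W) \<cdot> au W" by (rule map_total) simp_all
    show "\<one> W \<cdot> tr (\<one> W) \<sqsubseteq> \<one> (Trg C (\<one> W))" by simp
  qed (use dom in simp_all)
  then have "\<one> W \<sqsubseteq> h" by (simp add: le_meet)
  then have "\<one> W = h" by (intro map_le_eq) simp_all
  then show ?thesis by (simp add: h_def W_def p_def q_def)
qed

lemma tabulation_top:
  assumes [simp]: "X \<in> Ob C" "Y \<in> Ob C"
  shows "tabulation (au' Y \<cdot> au X) (prl X Y) (prr X Y)"
proof -
  define W p q where "W = X \<bullet> Y" and "p = prl X Y" and "q = prr X Y"
  have W [simp]: "W \<in> Ob C" by (simp add: W_def)
  have pq [simp]: "is_map C p" "is_map C q" "p \<in> Arr C" "q \<in> Arr C" "Src C p = W" "Src C q = W"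
    "Trg C p = X" "Trg C q = Y"
    by (simp_all add: p_def q_def W_def)
  have 1: "(p \<star> q) \<cdot> dg W = \<one> W"
    using pairing_of_projections[of X Y] by (simp add: p_def q_def W_def)
  have 2: "dg' W \<cdot> (radj C p \<star> radj C q) = \<one> W"
    using arg_cong[OF 1, of "radj C"] radj_Cmp[of "dg W" "p \<star> q"]
    by (simp add: radj_ten radj_eqI[OF adjoint_Idn])
  have "(radj C p \<cdot> p) \<triangle> (radj C q \<cdot> q) = (dg' W \<cdot> (radj C p \<star> radj C q)) \<cdot> ((p \<star> q) \<cdot> dg W)"
    by (subst lp_eq[of _ W W]) (simp_all add: Hom_iff)
  also have "\<dots> = \<one> W" unfolding 1 2 by simp
  finally have 3: "(tr p \<cdot> p) \<triangle> (tr q \<cdot> q) = \<one> W" by (simp add: radj_invol)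
  have "au' Y \<cdot> au X = q \<cdot> tr p"
    using prr_prl_top[of X Y] by (simp add: p_def[symmetric] q_def[symmetric] radj_invol)
  then show ?thesis
    unfolding tabulation_def p_def[symmetric] q_def[symmetric] using 3
    by (auto simp: Hom_iff intro!: exI[of _ W])
qed

theorem unitary_pre_tabular_of_relations:
  "unitary_pre_tabular_allegory C (local_product C M) (transpose_arr C M)"
proof
  show "\<exists>r' \<in> Hom C X Y. r \<preceq> r' \<and> (\<exists>f g. tabulation r' f g)" if r: "r \<in> Hom C X Y" for r X Y
  proof (rule bexI)
    show "r \<preceq> au' Y \<cdot> au X \<and> (\<exists>f g. tabulation (au' Y \<cdot> au X) f g)"
      using r leD[OF le_top[OF r]] tabulation_top[of X Y] by (auto simp: Hom_iff)
    show "au' Y \<cdot> au X \<in> Hom C X Y" using r by (simp add: Hom_iff)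
  qed
  have "is_unit I"
    unfolding is_unit_def
  proof (intro conjI ballI)
    fix r assume "r \<in> Hom C I I"
    then show "r \<preceq> \<one> I" using le_au[of r I] leD by simp
  next
    fix X assume [simp]: "X \<in> Ob C"
    show "\<exists>p \<in> Hom C X I. \<one> X \<preceq> tr p \<cdot> p"
      using leD[OF map_total[of "au X" X]] by (intro bexI[of _ "au X"]) (simp_all add: Hom_iff)
  qed simp
  then show "\<exists>U. is_unit U" by blast
qed

end

section \<open>Products in a unitary pre-tabular allegory\<close>

context unitary_pre_tabular_allegory
begin

definition unt :: 'a where "unt = (SOME U. is_unit U)"

definition bang :: "'a \<Rightarrow> 'b" where "bang X = (SOME p. p \<in> Hom C X unt \<and> \<one> X \<preceq> p\<degree> \<cdot> p)"

lemma unt_is_unit: "is_unit unt"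
  unfolding unt_def using unitary by (rule someI_ex)

lemma unt_Ob [simp]: "unt \<in> Ob C"
  using unt_is_unit by (simp add: is_unit_def)

lemma bang_spec:
  assumes "X \<in> Ob C"
  shows "bang X \<in> Hom C X unt \<and> \<one> X \<preceq> (bang X)\<degree> \<cdot> bang X"
  unfolding bang_def by (rule someI_ex) (use unt_is_unit assms in \<open>auto simp: is_unit_def\<close>)

lemma bang_simps [simp]:
  assumes "X \<in> Ob C"
  shows "bang X \<in> Arr C" "Src C (bang X) = X" "Trg C (bang X) = unt"
  using bang_spec[OF assms] by (auto simp: Hom_iff)

lemma le_one_unt: "r \<in> Hom C unt unt \<Longrightarrow> r \<sqsubseteq> \<one> unt"
  using unt_is_unit by (auto simp: is_unit_def le_def Hom_iff)

lemma map_bang [simp]: "X \<in> Ob C \<Longrightarrow> is_map C (bang X)"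
  using bang_spec[of X] le_one_unt[of "bang X \<cdot> (bang X)\<degree>"] by (auto simp: map_iff le_def Hom_iff)

lemma le_bang:
  assumes "r \<in> Arr C" "Trg C r = unt"
  shows "r \<sqsubseteq> bang (Src C r)"
proof -
  have "r \<cdot> \<one> (Src C r) \<sqsubseteq> r \<cdot> ((bang (Src C r))\<degree> \<cdot> bang (Src C r))"
    using assms by (intro Cmp_le_right map_total) simp_all
  also have "\<dots> = (r \<cdot> (bang (Src C r))\<degree>) \<cdot> bang (Src C r)"
    using assms by simp
  also have "\<dots> \<sqsubseteq> \<one> unt \<cdot> bang (Src C r)"
    using assms by (intro Cmp_le_left le_one_unt) (simp_all add: Hom_iff)
  finally show ?thesis using assms by simp
qed

lemma map_into_unt: "\<lbrakk>is_map C f; Trg C f = unt\<rbrakk> \<Longrightarrow> f = bang (Src C f)"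
  by (intro map_le_eq le_bang) (simp_all add: map_Arr)

lemma bang_map [simp]:
  assumes "is_map C f" "Trg C f = Y"
  shows "bang Y \<cdot> f = bang (Src C f)"
proof -
  have "f \<in> Arr C" using assms(1) by (rule map_Arr)
  then show ?thesis using assms map_into_unt[of "bang Y \<cdot> f"] by auto
qed

definition tp :: "'a \<Rightarrow> 'a \<Rightarrow> 'b" where "tp X Y = (bang Y)\<degree> \<cdot> bang X"

lemma tp_simps [simp]:
  assumes "X \<in> Ob C" "Y \<in> Ob C"
  shows "tp X Y \<in> Arr C" "Src C (tp X Y) = X" "Trg C (tp X Y) = Y" "(tp X Y)\<degree> = tp Y X"
  using assms by (simp_all add: tp_def)

lemma le_tp:
  assumes "r \<in> Arr C" "Src C r = X" "Trg C r = Y"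
  shows "r \<sqsubseteq> tp X Y"
proof -
  have [simp]: "X \<in> Ob C" "Y \<in> Ob C" using assms by auto
  note [simp] = assms
  have "\<one> Y \<cdot> r \<sqsubseteq> ((bang Y)\<degree> \<cdot> bang Y) \<cdot> r"
    by (intro Cmp_le_left map_total) simp_all
  also have "\<dots> = (bang Y)\<degree> \<cdot> (bang Y \<cdot> r)" by simp
  also have "\<dots> \<sqsubseteq> (bang Y)\<degree> \<cdot> bang X"
    using le_bang[of "bang Y \<cdot> r"] by (intro Cmp_le_right) simp_all
  finally show ?thesis by (simp add: tp_def)
qed

lemma tp_map:
  assumes "is_map C f" "Trg C f = X" "Y \<in> Ob C"
  shows "tp X Y \<cdot> f = tp (Src C f) Y"
proof -
  have [simp]: "f \<in> Arr C" using assms(1) by (rule map_Arr)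
  have [simp]: "X \<in> Ob C" using assms(2) by auto
  show ?thesis using assms by (simp add: tp_def)
qed

lemma invol_map_tp:
  assumes "is_map C f" "Trg C f = Y" "X \<in> Ob C"
  shows "f\<degree> \<cdot> tp X Y = tp X (Src C f)"
proof -
  have [simp]: "f \<in> Arr C" using assms(1) by (rule map_Arr)
  have [simp]: "Y \<in> Ob C" using assms(2) by auto
  show ?thesis using arg_cong[OF tp_map[OF assms], of invol] assms by simp
qed

definition is_product :: "'a \<times> 'b \<times> 'b \<Rightarrow> 'a \<Rightarrow> 'a \<Rightarrow> bool"
  where "is_product = (\<lambda>(P, p, q) X Y. p \<in> Hom C P X \<and> q \<in> Hom C P Y \<and> is_map C p \<and> is_map C q \<and>
    q \<cdot> p\<degree> = tp X Y \<and> (p\<degree> \<cdot> p) \<sqinter> (q\<degree> \<cdot> q) = \<one> P)"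

text \<open>One choice for all three components, so that object and projections belong together.\<close>

definition po :: "'a \<Rightarrow> 'a \<Rightarrow> 'a" where "po X Y = fst (SOME t. is_product t X Y)"
definition pl :: "'a \<Rightarrow> 'a \<Rightarrow> 'b" where "pl X Y = fst (snd (SOME t. is_product t X Y))"
definition pr :: "'a \<Rightarrow> 'a \<Rightarrow> 'b" where "pr X Y = snd (snd (SOME t. is_product t X Y))"

lemma product_exists:
  assumes [simp]: "X \<in> Ob C" "Y \<in> Ob C"
  shows "\<exists>t. is_product t X Y"
proof -
  obtain r' f g where r': "r' \<in> Hom C X Y" "tp X Y \<preceq> r'" "tabulation r' f g"
    using pre_tabular[of "tp X Y" X Y] by (auto simp: Hom_iff)
  have "r' \<sqsubseteq> tp X Y" using r'(1) by (intro le_tp) (auto simp: Hom_iff)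
  moreover have "tp X Y \<sqsubseteq> r'" using r'(1,2) by (auto simp: le_def Hom_iff)
  ultimately have "r' = tp X Y" by (rule le_antisym)
  then obtain Z where "is_product (Z, f, g) X Y"
    using r'(3) by (auto simp: tabulation_def is_product_def)
  then show ?thesis by blast
qed

lemma product_chosen:
  assumes "X \<in> Ob C" "Y \<in> Ob C"
  shows "is_product (po X Y, pl X Y, pr X Y) X Y"
  unfolding po_def pl_def pr_def using someI_ex[OF product_exists[OF assms]] by simp

lemma product_simps [simp]:
  assumes "X \<in> Ob C" "Y \<in> Ob C"
  shows "po X Y \<in> Ob C" "pl X Y \<in> Arr C" "Src C (pl X Y) = po X Y" "Trg C (pl X Y) = X" "is_map C (pl X Y)"
    "pr X Y \<in> Arr C" "Src C (pr X Y) = po X Y" "Trg C (pr X Y) = Y" "is_map C (pr X Y)"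
  using product_chosen[OF assms] by (auto simp: is_product_def Hom_iff)

lemma pr_pl: "\<lbrakk>X \<in> Ob C; Y \<in> Ob C\<rbrakk> \<Longrightarrow> pr X Y \<cdot> (pl X Y)\<degree> = tp X Y"
  and jointly_monic: "\<lbrakk>X \<in> Ob C; Y \<in> Ob C\<rbrakk> \<Longrightarrow>
    ((pl X Y)\<degree> \<cdot> pl X Y) \<sqinter> ((pr X Y)\<degree> \<cdot> pr X Y) = \<one> (po X Y)"
  using product_chosen[of X Y] by (auto simp: is_product_def)

definition pair :: "'b \<Rightarrow> 'b \<Rightarrow> 'b"
  where "pair c d = ((pl (Trg C c) (Trg C d))\<degree> \<cdot> c) \<sqinter> ((pr (Trg C c) (Trg C d))\<degree> \<cdot> d)"

lemma pair_simps [simp]: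
  assumes "c \<in> Arr C" "d \<in> Arr C" "Src C d = Src C c"
  shows "pair c d \<in> Arr C" "Src C (pair c d) = Src C c" "Trg C (pair c d) = po (Trg C c) (Trg C d)"
  using assms by (simp_all add: pair_def)

text \<open>
  Inserting the top arrow \<open>pr X Y \<cdot> (pl X Y)\<degree>\<close> and applying both modular laws replaces an arrow \<open>X \<rightarrow> Y\<close> by
  a coreflexive on the product.
\<close>

lemma le_coreflexive_on_product:
  assumes "r \<in> Arr C" "Src C r = X" "Trg C r = Y"
  shows "r \<sqsubseteq> pr X Y \<cdot> (\<one> (po X Y) \<sqinter> ((pr X Y)\<degree> \<cdot> r \<cdot> pl X Y)) \<cdot> (pl X Y)\<degree>"
proof -
  have [simp]: "X \<in> Ob C" "Y \<in> Ob C" using assms by auto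
  note [simp] = assms
  have "r \<sqsubseteq> (pr X Y \<cdot> (pl X Y)\<degree>) \<sqinter> r"
    using le_tp[of r X Y] by (intro meetI) (simp_all add: pr_pl)
  also have "\<dots> \<sqsubseteq> pr X Y \<cdot> ((pl X Y)\<degree> \<sqinter> ((pr X Y)\<degree> \<cdot> r))"
    by (intro modular_left) simp_all
  also have "\<dots> = pr X Y \<cdot> ((\<one> (po X Y) \<cdot> (pl X Y)\<degree>) \<sqinter> ((pr X Y)\<degree> \<cdot> r))" by simp
  also have "\<dots> \<sqsubseteq> pr X Y \<cdot> ((\<one> (po X Y) \<sqinter> (((pr X Y)\<degree> \<cdot> r) \<cdot> (pl X Y)\<degree>\<degree>)) \<cdot> (pl X Y)\<degree>)"
    by (intro Cmp_le_right modular_right) simp_all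
  finally show ?thesis by simp
qed

lemma coreflexive_le_dom_meet:
  assumes [simp]: "a \<in> Arr C" "c \<in> Arr C" "Src C c = Src C a" "Trg C c = Trg C a"
  shows "\<one> (Src C a) \<sqinter> (a\<degree> \<cdot> c) \<sqsubseteq> (a \<sqinter> c)\<degree> \<cdot> (a \<sqinter> c)"
proof -
  have "(a\<degree> \<cdot> c) \<sqinter> \<one> (Src C a) \<sqsubseteq> a\<degree> \<cdot> (c \<sqinter> (a\<degree>\<degree> \<cdot> \<one> (Src C a)))"
    by (intro modular_left) simp_all
  then have "\<one> (Src C a) \<sqinter> (a\<degree> \<cdot> c) \<sqsubseteq> a\<degree> \<cdot> (a \<sqinter> c)"
    by (simp add: meet_comm)
  then have "\<one> (Src C a) \<sqinter> (a\<degree> \<cdot> c) \<sqsubseteq> \<one> (Src C a) \<sqinter> (a\<degree> \<cdot> (a \<sqinter> c))"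
    by (intro meetI meet_lower) simp_all
  also have "\<dots> = \<one> (Src C a) \<sqinter> (a\<degree> \<cdot> (a \<sqinter> c))\<degree>"
    by (rule meet_one_invol[symmetric]) simp_all
  also have "\<dots> = \<one> (Src C (a \<sqinter> c)) \<sqinter> ((a \<sqinter> c)\<degree> \<cdot> a)" by simp
  also have "\<dots> \<sqsubseteq> (a \<sqinter> c)\<degree> \<cdot> (a \<sqinter> c)"
    by (rule coreflexive_le_dom) simp_all
  finally show ?thesis .
qed

text \<open>
  For the inequality from right to left, the point of \<open>po X Y\<close> through which the composite factors
  depends on a point of \<open>W\<close> and a point of \<open>V\<close> together, so the modular law for the product of \<open>X\<close> and
  \<open>Y\<close> alone does not produce it. Both sides are therefore moved to coreflexives on \<open>po W V\<close>, where the
  choice of that point becomes a single arrow \<open>z\<close>.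
\<close>

lemma pair_sharp:
  assumes a: "a \<in> Hom C V X" and b: "b \<in> Hom C V Y" and c: "c \<in> Hom C W X" and d: "d \<in> Hom C W Y"
  shows "(pair a b)\<degree> \<cdot> pair c d = (a\<degree> \<cdot> c) \<sqinter> (b\<degree> \<cdot> d)"
proof (rule le_antisym)
  note [simp] = a[unfolded Hom_iff] b[unfolded Hom_iff] c[unfolded Hom_iff] d[unfolded Hom_iff]
  define p q where "p = pl X Y" and "q = pr X Y"
  have pq [simp]: "p \<in> Arr C" "q \<in> Arr C" "Src C p = po X Y" "Src C q = po X Y" "Trg C p = X" "Trg C q = Y"
    "is_map C p" "is_map C q"
    by (simp_all add: p_def q_def)
  have pair_ab: "pair a b = (p\<degree> \<cdot> a) \<sqinter> (q\<degree> \<cdot> b)" and pair_cd: "pair c d = (p\<degree> \<cdot> c) \<sqinter> (q\<degree> \<cdot> d)"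
    by (simp_all add: pair_def p_def q_def)
  show "(pair a b)\<degree> \<cdot> pair c d \<sqsubseteq> (a\<degree> \<cdot> c) \<sqinter> (b\<degree> \<cdot> d)"
  proof (rule meetI)
    have "(pair a b)\<degree> \<cdot> pair c d \<sqsubseteq> (p\<degree> \<cdot> a)\<degree> \<cdot> (p\<degree> \<cdot> c)"
      unfolding pair_ab pair_cd by (intro Cmp_le invol_le meet_lower) simp_all
    also have "\<dots> = a\<degree> \<cdot> (p \<cdot> (p\<degree> \<cdot> c))" by simp
    also have "\<dots> \<sqsubseteq> a\<degree> \<cdot> c"
      by (intro Cmp_le_right functional_below map_functional) simp_all
    finally show "(pair a b)\<degree> \<cdot> pair c d \<sqsubseteq> a\<degree> \<cdot> c" .
    have "(pair a b)\<degree> \<cdot> pair c d \<sqsubseteq> (q\<degree> \<cdot> b)\<degree> \<cdot> (q\<degree> \<cdot> d)"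
      unfolding pair_ab pair_cd by (intro Cmp_le invol_le meet_lower) simp_all
    also have "\<dots> = b\<degree> \<cdot> (q \<cdot> (q\<degree> \<cdot> d))" by simp
    also have "\<dots> \<sqsubseteq> b\<degree> \<cdot> d"
      by (intro Cmp_le_right functional_below map_functional) simp_all
    finally show "(pair a b)\<degree> \<cdot> pair c d \<sqsubseteq> b\<degree> \<cdot> d" .
  qed
  define Q m n where "Q = po W V" and "m = pl W V" and "n = pr W V"
  have mn [simp]: "Q \<in> Ob C" "m \<in> Arr C" "n \<in> Arr C" "Src C m = Q" "Src C n = Q" "Trg C m = W" "Trg C n = V"
    "is_map C m" "is_map C n"
    by (simp_all add: Q_def m_def n_def)
  define t where "t = (a\<degree> \<cdot> c) \<sqinter> (b\<degree> \<cdot> d)"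
  have t [simp]: "t \<in> Arr C" "Src C t = W" "Trg C t = V" by (simp_all add: t_def)
  define x where "x = (a \<cdot> n) \<sqinter> (c \<cdot> m)"
  define y where "y = (b \<cdot> n) \<sqinter> (d \<cdot> m)"
  have xy [simp]: "x \<in> Arr C" "y \<in> Arr C" "Src C x = Q" "Src C y = Q" "Trg C x = X" "Trg C y = Y"
    by (simp_all add: x_def y_def)
  define z where "z = (p\<degree> \<cdot> x) \<sqinter> (q\<degree> \<cdot> y)"
  have z [simp]: "z \<in> Arr C" "Src C z = Q" "Trg C z = po X Y" by (simp_all add: z_def)
  \<comment> \<open>The coreflexive of \<open>t\<close>. It lies in the domains of \<open>x\<close> and \<open>y\<close>, hence in that of \<open>z\<close>.\<close>
  define k where "k = \<one> Q \<sqinter> (n\<degree> \<cdot> t \<cdot> m)"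
  have k [simp]: "k \<in> Arr C" "Src C k = Q" "Trg C k = Q" by (simp_all add: k_def)
  have "k \<sqsubseteq> \<one> Q \<sqinter> ((a \<cdot> n)\<degree> \<cdot> (c \<cdot> m))"
  proof -
    have "n\<degree> \<cdot> t \<cdot> m \<sqsubseteq> n\<degree> \<cdot> (a\<degree> \<cdot> c) \<cdot> m"
      unfolding t_def by (intro Cmp_le_right Cmp_le_left meet_lower) simp_all
    then show ?thesis unfolding k_def by (intro meet_le) simp_all
  qed
  also have "\<dots> \<sqsubseteq> x\<degree> \<cdot> x"
    unfolding x_def using coreflexive_le_dom_meet[of "a \<cdot> n" "c \<cdot> m"] by simp
  finally have kx: "k \<sqsubseteq> x\<degree> \<cdot> x" .
  have "k \<sqsubseteq> \<one> Q \<sqinter> ((b \<cdot> n)\<degree> \<cdot> (d \<cdot> m))"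
  proof -
    have "n\<degree> \<cdot> t \<cdot> m \<sqsubseteq> n\<degree> \<cdot> (b\<degree> \<cdot> d) \<cdot> m"
      unfolding t_def by (intro Cmp_le_right Cmp_le_left meet_lower) simp_all
    then show ?thesis unfolding k_def by (intro meet_le) simp_all
  qed
  also have "\<dots> \<sqsubseteq> y\<degree> \<cdot> y"
    unfolding y_def using coreflexive_le_dom_meet[of "b \<cdot> n" "d \<cdot> m"] by simp
  finally have ky: "k \<sqsubseteq> y\<degree> \<cdot> y" .
  have k1: "k \<sqsubseteq> \<one> Q" unfolding k_def by (intro meet_lower) simp_all
  have "k \<sqsubseteq> k \<cdot> (\<one> Q \<sqinter> (k\<degree> \<cdot> k))" using le_self_dom[of k] by simp
  also have "\<dots> \<sqsubseteq> k \<cdot> (k\<degree> \<cdot> k)" by (intro Cmp_le_right meet_lower) simp_all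
  also have "\<dots> \<sqsubseteq> k \<cdot> (\<one> Q \<cdot> k)"
    using invol_le[OF k1] by (intro Cmp_le_right Cmp_le_left) simp_all
  also have "\<dots> \<sqsubseteq> (x\<degree> \<cdot> x) \<cdot> (\<one> Q \<cdot> (y\<degree> \<cdot> y))"
    using kx ky by (intro Cmp_le le_refl) simp_all
  also have "\<dots> = x\<degree> \<cdot> ((x \<cdot> y\<degree>) \<cdot> y)" by simp
  also have "\<dots> \<sqsubseteq> x\<degree> \<cdot> (tp Y X \<cdot> y)"
    by (intro Cmp_le_right Cmp_le_left le_tp) simp_all
  also have "tp Y X = p \<cdot> q\<degree>"
    using arg_cong[OF pr_pl[of X Y], of invol] by (simp add: p_def q_def)
  finally have "k \<sqsubseteq> \<one> Q \<sqinter> ((p\<degree> \<cdot> x)\<degree> \<cdot> (q\<degree> \<cdot> y))"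
    using k1 by (intro meetI) simp_all
  also have "\<dots> \<sqsubseteq> z\<degree> \<cdot> z"
    unfolding z_def using coreflexive_le_dom_meet[of "p\<degree> \<cdot> x" "q\<degree> \<cdot> y"] by simp
  also have "\<dots> \<sqsubseteq> (pair a b \<cdot> n)\<degree> \<cdot> (pair c d \<cdot> m)"
  proof (intro Cmp_le invol_le)
    have "z \<sqsubseteq> (p\<degree> \<cdot> (a \<cdot> n)) \<sqinter> (q\<degree> \<cdot> (b \<cdot> n))"
      unfolding z_def x_def y_def by (intro meet_le Cmp_le_right meet_lower) simp_all
    then show "z \<sqsubseteq> pair a b \<cdot> n" unfolding pair_ab by (simp add: meet_map)
    have "z \<sqsubseteq> (p\<degree> \<cdot> (c \<cdot> m)) \<sqinter> (q\<degree> \<cdot> (d \<cdot> m))"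
      unfolding z_def x_def y_def by (intro meet_le Cmp_le_right meet_lower) simp_all
    then show "z \<sqsubseteq> pair c d \<cdot> m" unfolding pair_cd by (simp add: meet_map)
  qed simp_all
  finally have kle: "k \<sqsubseteq> n\<degree> \<cdot> ((pair a b)\<degree> \<cdot> pair c d) \<cdot> m" by simp
  have "t \<sqsubseteq> n \<cdot> k \<cdot> m\<degree>"
    using le_coreflexive_on_product[of t W V] by (simp add: k_def Q_def m_def n_def)
  also have "\<dots> \<sqsubseteq> n \<cdot> (n\<degree> \<cdot> ((pair a b)\<degree> \<cdot> pair c d) \<cdot> m) \<cdot> m\<degree>"
    using kle by (intro Cmp_le_right Cmp_le_left) simp_all
  also have "\<dots> = n \<cdot> (n\<degree> \<cdot> (((pair a b)\<degree> \<cdot> pair c d) \<cdot> (m \<cdot> m\<degree>)))" by simp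
  also have "\<dots> \<sqsubseteq> ((pair a b)\<degree> \<cdot> pair c d) \<cdot> (m \<cdot> m\<degree>)"
    by (intro functional_below map_functional) simp_all
  also have "\<dots> \<sqsubseteq> (pair a b)\<degree> \<cdot> pair c d"
    by (intro functional_below' map_functional) simp_all
  finally show "(a\<degree> \<cdot> c) \<sqinter> (b\<degree> \<cdot> d) \<sqsubseteq> (pair a b)\<degree> \<cdot> pair c d" by (simp add: t_def)
qed

lemma map_pair [simp]:
  assumes "is_map C f" "is_map C g" "Src C g = Src C f"
  shows "is_map C (pair f g)"
proof -
  note [simp] = map_Arr[OF assms(1)] map_Arr[OF assms(2)] assms
  define p q where "p = pl (Trg C f) (Trg C g)" and "q = pr (Trg C f) (Trg C g)"
  have pq [simp]: "p \<in> Arr C" "q \<in> Arr C" "Src C p = po (Trg C f) (Trg C g)"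
    "Src C q = po (Trg C f) (Trg C g)" "Trg C p = Trg C f" "Trg C q = Trg C g"
    "is_map C p" "is_map C q"
    by (simp_all add: p_def q_def)
  have "\<one> (Src C f) \<sqsubseteq> (f\<degree> \<cdot> f) \<sqinter> (g\<degree> \<cdot> g)"
    by (intro meetI map_total) simp_all
  also have "\<dots> = (pair f g)\<degree> \<cdot> pair f g"
    by (rule pair_sharp[of _ "Src C f" "Trg C f" _ "Trg C g" _ "Src C f", symmetric]) (simp_all add: Hom_iff)
  finally have 1: "\<one> (Src C f) \<sqsubseteq> (pair f g)\<degree> \<cdot> pair f g" .
  have "pair f g \<cdot> (pair f g)\<degree> \<sqsubseteq> (p\<degree> \<cdot> p) \<sqinter> (q\<degree> \<cdot> q)"
  proof (rule meetI)
    have "pair f g \<cdot> (pair f g)\<degree> \<sqsubseteq> (p\<degree> \<cdot> f) \<cdot> (p\<degree> \<cdot> f)\<degree>"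
      unfolding pair_def p_def[symmetric] q_def[symmetric]
      by (intro Cmp_le invol_le meet_lower) simp_all
    also have "\<dots> = p\<degree> \<cdot> (f \<cdot> f\<degree>) \<cdot> p" by simp
    also have "\<dots> \<sqsubseteq> p\<degree> \<cdot> \<one> (Trg C f) \<cdot> p"
      by (intro Cmp_le_right Cmp_le_left map_functional) simp_all
    finally show "pair f g \<cdot> (pair f g)\<degree> \<sqsubseteq> p\<degree> \<cdot> p" by simp
    have "pair f g \<cdot> (pair f g)\<degree> \<sqsubseteq> (q\<degree> \<cdot> g) \<cdot> (q\<degree> \<cdot> g)\<degree>"
      unfolding pair_def p_def[symmetric] q_def[symmetric]
      by (intro Cmp_le invol_le meet_lower) simp_all
    also have "\<dots> = q\<degree> \<cdot> (g \<cdot> g\<degree>) \<cdot> q" by simp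
    also have "\<dots> \<sqsubseteq> q\<degree> \<cdot> \<one> (Trg C g) \<cdot> q"
      by (intro Cmp_le_right Cmp_le_left map_functional) simp_all
    finally show "pair f g \<cdot> (pair f g)\<degree> \<sqsubseteq> q\<degree> \<cdot> q" by simp
  qed
  also have "\<dots> = \<one> (po (Trg C f) (Trg C g))"
    by (simp add: p_def q_def jointly_monic)
  finally show ?thesis using 1 by (simp add: map_iff)
qed

lemma pl_pair [simp]:
  assumes "r \<in> Arr C" "Trg C r = X" "is_map C f" "Trg C f = Y" "Src C f = Src C r"
  shows "pl X Y \<cdot> pair r f = r"
proof -
  have f [simp]: "f \<in> Arr C" using assms(3) by (rule map_Arr)
  have [simp]: "X \<in> Ob C" "Y \<in> Ob C" using assms f by (metis Trg_Ob)+
  note [simp] = assms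
  \<comment> \<open>The projection is the converse of a pairing, so sharpness applies although \<open>r\<close> need not be a map.\<close>
  have eq: "pair (\<one> X) (tp X Y) = (pl X Y)\<degree>"
    using le_tp[of "(pl X Y)\<degree>" X "po X Y"] by (simp add: pair_def invol_map_tp meet_absorb)
  have "pl X Y \<cdot> pair r f = (pair (\<one> X) (tp X Y))\<degree> \<cdot> pair r f"
    unfolding eq by simp
  also have "\<dots> = ((\<one> X)\<degree> \<cdot> r) \<sqinter> ((tp X Y)\<degree> \<cdot> f)"
    by (rule pair_sharp[of _ X X _ Y _ "Src C r"]) (simp_all add: Hom_iff)
  also have "\<dots> = r \<sqinter> tp (Src C r) X"
    by (simp add: tp_map)
  also have "\<dots> = r" by (intro meet_absorb le_tp) simp_all
  finally show ?thesis .
qed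

lemma pr_pair [simp]:
  assumes "r \<in> Arr C" "Trg C r = Y" "is_map C f" "Trg C f = X" "Src C f = Src C r"
  shows "pr X Y \<cdot> pair f r = r"
proof -
  have f [simp]: "f \<in> Arr C" using assms(3) by (rule map_Arr)
  have [simp]: "X \<in> Ob C" "Y \<in> Ob C" using assms f by (metis Trg_Ob)+
  note [simp] = assms
  have eq: "pair (tp Y X) (\<one> Y) = (pr X Y)\<degree>"
    using le_tp[of "(pr X Y)\<degree>" Y "po X Y"]
    by (simp add: pair_def invol_map_tp meet_absorb meet_comm[of "tp Y (po X Y)"])
  have "pr X Y \<cdot> pair f r = (pair (tp Y X) (\<one> Y))\<degree> \<cdot> pair f r"
    unfolding eq by simp
  also have "\<dots> = ((tp Y X)\<degree> \<cdot> f) \<sqinter> ((\<one> Y)\<degree> \<cdot> r)"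
    by (rule pair_sharp[of _ Y X _ Y _ "Src C r"]) (simp_all add: Hom_iff)
  also have "\<dots> = r \<sqinter> tp (Src C r) Y"
    by (simp add: tp_map meet_comm)
  also have "\<dots> = r" by (intro meet_absorb le_tp) simp_all
  finally show ?thesis .
qed

lemma pair_map [simp]:
  assumes "is_map C h" "c \<in> Arr C" "d \<in> Arr C" "Src C c = Trg C h" "Src C d = Trg C h"
  shows "pair c d \<cdot> h = pair (c \<cdot> h) (d \<cdot> h)"
  using assms map_Arr[OF assms(1)] by (simp add: pair_def meet_map)

lemma pair_projections [simp]: "\<lbrakk>X \<in> Ob C; Y \<in> Ob C\<rbrakk> \<Longrightarrow> pair (pl X Y) (pr X Y) = \<one> (po X Y)"
  by (simp add: pair_def jointly_monic)

lemma pair_projections_map [simp]: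
  assumes "is_map C h" "Trg C h = po X Y" "X \<in> Ob C" "Y \<in> Ob C"
  shows "pair (pl X Y \<cdot> h) (pr X Y \<cdot> h) = h"
proof -
  have "pair (pl X Y) (pr X Y) \<cdot> h = h"
    using assms map_Arr[OF assms(1)] by (simp del: pair_map)
  then show ?thesis using assms map_Arr[OF assms(1)] by (simp del: pair_projections)
qed

lemma pair_le:
  assumes "c \<sqsubseteq> c'" "d \<sqsubseteq> d'" "Src C d = Src C c"
  shows "pair c d \<sqsubseteq> pair c' d'"
proof -
  have "c \<in> Arr C" "c' \<in> Arr C" "d \<in> Arr C" "d' \<in> Arr C" "Trg C c = Trg C c'" "Trg C d = Trg C d'"
    using assms by (auto simp: le_def)
  then show ?thesis
    unfolding pair_def using assms by (intro meet_le) (simp_all add: Cmp_le_right)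
qed

definition ten :: "'b \<Rightarrow> 'b \<Rightarrow> 'b"
  where "ten r s = pair (r \<cdot> pl (Src C r) (Src C s)) (s \<cdot> pr (Src C r) (Src C s))"

lemma ten_simps [simp]:
  assumes "r \<in> Arr C" "s \<in> Arr C"
  shows "ten r s \<in> Arr C" "Src C (ten r s) = po (Src C r) (Src C s)"
    "Trg C (ten r s) = po (Trg C r) (Trg C s)"
  using assms by (simp_all add: ten_def)

lemma ten_pair [simp]:
  assumes "r \<in> Arr C" "s \<in> Arr C" "c \<in> Arr C" "d \<in> Arr C" "Trg C c = Src C r" "Trg C d = Src C s"
    "Src C d = Src C c"
  shows "ten r s \<cdot> pair c d = pair (r \<cdot> c) (s \<cdot> d)"
proof -
  note [simp] = assms
  define p q p' q' where "p = pl (Src C r) (Src C s)" and "q = pr (Src C r) (Src C s)"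
    and "p' = pl (Trg C r) (Trg C s)" and "q' = pr (Trg C r) (Trg C s)"
  have pq [simp]: "p \<in> Arr C" "q \<in> Arr C" "p' \<in> Arr C" "q' \<in> Arr C"
    "Src C p = po (Src C r) (Src C s)" "Src C q = po (Src C r) (Src C s)" "Trg C p = Src C r" "Trg C q = Src C s"
    "Src C p' = po (Trg C r) (Trg C s)" "Src C q' = po (Trg C r) (Trg C s)" "Trg C p' = Trg C r" "Trg C q' = Trg C s"
    by (simp_all add: p_def q_def p'_def q'_def)
  have "(pair (r\<degree> \<cdot> p') (s\<degree> \<cdot> q'))\<degree> = ten r s"
    by (simp add: ten_def pair_def p_def[symmetric] q_def[symmetric] p'_def[symmetric] q'_def[symmetric])
  moreover have "(pair (r\<degree> \<cdot> p') (s\<degree> \<cdot> q'))\<degree> \<cdot> pair c d =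
      ((r\<degree> \<cdot> p')\<degree> \<cdot> c) \<sqinter> ((s\<degree> \<cdot> q')\<degree> \<cdot> d)"
    by (rule pair_sharp[of _ "po (Trg C r) (Trg C s)" "Src C r" _ "Src C s" _ "Src C c"])
      (simp_all add: Hom_iff)
  ultimately show ?thesis
    by (simp add: pair_def p'_def[symmetric] q'_def[symmetric])
qed

text \<open>
  An isomorphism is the converse of its inverse, so sharpness also computes its effect on pairings
  of arrows that are not maps.
\<close>

lemma iso_invol: "inverse_arrows C f g \<Longrightarrow> f = g\<degree>"
  using adjoint_invol[OF adjoint_inverse, of f g] by (auto simp: inverse_arrows_def Hom_iff)

definition asc :: "'a \<Rightarrow> 'a \<Rightarrow> 'a \<Rightarrow> 'b"
  where "asc X Y Z = pair (pl X Y \<cdot> pl (po X Y) Z) (pair (pr X Y \<cdot> pl (po X Y) Z) (pr (po X Y) Z))"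

definition asc' :: "'a \<Rightarrow> 'a \<Rightarrow> 'a \<Rightarrow> 'b"
  where "asc' X Y Z = pair (pair (pl X (po Y Z)) (pl Y Z \<cdot> pr X (po Y Z))) (pr Y Z \<cdot> pr X (po Y Z))"

definition swp :: "'a \<Rightarrow> 'a \<Rightarrow> 'b"
  where "swp X Y = pair (pr X Y) (pl X Y)"

lemma asc_inverse: "\<lbrakk>X \<in> Ob C; Y \<in> Ob C; Z \<in> Ob C\<rbrakk> \<Longrightarrow> inverse_arrows C (asc X Y Z) (asc' X Y Z)"
  by (simp add: inverse_arrows_def asc_def asc'_def Hom_iff)

lemma swp_inverse: "\<lbrakk>X \<in> Ob C; Y \<in> Ob C\<rbrakk> \<Longrightarrow> inverse_arrows C (swp X Y) (swp Y X)"
  by (simp add: inverse_arrows_def swp_def Hom_iff)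

lemma lun_inverse: "X \<in> Ob C \<Longrightarrow> inverse_arrows C (pr unt X) (pair (bang X) (\<one> X))"
  using map_into_unt[of "pl unt X"] pair_projections[of unt X]
  by (simp add: inverse_arrows_def Hom_iff)

lemma run_inverse: "X \<in> Ob C \<Longrightarrow> inverse_arrows C (pl X unt) (pair (\<one> X) (bang X))"
  using map_into_unt[of "pr X unt"] pair_projections[of X unt]
  by (simp add: inverse_arrows_def Hom_iff)

lemma swp_pair:
  assumes "u \<in> Hom C W X" "v \<in> Hom C W Y"
  shows "swp X Y \<cdot> pair u v = pair v u"
proof -
  note [simp] = assms[unfolded Hom_iff]
  have "swp X Y \<cdot> pair u v = (pair (pr Y X) (pl Y X))\<degree> \<cdot> pair u v"
    using iso_invol[OF swp_inverse[of X Y]] by (simp add: swp_def)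
  also have "\<dots> = ((pr Y X)\<degree> \<cdot> u) \<sqinter> ((pl Y X)\<degree> \<cdot> v)"
    by (rule pair_sharp[of _ "po Y X" X _ Y _ W]) (simp_all add: Hom_iff)
  also have "\<dots> = pair v u"
    by (simp add: pair_def meet_comm)
  finally show ?thesis .
qed

lemma asc_pair:
  assumes "u \<in> Hom C W X" "v \<in> Hom C W Y" "w \<in> Hom C W Z"
  shows "asc X Y Z \<cdot> pair (pair u v) w = pair u (pair v w)"
proof -
  note [simp] = assms[unfolded Hom_iff]
  define p q where "p = pl X (po Y Z)" and "q = pr X (po Y Z)"
  have pq [simp]: "p \<in> Arr C" "q \<in> Arr C" "Src C p = po X (po Y Z)" "Src C q = po X (po Y Z)"
    "Trg C p = X" "Trg C q = po Y Z" "is_map C p" "is_map C q"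
    by (simp_all add: p_def q_def)
  have "asc X Y Z \<cdot> pair (pair u v) w = (pair (pair p (pl Y Z \<cdot> q)) (pr Y Z \<cdot> q))\<degree> \<cdot> pair (pair u v) w"
    using iso_invol[OF asc_inverse[of X Y Z]] by (simp add: asc'_def p_def q_def)
  also have "\<dots> = ((pair p (pl Y Z \<cdot> q))\<degree> \<cdot> pair u v) \<sqinter> ((pr Y Z \<cdot> q)\<degree> \<cdot> w)"
    by (rule pair_sharp[of _ "po X (po Y Z)" "po X Y" _ Z _ W]) (simp_all add: Hom_iff)
  also have "(pair p (pl Y Z \<cdot> q))\<degree> \<cdot> pair u v = (p\<degree> \<cdot> u) \<sqinter> ((pl Y Z \<cdot> q)\<degree> \<cdot> v)"
    by (rule pair_sharp[of _ "po X (po Y Z)" X _ Y _ W]) (simp_all add: Hom_iff)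
  also have "((p\<degree> \<cdot> u) \<sqinter> ((pl Y Z \<cdot> q)\<degree> \<cdot> v)) \<sqinter> ((pr Y Z \<cdot> q)\<degree> \<cdot> w) =
      (p\<degree> \<cdot> u) \<sqinter> ((q\<degree> \<cdot> ((pl Y Z)\<degree> \<cdot> v)) \<sqinter> (q\<degree> \<cdot> ((pr Y Z)\<degree> \<cdot> w)))"
    by (simp add: meet_assoc)
  also have "\<dots> = (p\<degree> \<cdot> u) \<sqinter> (q\<degree> \<cdot> (((pl Y Z)\<degree> \<cdot> v) \<sqinter> ((pr Y Z)\<degree> \<cdot> w)))"
    by (subst invol_map_meet) simp_all
  also have "\<dots> = pair u (pair v w)"
    by (simp add: pair_def p_def q_def)
  finally show ?thesis .
qed

section \<open>The bicategory of relations of a unitary pre-tabular allegory\<close>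

definition product_monoidal :: "('a, 'b) monoidal"
  where "product_monoidal = \<lparr>TenO = po, TenA = ten, UnitO = unt, Assoc = asc, LUnit = pr unt,
    RUnit = (\<lambda>X. pl X unt), Swap = swp, Diag = (\<lambda>X. pair (\<one> X) (\<one> X)), Aug = bang\<rparr>"

lemma product_monoidal_simps [simp]:
  "TenO product_monoidal = po" "TenA product_monoidal = ten" "UnitO product_monoidal = unt" "Assoc product_monoidal = asc" "LUnit product_monoidal = pr unt"
  "RUnit product_monoidal X = pl X unt" "Swap product_monoidal = swp" "Diag product_monoidal X = pair (\<one> X) (\<one> X)" "Aug product_monoidal = bang"
  by (simp_all add: product_monoidal_def)

lemma asc_simps [simp]:
  assumes "X \<in> Ob C" "Y \<in> Ob C" "Z \<in> Ob C"
  shows "asc X Y Z \<in> Arr C" "Src C (asc X Y Z) = po (po X Y) Z" "Trg C (asc X Y Z) = po X (po Y Z)"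
    "is_map C (asc X Y Z)"
  using assms by (simp_all add: asc_def)

lemma swp_simps [simp]:
  assumes "X \<in> Ob C" "Y \<in> Ob C"
  shows "swp X Y \<in> Arr C" "Src C (swp X Y) = po X Y" "Trg C (swp X Y) = po Y X" "is_map C (swp X Y)"
  using assms by (simp_all add: swp_def)

lemma isos:
  assumes "X \<in> Ob C"
  shows "is_iso C (pr unt X)" "is_iso C (pl X unt)"
    and "Y \<in> Ob C \<Longrightarrow> Z \<in> Ob C \<Longrightarrow> is_iso C (asc X Y Z)"
  using lun_inverse run_inverse asc_inverse assms unfolding is_iso_def by blast+

lemma ten_Idn: "\<lbrakk>X \<in> Ob C; Y \<in> Ob C\<rbrakk> \<Longrightarrow> ten (\<one> X) (\<one> Y) = \<one> (po X Y)"
  by (simp add: ten_def)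

lemma ten_Cmp:
  assumes "f \<in> Hom C X X'" "f' \<in> Hom C X' X''" "g \<in> Hom C Y Y'" "g' \<in> Hom C Y' Y''"
  shows "ten (f' \<cdot> f) (g' \<cdot> g) = ten f' g' \<cdot> ten f g"
proof -
  note [simp] = assms[unfolded Hom_iff]
  have "ten f' g' \<cdot> ten f g = ten f' g' \<cdot> pair (f \<cdot> pl X Y) (g \<cdot> pr X Y)"
    by (simp add: ten_def[of f g] del: ten_pair)
  then show ?thesis by (simp add: ten_def[of "f' \<cdot> f"])
qed

lemma ten_le:
  assumes "f \<sqsubseteq> f'" "g \<sqsubseteq> g'"
  shows "ten f g \<sqsubseteq> ten f' g'"
proof -
  have "f \<in> Arr C" "f' \<in> Arr C" "g \<in> Arr C" "g' \<in> Arr C" "Src C f = Src C f'" "Src C g = Src C g'"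
    using assms by (auto simp: le_def)
  then show ?thesis
    unfolding ten_def using assms by (intro pair_le) (simp_all add: Cmp_le_left)
qed

lemma asc_natural:
  assumes "f \<in> Hom C X X'" "g \<in> Hom C Y Y'" "h \<in> Hom C Z Z'"
  shows "asc X' Y' Z' \<cdot> ten (ten f g) h = ten f (ten g h) \<cdot> asc X Y Z"
proof -
  note [simp] = assms[unfolded Hom_iff]
  have "ten (ten f g) h = pair (pair (f \<cdot> pl X Y \<cdot> pl (po X Y) Z) (g \<cdot> pr X Y \<cdot> pl (po X Y) Z)) (h \<cdot> pr (po X Y) Z)"
    by (simp add: ten_def)
  then have "asc X' Y' Z' \<cdot> ten (ten f g) h =
      pair (f \<cdot> pl X Y \<cdot> pl (po X Y) Z) (pair (g \<cdot> pr X Y \<cdot> pl (po X Y) Z) (h \<cdot> pr (po X Y) Z))"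
    by (simp add: asc_pair[of _ "po (po X Y) Z"] Hom_iff)
  then show ?thesis by (simp add: asc_def)
qed

lemma swp_natural:
  assumes "f \<in> Hom C X X'" "g \<in> Hom C Y Y'"
  shows "swp X' Y' \<cdot> ten f g = ten g f \<cdot> swp X Y"
proof -
  note [simp] = assms[unfolded Hom_iff]
  have "swp X' Y' \<cdot> ten f g = pair (g \<cdot> pr X Y) (f \<cdot> pl X Y)"
    using swp_pair[of "f \<cdot> pl X Y" "po X Y" X' "g \<cdot> pr X Y" Y'] by (simp add: Hom_iff ten_def[of f g])
  then show ?thesis by (simp add: swp_def)
qed

lemma triangle_product: "\<lbrakk>X \<in> Ob C; Y \<in> Ob C\<rbrakk>
    \<Longrightarrow> ten (\<one> X) (pr unt Y) \<cdot> asc X unt Y = ten (pl X unt) (\<one> Y)"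
  by (simp add: asc_def) (simp add: ten_def)

lemma pentagon_product: "\<lbrakk>W \<in> Ob C; X \<in> Ob C; Y \<in> Ob C; Z \<in> Ob C\<rbrakk>
    \<Longrightarrow> asc W X (po Y Z) \<cdot> asc (po W X) Y Z =
      ten (\<one> W) (asc X Y Z) \<cdot> asc W (po X Y) Z \<cdot> ten (asc W X Y) (\<one> Z)"
  by (simp add: asc_def ten_def)

lemma hexagon_product: "\<lbrakk>X \<in> Ob C; Y \<in> Ob C; Z \<in> Ob C\<rbrakk>
    \<Longrightarrow> asc Y Z X \<cdot> swp X (po Y Z) \<cdot> asc X Y Z =
      ten (\<one> Y) (swp X Z) \<cdot> asc Y X Z \<cdot> ten (swp X Y) (\<one> Z)"
  by (simp add: asc_def swp_def) (simp add: ten_def)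

lemma monoidal_product: "symmetric_monoidal_2_category C product_monoidal"
proof (unfold_locales, unfold product_monoidal_simps)
  show "ten f g \<preceq> ten f' g'"
    if "f \<in> Hom C X X'" "f' \<in> Hom C X X'" "g \<in> Hom C Y Y'" "g' \<in> Hom C Y Y'" "f \<preceq> f'" "g \<preceq> g'"
    for X X' Y Y' f f' g g'
    by (rule leD[OF ten_le[OF leI[OF that(1,2,5)] leI[OF that(3,4,6)]]])
  show "swp Y X \<cdot> swp X Y = \<one> (po X Y)" if "X \<in> Ob C" "Y \<in> Ob C" for X Y
    using swp_inverse[OF that] that by (simp add: inverse_arrows_def)
  show "pr unt X' \<cdot> ten (\<one> unt) f = f \<cdot> pr unt X" if "f \<in> Hom C X X'" for f X X'
    using that by (simp add: ten_def Hom_iff)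
  show "pl X' unt \<cdot> ten f (\<one> unt) = f \<cdot> pl X unt" if "f \<in> Hom C X X'" for f X X'
    using that by (simp add: ten_def Hom_iff)
qed (simp_all add: isos ten_Idn ten_Cmp asc_natural swp_natural triangle_product pentagon_product
      hexagon_product, simp_all add: Hom_iff)

lemma comonoid_product:
  assumes [simp]: "X \<in> Ob C"
  shows "map_comonoid C product_monoidal X (pair (\<one> X) (\<one> X)) (bang X)"
  by (simp add: map_comonoid_def asc_def swp_def Hom_iff)

text \<open>The counit laws say that both projections of \<open>d\<close> are identities.\<close>

lemma comonoid_product_unique:
  assumes X [simp]: "X \<in> Ob C" and de: "map_comonoid C product_monoidal X d e"
  shows "d = pair (\<one> X) (\<one> X) \<and> e = bang X"
proof
  have d [simp]: "d \<in> Arr C" "Src C d = X" "Trg C d = po X X" "is_map C d"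
    and e [simp]: "e \<in> Arr C" "Src C e = X" "Trg C e = unt" "is_map C e"
    and counits: "pr unt X \<cdot> ten e (\<one> X) \<cdot> d = \<one> X" "pl X unt \<cdot> ten (\<one> X) e \<cdot> d = \<one> X"
    using de by (simp_all add: map_comonoid_def Hom_iff)
  show "e = bang X" using map_into_unt[of e] by simp
  have "pr X X \<cdot> d = \<one> X" "pl X X \<cdot> d = \<one> X"
    using counits by (simp_all add: ten_def)
  then show "d = pair (\<one> X) (\<one> X)"
    using pair_projections_map[of d X X] by simp
qed

lemma lax_diagonal:
  assumes "r \<in> Hom C X Y"
  shows "pair (\<one> Y) (\<one> Y) \<cdot> r \<sqsubseteq> ten r r \<cdot> pair (\<one> X) (\<one> X)"
proof -
  note [simp] = assms[unfolded Hom_iff]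
  have "pair (\<one> Y) (\<one> Y) \<cdot> r \<sqsubseteq> ((pl Y Y)\<degree> \<cdot> r) \<sqinter> ((pr Y Y)\<degree> \<cdot> r)"
    unfolding pair_def by (intro meetI Cmp_le_left meet_coarser) simp_all
  then show ?thesis by (simp add: pair_def[of r r])
qed

text \<open>
  Both sides of the Frobenius law are the coreflexive of \<open>po X X\<close> on which the two projections agree.
\<close>

lemma Frobenius_product:
  assumes X [simp]: "X \<in> Ob C"
  defines "d \<equiv> pair (\<one> X) (\<one> X)"
  shows "d \<cdot> d\<degree> = ten (d\<degree>) (\<one> X) \<cdot> asc' X X X \<cdot> ten (\<one> X) d"
proof -
  define p q where "p = pl X X" and "q = pr X X"
  have pq [simp]: "p \<in> Arr C" "q \<in> Arr C" "Src C p = po X X" "Src C q = po X X"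
    "Trg C p = X" "Trg C q = X" "is_map C p" "is_map C q"
    by (simp_all add: p_def q_def)
  have d: "d = p\<degree> \<sqinter> q\<degree>" by (simp add: d_def pair_def p_def q_def)
  have d' [simp]: "d \<in> Arr C" "Src C d = X" "Trg C d = po X X" "is_map C d"
    by (simp_all add: d_def)
  have dd: "d\<degree> \<cdot> d = \<one> X"
    using pair_sharp[of "\<one> X" X X "\<one> X" X "\<one> X" X "\<one> X"] meet_absorb[of "\<one> X" "\<one> X"]
    by (simp add: d_def Hom_iff)
  have mono: "(p\<degree> \<cdot> p) \<sqinter> (q\<degree> \<cdot> q) = \<one> (po X X)"
    by (simp add: p_def q_def jointly_monic)
  have left: "f\<degree> \<cdot> (p \<sqinter> q) = (f\<degree> \<cdot> p) \<sqinter> (f\<degree> \<cdot> q)" if "f \<in> {p, q}" for f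
    using that by (intro invol_map_meet) auto
  have "d \<cdot> d\<degree> = (p\<degree> \<cdot> d\<degree>) \<sqinter> (q\<degree> \<cdot> d\<degree>)"
    by (subst (1) d, rule meet_functional) (simp_all add: dd)
  also have "\<dots> = ((p\<degree> \<cdot> p) \<sqinter> (p\<degree> \<cdot> q)) \<sqinter> ((q\<degree> \<cdot> p) \<sqinter> (q\<degree> \<cdot> q))"
    by (simp add: d left)
  also have "\<dots> = \<one> (po X X) \<sqinter> (p\<degree> \<cdot> q)"
  proof (rule le_antisym)
    let ?l = "((p\<degree> \<cdot> p) \<sqinter> (p\<degree> \<cdot> q)) \<sqinter> ((q\<degree> \<cdot> p) \<sqinter> (q\<degree> \<cdot> q))"
    have "?l \<sqsubseteq> p\<degree> \<cdot> p" "?l \<sqsubseteq> p\<degree> \<cdot> q" "?l \<sqsubseteq> q\<degree> \<cdot> q"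
      by (simp_all add: meet_coarser meet_lower)
    then show "?l \<sqsubseteq> \<one> (po X X) \<sqinter> (p\<degree> \<cdot> q)"
      unfolding mono[symmetric] by (intro meetI)
    let ?r = "\<one> (po X X) \<sqinter> (p\<degree> \<cdot> q)"
    have 1: "?r \<sqsubseteq> \<one> (po X X)" by (intro meet_lower) simp_all
    have "?r \<sqsubseteq> p\<degree> \<cdot> p" "?r \<sqsubseteq> q\<degree> \<cdot> q"
      using 1 unfolding mono[symmetric] by (simp_all add: le_meet)
    moreover have "?r \<sqsubseteq> p\<degree> \<cdot> q" by (intro meet_lower) simp_all
    moreover have "?r \<sqsubseteq> q\<degree> \<cdot> p"
      using coreflexive_le_invol[of "p\<degree> \<cdot> q" "po X X"] by simp
    ultimately show "?r \<sqsubseteq> ?l" by (intro meetI)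
  qed
  also have "\<dots> = ((p\<degree> \<cdot> p) \<sqinter> (p\<degree> \<cdot> q)) \<sqinter> (q\<degree> \<cdot> q)"
    unfolding mono[symmetric] by (simp add: meet_assoc meet_comm[of "q\<degree> \<cdot> q"])
  also have "\<dots> = pair (d\<degree>) q"
    by (simp add: pair_def p_def[symmetric] q_def[symmetric] d left)
  also have "\<dots> = ten (d\<degree>) (\<one> X) \<cdot> pair (\<one> (po X X)) q" by simp
  also have "pair (\<one> (po X X)) q = asc' X X X \<cdot> ten (\<one> X) d"
    by (simp add: asc'_def ten_def d_def q_def)
  finally show ?thesis .
qed

theorem relations_product: "bicategory_of_relations C product_monoidal"
proof -
  interpret P: symmetric_monoidal_2_category C product_monoidal by (rule monoidal_product)
  show ?thesis
  proof (unfold_locales, unfold product_monoidal_simps)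
    show "pair (\<one> Y) (\<one> Y) \<cdot> r \<preceq> ten r r \<cdot> pair (\<one> X) (\<one> X)" if "r \<in> Hom C X Y" for r X Y
      using lax_diagonal[OF that] by (rule leD)
    show "bang Y \<cdot> r \<preceq> bang X" if "r \<in> Hom C X Y" for r X Y
      using that le_bang[of "bang Y \<cdot> r"] by (intro leD) (simp add: Hom_iff)
    show "pair (\<one> X) (\<one> X) \<cdot> radj C (pair (\<one> X) (\<one> X)) =
        ten (radj C (pair (\<one> X) (\<one> X))) (\<one> X) \<cdot> inv_arr C (asc X X X) \<cdot> ten (\<one> X) (pair (\<one> X) (\<one> X))"
      if "X \<in> Ob C" for X
      using Frobenius_product[OF that] that inv_arr_eqI[OF asc_inverse[of X X X]]
      by (simp add: radj_invol del: ten_pair)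
  qed (use comonoid_product comonoid_product_unique in blast)+
qed

text \<open>
  The allegory structure is determined by the ordered category: meets are order-theoretic, and
  every arrow is \<open>n \<cdot> k \<cdot> m\<degree>\<close> with maps \<open>m\<close>, \<open>n\<close> and a coreflexive \<open>k\<close>, whose converses are forced to
  be the right adjoints and \<open>k\<close> itself.
\<close>

lemma coreflexive_factorization:
  assumes "r \<in> Arr C" "Src C r = X" "Trg C r = Y"
  shows "r = pr X Y \<cdot> (\<one> (po X Y) \<sqinter> ((pr X Y)\<degree> \<cdot> r \<cdot> pl X Y)) \<cdot> (pl X Y)\<degree>"
proof (rule le_antisym[OF le_coreflexive_on_product[OF assms]])
  have [simp]: "X \<in> Ob C" "Y \<in> Ob C" using assms by auto
  note [simp] = assms
  have "pr X Y \<cdot> (\<one> (po X Y) \<sqinter> ((pr X Y)\<degree> \<cdot> r \<cdot> pl X Y)) \<cdot> (pl X Y)\<degree> \<sqsubseteq>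
      pr X Y \<cdot> ((pr X Y)\<degree> \<cdot> r \<cdot> pl X Y) \<cdot> (pl X Y)\<degree>"
    by (intro Cmp_le_right Cmp_le_left meet_lower) simp_all
  also have "\<dots> = pr X Y \<cdot> ((pr X Y)\<degree> \<cdot> (r \<cdot> (pl X Y \<cdot> (pl X Y)\<degree>)))" by simp
  also have "\<dots> \<sqsubseteq> r \<cdot> (pl X Y \<cdot> (pl X Y)\<degree>)"
    by (intro functional_below map_functional) simp_all
  also have "\<dots> \<sqsubseteq> r"
    by (intro functional_below' map_functional) simp_all
  finally show "pr X Y \<cdot> (\<one> (po X Y) \<sqinter> ((pr X Y)\<degree> \<cdot> r \<cdot> pl X Y)) \<cdot> (pl X Y)\<degree> \<sqsubseteq> r" .
qed

lemma meet_unique: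
  assumes "allegory C meet' invol'" "r \<in> Hom C X Y" "s \<in> Hom C X Y"
  shows "meet' r s = r \<sqinter> s"
proof -
  interpret A: allegory C meet' invol' by (rule assms(1))
  show ?thesis
    using assms(2,3) by (intro le_antisym meetI A.meetI meet_lower A.meet_lower) (simp_all add: Hom_iff)
qed

lemma invol_unique:
  assumes "allegory C meet' invol'" "r \<in> Arr C"
  shows "invol' r = r\<degree>"
proof -
  interpret A: allegory C meet' invol' by (rule assms(1))
  define X Y where "X = Src C r" and "Y = Trg C r"
  define m n k where "m = pl X Y" and "n = pr X Y" and "k = \<one> (po X Y) \<sqinter> (n\<degree> \<cdot> r \<cdot> m)"
  have [simp]: "r \<in> Arr C" "Src C r = X" "Trg C r = Y" "X \<in> Ob C" "Y \<in> Ob C"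
    using assms(2) by (auto simp: X_def Y_def)
  have mn [simp]: "m \<in> Arr C" "n \<in> Arr C" "Src C m = po X Y" "Src C n = po X Y" "Trg C m = X" "Trg C n = Y"
    "is_map C m" "is_map C n"
    by (simp_all add: m_def n_def)
  have k [simp]: "k \<in> Arr C" "Src C k = po X Y" "Trg C k = po X Y"
    by (simp_all add: k_def)
  have k1: "k \<sqsubseteq> \<one> (po X Y)" unfolding k_def by (intro meet_lower) simp_all
  have r: "r = n \<cdot> k \<cdot> m\<degree>"
    using coreflexive_factorization[of r X Y] by (simp add: k_def m_def n_def)
  have maps: "invol' f = f\<degree>" if "is_map C f" for f
    using A.radj_invol[OF that] radj_invol[OF that] by simp
  have m': "invol' (m\<degree>) = m"
    using maps[of m] A.invol_simps(4)[of m] by simp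
  have k': "invol' k = k" "k\<degree> = k"
    using k1 coreflexive_invol A.coreflexive_invol by simp_all
  have "invol' r = (invol' (m\<degree>) \<cdot> invol' k) \<cdot> invol' n"
    by (subst r) simp
  also have "\<dots> = m \<cdot> k \<cdot> n\<degree>"
    by (simp add: m' k' maps)
  also have "\<dots> = r\<degree>" using arg_cong[OF r, of invol] by (simp add: k')
  finally show ?thesis .
qed

end

theorem mainTheorem6:
  fixes C :: "('o, 'a) cat2"
  shows "(\<forall>M. bicategory_of_relations C M \<longrightarrow>
            unitary_pre_tabular_allegory C (local_product C M) (transpose_arr C M)) \<and>
         (\<forall>meet invol. unitary_pre_tabular_allegory C meet invol \<longrightarrow>
            (\<exists>M. bicategory_of_relations C M \<and>
              (\<forall>r \<in> Arr C. transpose_arr C M r = invol r) \<and>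
              (\<forall>X Y. \<forall>r \<in> Hom C X Y. \<forall>s \<in> Hom C X Y. local_product C M r s = meet r s)))"
proof (intro conjI allI impI)
  fix M :: "('o, 'a) monoidal" assume "bicategory_of_relations C M"
  then interpret bicategory_of_relations C M .
  show "unitary_pre_tabular_allegory C (local_product C M) (transpose_arr C M)"
    by (rule unitary_pre_tabular_of_relations)
next
  fix meet :: "'a \<Rightarrow> 'a \<Rightarrow> 'a" and invol :: "'a \<Rightarrow> 'a"
  assume "unitary_pre_tabular_allegory C meet invol"
  then interpret unitary_pre_tabular_allegory C meet invol .
  interpret R: bicategory_of_relations C product_monoidal by (rule relations_product)
  show "\<exists>M. bicategory_of_relations C M \<and> (\<forall>r \<in> Arr C. transpose_arr C M r = invol r) \<and>
      (\<forall>X Y. \<forall>r \<in> Hom C X Y. \<forall>s \<in> Hom C X Y. local_product C M r s = meet r s)"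
    using relations_product invol_unique[OF R.allegory_of_relations] meet_unique[OF R.allegory_of_relations]
    by blast
qed

end
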